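(* Let $\alpha>0$ and $q\in(2,2_\alpha^* )$. Let $\|\cdot\|_{H^\alpha(\mathbb{R}^N)}$ be the norm $$\|f\|_{H^\alpha}=\left(\int_{\mathbb{R}^N}(1+|\xi|^2)^\alpha|\widehat f(\xi)|^2\,d\xi\right)^{1/2}$$ or any other equivalent Hilbert norm on $H^\alpha(\mathbb{R}^N)$ which is invariant under lattice translations $u\mapsto u(\cdot-y)$, $y\in\mathbb{Z}^N$. Then the infimum $$\kappa:=\inf_{\|u\|_{L^q(\mathbb{R}^N)}=1}\|u\|_{H^\alpha(\mathbb{R}^N)}^2,$$ taken over $u\in H^\alpha(\mathbb{R}^N)$, is attained.
   Context: $H^\alpha(\mathbb{R}^N)=W^{\alpha,2}(\mathbb{R}^N)$ is the Hilbert space of $f\in L^2(\mathbb{R}^N)$ for which $(1+|\xi|^2)^{\alpha/2}\widehat f(\xi)\in L^2(\mathbb{R}^N)$. The critical exponent is $2_\alpha^*=\frac{2N}{N-2\alpha}$ if $N>2\alpha$ and $2_\alpha^*=\infty$ if $N\le2\alpha$. $H^\alpha(\mathbb{R}^N)$ is continuously imbedded in $L^q(\mathbb{R}^N)$ for the $q$ considered. A Hilbert norm is a norm induced by an inner product. *)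

theory Defs
  imports "HOL-Analysis.Analysis"
begin

text \<open>
  Elements of \<open>L\<^sup>2\<close>, \<open>L\<^sup>q\<close> and \<open>H\<^sup>\<alpha>\<close> are represented by functions into \<^typ>\<open>complex\<close>, and two
  functions that agree almost everywhere represent the same element. The set \<open>K\<close> of scalars is
  \<open>\<real>\<close> (real function spaces) or \<^term>\<open>UNIV\<close> (complex function spaces).
\<close>

definition square_integrable :: "(real ^ 'n \<Rightarrow> complex) \<Rightarrow> bool" where
  "square_integrable f \<longleftrightarrow>
     f \<in> borel_measurable lborel \<and> integrable lborel (\<lambda>x. (norm (f x))\<^sup>2)"

text \<open>If \<open>|f|\<^sup>q\<close> is not integrable, this takes the value 0, hence never the value 1.\<close>

definition Lq_norm :: "real \<Rightarrow> (real ^ 'n \<Rightarrow> complex) \<Rightarrow> real" where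
  "Lq_norm q f = (LINT x|lborel. norm (f x) powr q) powr (1 / q)"

definition fourier_integral :: "(real ^ 'n \<Rightarrow> complex) \<Rightarrow> real ^ 'n \<Rightarrow> complex" where
  "fourier_integral f \<xi> =
     of_real ((2 * pi) powr (- real CARD('n) / 2)) *
     (LINT x|lborel. exp (- (\<i> * of_real (x \<bullet> \<xi>))) * f x)"

text \<open>
  The Fourier transform of \<open>f \<in> L\<^sup>2\<close> is the \<open>L\<^sup>2\<close> limit of the Fourier integrals of the truncations
  of \<open>f\<close> to balls (Plancherel); it is determined up to a null set.
\<close>

definition is_fourier_transform ::
    "(real ^ 'n \<Rightarrow> complex) \<Rightarrow> (real ^ 'n \<Rightarrow> complex) \<Rightarrow> bool" where
  "is_fourier_transform f g \<longleftrightarrow>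
     square_integrable g \<and>
     ((\<lambda>R::real. \<integral>\<^sup>+ \<xi>. ennreal ((norm
          (fourier_integral (\<lambda>x. indicator (cball 0 R) x *\<^sub>R f x) \<xi> - g \<xi>))\<^sup>2) \<partial>lborel)
        \<longlongrightarrow> 0) at_top"

definition fourier :: "(real ^ 'n \<Rightarrow> complex) \<Rightarrow> real ^ 'n \<Rightarrow> complex" where
  "fourier f = (SOME g. is_fourier_transform f g)"

definition sobolev_space :: "complex set \<Rightarrow> real \<Rightarrow> (real ^ 'n \<Rightarrow> complex) set" where
  "sobolev_space K \<alpha> =
     {f. range f \<subseteq> K \<and> square_integrable f \<and>
         square_integrable (\<lambda>\<xi>. (1 + (norm \<xi>)\<^sup>2) powr (\<alpha> / 2) *\<^sub>R fourier f \<xi>)}"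

definition sobolev_norm :: "real \<Rightarrow> (real ^ 'n \<Rightarrow> complex) \<Rightarrow> real" where
  "sobolev_norm \<alpha> f =
     sqrt (LINT \<xi>|lborel. (1 + (norm \<xi>)\<^sup>2) powr \<alpha> * (norm (fourier f \<xi>))\<^sup>2)"

definition critical_exponent :: "nat \<Rightarrow> real \<Rightarrow> ereal" where
  "critical_exponent N \<alpha> =
     (if real N > 2 * \<alpha> then ereal (2 * real N / (real N - 2 * \<alpha>)) else \<infinity>)"

definition inner_product_on ::
    "complex set \<Rightarrow> (real ^ 'n \<Rightarrow> complex) set \<Rightarrow>
     ((real ^ 'n \<Rightarrow> complex) \<Rightarrow> (real ^ 'n \<Rightarrow> complex) \<Rightarrow> complex) \<Rightarrow> bool" where
  "inner_product_on K V ip \<longleftrightarrow>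
     (\<forall>u\<in>V. \<forall>v\<in>V. ip u v \<in> K) \<and>
     (\<forall>u\<in>V. \<forall>v\<in>V. \<forall>w\<in>V. ip (\<lambda>x. u x + v x) w = ip u w + ip v w) \<and>
     (\<forall>c\<in>K. \<forall>u\<in>V. \<forall>v\<in>V. ip (\<lambda>x. c * u x) v = c * ip u v) \<and>
     (\<forall>u\<in>V. \<forall>v\<in>V. ip v u = cnj (ip u v)) \<and>
     (\<forall>u\<in>V. 0 \<le> Re (ip u u)) \<and>
     (\<forall>u\<in>V. ip u u = 0 \<longleftrightarrow> (AE x in lborel. u x = 0))"

definition hilbert_norm_on ::
    "complex set \<Rightarrow> (real ^ 'n \<Rightarrow> complex) set \<Rightarrow> ((real ^ 'n \<Rightarrow> complex) \<Rightarrow> real) \<Rightarrow> bool" where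
  "hilbert_norm_on K V nrm \<longleftrightarrow>
     (\<exists>ip. inner_product_on K V ip \<and> (\<forall>u\<in>V. nrm u = sqrt (Re (ip u u))))"

definition equivalent_norms_on ::
    "'a set \<Rightarrow> ('a \<Rightarrow> real) \<Rightarrow> ('a \<Rightarrow> real) \<Rightarrow> bool" where
  "equivalent_norms_on V nrm1 nrm2 \<longleftrightarrow>
     (\<exists>c>0. \<exists>C>0. \<forall>u\<in>V. c * nrm1 u \<le> nrm2 u \<and> nrm2 u \<le> C * nrm1 u)"

definition lattice_invariant_on ::
    "(real ^ 'n \<Rightarrow> complex) set \<Rightarrow> ((real ^ 'n \<Rightarrow> complex) \<Rightarrow> real) \<Rightarrow> bool" where
  "lattice_invariant_on V nrm \<longleftrightarrow>
     (\<forall>u\<in>V. \<forall>y. (\<forall>i. y $ i \<in> \<int>) \<longrightarrow> nrm (\<lambda>x. u (x - y)) = nrm u)"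

end

(*
  Minimizing sequences need not converge, since mass can escape to infinity; lattice translations
  bring it back. Split functions by sharp Fourier cutoffs at the dyadic frequencies. Subcriticality
  makes the high-frequency part uniformly small in L^q along a bounded sequence. Since the L^q norm
  is 1, the low-frequency part is therefore bounded below at some point, and an integer translation
  moves that point into the unit cube. The weak limit f of a subsequence then has nonzero low
  frequencies. With ||u_n||_q^q <= ||f||_q^q + ||u_n - f||_q^q + o(1) and
  ||u_n||^2 = ||f||^2 + ||u_n - f||^2 + o(1), the strict concavity of t^(2/q) forces ||f||_q = 1,
  so f is a minimizer.
*)
theory Submission
  imports Defs "HOL-Probability.Characteristic_Functions" "HOL-Library.Diagonal_Subsequence"
begin

text \<open>Point values of an L^q function have no meaning, but evaluating its low frequencies at a
  point is a bounded functional, by Cauchy-Schwarz on a ball of frequencies. Weak convergence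
  therefore yields pointwise convergence of all low frequencies, and together with the uniformly
  small tails this takes the place of the compact embedding on bounded sets. Subcriticality is used
  only as N (q - 2) < 2 \<alpha> q, which says that the L^q masses of dyadic blocks are dominated by
  a convergent geometric series. The norm is arbitrary up to equivalence, while the energy identity
  needs the very inner product that induces it; moreover, functions equal almost everywhere stay
  distinct. Hilbert space theory is hence developed for positive semidefinite real forms on sets of
  functions, and the real part of a complex inner product is such a form with the same norm.
  \<open>fourier\<close> is a choice of an L^2 limit, so its rules hold only almost everywhere;
  \<open>band\<close>, an integral of it, obeys them at every point. Plancherel's theorem comes from
  Gaussian regularization.\<close>

section \<open>Weak sequential compactness\<close>

text \<open>Dyadic convex combinations. Midpoints are all that the parallelogram law needs, and
  induction over them replaces the handling of finite convex sums.\<close>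

inductive_set midpoint_hull :: "('a \<Rightarrow> complex) set \<Rightarrow> ('a \<Rightarrow> complex) set"
  for A where
  base: "f \<in> A \<Longrightarrow> f \<in> midpoint_hull A"
| midpoint: "f \<in> midpoint_hull A \<Longrightarrow> g \<in> midpoint_hull A \<Longrightarrow>
    (\<lambda>x. (f x + g x) / 2) \<in> midpoint_hull A"

text \<open>The form is only semidefinite: it vanishes on functions that are zero almost everywhere,
  so \<open>nm\<close> is a seminorm and limits are unique only up to \<open>nm\<close>-distance 0.
  \<open>V\<close> is a set of honest functions, not of equivalence classes.\<close>

locale real_form_space =
  fixes V :: "('a \<Rightarrow> complex) set" and b :: "('a \<Rightarrow> complex) \<Rightarrow> ('a \<Rightarrow> complex) \<Rightarrow> real"
  assumes zero: "(\<lambda>x. 0) \<in> V"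
    and add: "f \<in> V \<Longrightarrow> g \<in> V \<Longrightarrow> (\<lambda>x. f x + g x) \<in> V"
    and scale: "f \<in> V \<Longrightarrow> (\<lambda>x. of_real c * f x) \<in> V"
    and form_sym: "f \<in> V \<Longrightarrow> g \<in> V \<Longrightarrow> b f g = b g f"
    and form_add: "f \<in> V \<Longrightarrow> g \<in> V \<Longrightarrow> h \<in> V \<Longrightarrow> b (\<lambda>x. f x + g x) h = b f h + b g h"
    and form_scale: "f \<in> V \<Longrightarrow> g \<in> V \<Longrightarrow> b (\<lambda>x. of_real c * f x) g = c * b f g"
    and form_nonneg: "f \<in> V \<Longrightarrow> 0 \<le> b f f"
begin

definition nm :: "('a \<Rightarrow> complex) \<Rightarrow> real" where "nm f = sqrt (b f f)"

lemma diff: "f \<in> V \<Longrightarrow> g \<in> V \<Longrightarrow> (\<lambda>x. f x - g x) \<in> V"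
  using add[of f "\<lambda>x. of_real (-1) * g x"] scale[of g "-1"] by simp

lemma form_diff: "f \<in> V \<Longrightarrow> g \<in> V \<Longrightarrow> h \<in> V \<Longrightarrow> b (\<lambda>x. f x - g x) h = b f h - b g h"
  using form_add[of f "\<lambda>x. of_real (-1) * g x" h] form_scale[of g h "-1"] scale[of g "-1"] by simp

lemma form_add_right: "f \<in> V \<Longrightarrow> g \<in> V \<Longrightarrow> h \<in> V \<Longrightarrow> b h (\<lambda>x. f x + g x) = b h f + b h g"
  using form_add[of f g h] form_sym add by metis

lemma form_diff_right: "f \<in> V \<Longrightarrow> g \<in> V \<Longrightarrow> h \<in> V \<Longrightarrow> b h (\<lambda>x. f x - g x) = b h f - b h g"
  using form_diff[of f g h] form_sym diff by metis

lemma form_scale_right: "f \<in> V \<Longrightarrow> g \<in> V \<Longrightarrow> b g (\<lambda>x. of_real c * f x) = c * b g f"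
  using form_scale[of f g c] form_sym scale by metis

lemma nm_nonneg: "f \<in> V \<Longrightarrow> 0 \<le> nm f"
  unfolding nm_def using form_nonneg by simp

lemma nm_sq: "f \<in> V \<Longrightarrow> (nm f)\<^sup>2 = b f f"
  unfolding nm_def using form_nonneg by simp

lemma nm_scale: "f \<in> V \<Longrightarrow> nm (\<lambda>x. of_real c * f x) = \<bar>c\<bar> * nm f"
  unfolding nm_def
  by (simp add: form_scale form_scale_right scale real_sqrt_mult flip: mult.assoc)

lemma form_add_self:
  "f \<in> V \<Longrightarrow> g \<in> V \<Longrightarrow> b (\<lambda>x. f x + g x) (\<lambda>x. f x + g x) = b f f + 2 * b f g + b g g"
  by (simp add: form_add form_add_right add form_sym[of g f])

lemma form_diff_self:
  "f \<in> V \<Longrightarrow> g \<in> V \<Longrightarrow> b (\<lambda>x. f x - g x) (\<lambda>x. f x - g x) = b f f - 2 * b f g + b g g"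
  by (simp add: form_diff form_diff_right diff form_sym[of g f])

lemma nm_diff_commute: "f \<in> V \<Longrightarrow> g \<in> V \<Longrightarrow> nm (\<lambda>x. f x - g x) = nm (\<lambda>x. g x - f x)"
  unfolding nm_def by (simp add: form_diff_self form_sym[of f g])

lemma Cauchy_Schwarz:
  assumes f: "f \<in> V" and g: "g \<in> V"
  shows "\<bar>b f g\<bar> \<le> nm f * nm g"
proof -
  have q: "0 \<le> b f f + 2 * t * b f g + t\<^sup>2 * b g g" for t
  proof -
    have "0 \<le> b (\<lambda>x. f x + of_real t * g x) (\<lambda>x. f x + of_real t * g x)"
      by (intro form_nonneg add scale f g)
    also have "\<dots> = b f f + 2 * t * b f g + t\<^sup>2 * b g g"
      using f g by (simp add: form_add_self scale form_scale form_scale_right power2_eq_square)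
    finally show ?thesis .
  qed
  have "(b f g)\<^sup>2 \<le> b f f * b g g"
  proof (cases "b g g = 0")
    case True
    have "b f g = 0"
    proof (rule ccontr)
      assume "b f g \<noteq> 0"
      \<comment> \<open>When \<open>b g g = 0\<close> the quadratic in t degenerates to an affine
        function, and this t gives it the value -1.\<close>
      then show False
        using q[of "- (b f f + 1) / (2 * b f g)"] True form_nonneg[OF f] by (simp add: field_simps)
    qed
    then show ?thesis using True by simp
  next
    case False
    then have pos: "b g g > 0" using form_nonneg[OF g] by simp
    have "0 \<le> (b f f + 2 * (- (b f g) / b g g) * b f g + (- (b f g) / b g g)\<^sup>2 * b g g) * b g g"
      using q[of "- (b f g) / b g g"] pos by (intro mult_nonneg_nonneg) simp_all
    also have "\<dots> = b f f * b g g - (b f g)\<^sup>2"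
      using pos by (simp add: field_simps power2_eq_square)
    finally show ?thesis by simp
  qed
  then have "sqrt ((b f g)\<^sup>2) \<le> sqrt (b f f * b g g)"
    by (rule real_sqrt_le_mono)
  then show ?thesis
    by (simp add: nm_def real_sqrt_mult)
qed

lemma nm_triangle:
  assumes f: "f \<in> V" and g: "g \<in> V"
  shows "nm (\<lambda>x. f x + g x) \<le> nm f + nm g"
proof (rule power2_le_imp_le)
  show "(nm (\<lambda>x. f x + g x))\<^sup>2 \<le> (nm f + nm g)\<^sup>2"
    using Cauchy_Schwarz[OF f g] f g
    by (simp add: nm_sq add form_add_self power2_sum)
qed (use f g nm_nonneg in auto)

lemma nm_triangle_diff:
  assumes "f \<in> V" "g \<in> V" "h \<in> V"
  shows "nm (\<lambda>x. f x - h x) \<le> nm (\<lambda>x. f x - g x) + nm (\<lambda>x. g x - h x)"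
  using nm_triangle[of "\<lambda>x. f x - g x" "\<lambda>x. g x - h x"] assms diff by simp

lemma nm_diff_le: "f \<in> V \<Longrightarrow> g \<in> V \<Longrightarrow> nm (\<lambda>x. f x - g x) \<le> nm f + nm g"
  using nm_triangle[of f "\<lambda>x. of_real (-1) * g x"] scale[of g "-1"] nm_scale[of g "-1"] by simp

lemma nm_reverse_triangle:
  assumes f: "f \<in> V" and g: "g \<in> V"
  shows "\<bar>nm f - nm g\<bar> \<le> nm (\<lambda>x. f x - g x)"
  using nm_triangle[of "\<lambda>x. f x - g x" g] nm_triangle[of "\<lambda>x. g x - f x" f] f g
    diff[of f g] diff[of g f] nm_diff_commute[of f g] by simp

lemma nm_tendsto:
  assumes X: "\<And>n. X n \<in> V" and f: "f \<in> V" and lim: "((\<lambda>n. nm (\<lambda>x. X n x - f x)) \<longlongrightarrow> 0) F"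
  shows "((\<lambda>n. nm (X n)) \<longlongrightarrow> nm f) F"
proof -
  have "((\<lambda>n. nm (X n) - nm f) \<longlongrightarrow> 0) F"
    by (rule Lim_null_comparison[OF always_eventually lim]) (use nm_reverse_triangle X f in auto)
  then show ?thesis by (simp add: LIM_zero_iff)
qed

lemma form_tendsto:
  assumes X: "\<And>n. X n \<in> V" and f: "f \<in> V" and g: "g \<in> V"
    and lim: "((\<lambda>n. nm (\<lambda>x. X n x - f x)) \<longlongrightarrow> 0) F"
  shows "((\<lambda>n. b (X n) g) \<longlongrightarrow> b f g) F"
proof -
  have "((\<lambda>n. b (X n) g - b f g) \<longlongrightarrow> 0) F"
  proof (rule Lim_null_comparison[OF always_eventually])
    show "((\<lambda>n. nm (\<lambda>x. X n x - f x) * nm g) \<longlongrightarrow> 0) F"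
      using tendsto_mult_right[OF lim, of "nm g"] by simp
    show "\<forall>n. norm (b (X n) g - b f g) \<le> nm (\<lambda>x. X n x - f x) * nm g"
      using Cauchy_Schwarz[OF diff[OF X f] g] by (simp add: form_diff X f g)
  qed
  then show ?thesis by (simp add: LIM_zero_iff)
qed

section \<open>Bounded functionals, midpoint hulls and weak limits\<close>

definition bounded_functional :: "(('a \<Rightarrow> complex) \<Rightarrow> real) \<Rightarrow> bool" where
  "bounded_functional L \<longleftrightarrow>
     (\<forall>f\<in>V. \<forall>g\<in>V. L (\<lambda>x. f x + g x) = L f + L g) \<and>
     (\<forall>f\<in>V. \<forall>c. L (\<lambda>x. of_real c * f x) = c * L f) \<and>
     (\<exists>C. \<forall>f\<in>V. \<bar>L f\<bar> \<le> C * nm f)"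

definition complete_form :: bool where
  "complete_form \<longleftrightarrow> (\<forall>X. (\<forall>n. X n \<in> V) \<and>
     (\<forall>e>0. \<exists>N. \<forall>m\<ge>N. \<forall>n\<ge>N. nm (\<lambda>x. X m x - X n x) < e) \<longrightarrow>
     (\<exists>f\<in>V. (\<lambda>n. nm (\<lambda>x. X n x - f x)) \<longlonglongrightarrow> 0))"

lemma bounded_functional_add:
  "bounded_functional L \<Longrightarrow> f \<in> V \<Longrightarrow> g \<in> V \<Longrightarrow> L (\<lambda>x. f x + g x) = L f + L g"
  unfolding bounded_functional_def by simp

lemma bounded_functional_scale:
  "bounded_functional L \<Longrightarrow> f \<in> V \<Longrightarrow> L (\<lambda>x. of_real c * f x) = c * L f"
  unfolding bounded_functional_def by simp

lemma midpoint_in: "f \<in> V \<Longrightarrow> g \<in> V \<Longrightarrow> (\<lambda>x. (f x + g x) / 2) \<in> V"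
  using scale[OF add, of f g "1/2"] by simp

lemma bounded_functional_diff:
  assumes L: "bounded_functional L" and f: "f \<in> V" and g: "g \<in> V"
  shows "L (\<lambda>x. f x - g x) = L f - L g"
  using bounded_functional_add[OF L f scale[OF g, of "-1"]] bounded_functional_scale[OF L g, of "-1"]
  by simp

lemma bounded_functional_tendsto:
  assumes L: "bounded_functional L" and X: "\<And>n. X n \<in> V" and f: "f \<in> V"
    and lim: "((\<lambda>n. nm (\<lambda>x. X n x - f x)) \<longlongrightarrow> 0) F"
  shows "((\<lambda>n. L (X n)) \<longlongrightarrow> L f) F"
proof -
  obtain C where C: "\<And>f. f \<in> V \<Longrightarrow> \<bar>L f\<bar> \<le> C * nm f"
    using L unfolding bounded_functional_def by blast
  have "((\<lambda>n. L (X n) - L f) \<longlongrightarrow> 0) F"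
  proof (rule Lim_null_comparison[OF always_eventually])
    show "((\<lambda>n. C * nm (\<lambda>x. X n x - f x)) \<longlongrightarrow> 0) F"
      using tendsto_mult_left[OF lim, of C] by simp
    show "\<forall>n. norm (L (X n) - L f) \<le> C * nm (\<lambda>x. X n x - f x)"
      using C[OF diff[OF X f]] bounded_functional_diff[OF L X f] by simp
  qed
  then show ?thesis by (simp add: LIM_zero_iff)
qed

lemma bounded_functional_form:
  assumes g: "g \<in> V"
  shows "bounded_functional (\<lambda>f. b f g)"
  unfolding bounded_functional_def
proof (intro conjI ballI allI exI)
  show "\<bar>b f g\<bar> \<le> nm g * nm f" if "f \<in> V" for f
    using Cauchy_Schwarz[OF that g] by (simp add: mult.commute)
qed (simp_all add: g form_add form_scale)

lemma midpoint_hull_subset: "A \<subseteq> V \<Longrightarrow> f \<in> midpoint_hull A \<Longrightarrow> f \<in> V"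
  by (rotate_tac, induction rule: midpoint_hull.induct) (auto intro: midpoint_in)

text \<open>The functions f with \<open>\<bar>L f - l\<bar> \<le> e\<close> form a convex set
  because L is linear. Hence hulls of late tails stay close to the limit of L along a
  sequence.\<close>

lemma bounded_functional_midpoint_hull:
  assumes L: "bounded_functional L" and A: "A \<subseteq> V" "\<And>f. f \<in> A \<Longrightarrow> \<bar>L f - l\<bar> \<le> e"
    and f: "f \<in> midpoint_hull A"
  shows "\<bar>L f - l\<bar> \<le> e"
  using f
proof (induction rule: midpoint_hull.induct)
  case (midpoint f g)
  have fg: "f \<in> V" "g \<in> V" using midpoint A midpoint_hull_subset by auto
  have "L (\<lambda>x. (f x + g x) / 2) = (L f + L g) / 2"
    using bounded_functional_scale[OF L add[OF fg], of "1/2"] bounded_functional_add[OF L fg] by simp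
  then show ?case using midpoint.IH by (simp add: abs_le_iff field_simps)
qed (use A in auto)

lemma midpoint_hull_mono: "A \<subseteq> B \<Longrightarrow> f \<in> midpoint_hull A \<Longrightarrow> f \<in> midpoint_hull B"
  by (rotate_tac, induction rule: midpoint_hull.induct)
    (blast intro: midpoint_hull.base, rule midpoint_hull.midpoint)

text \<open>Nearly minimal elements of the midpoint hulls of the tails form a Cauchy sequence by the
  parallelogram law; this replaces Mazur's lemma and the Riesz representation theorem.\<close>

lemma strong_limit_in_hulls:
  assumes complete: complete_form and X: "\<And>n. X n \<in> V" and B: "\<And>n. nm (X n) \<le> B"
  obtains Y f where "f \<in> V" "\<And>n. Y n \<in> midpoint_hull (X ` {n..})"
    "(\<lambda>n. nm (\<lambda>x. Y n x - f x)) \<longlonglongrightarrow> 0"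
proof -
  define K where "K n = midpoint_hull (X ` {n..})" for n
  define d where "d n = (INF y\<in>K n. b y y)" for n
  have KV: "y \<in> V" if "y \<in> K n" for y n
    using that midpoint_hull_subset[of "X ` {n..}" y] X unfolding K_def by auto
  have XK: "X n \<in> K n" for n unfolding K_def by (auto intro: midpoint_hull.base)
  have bdd: "bdd_below ((\<lambda>y. b y y) ` K n)" for n
    using KV form_nonneg by (auto intro!: bdd_belowI[of _ 0])
  have dle: "d n \<le> b y y" if "y \<in> K n" for n y
    unfolding d_def using that bdd by (rule cINF_lower[rotated])
  \<comment> \<open>The hulls of the tails shrink, so their minimal squared norms increase; they are
    bounded by \<open>B\<^sup>2\<close> and converge.\<close>
  have dmono: "incseq d"
    unfolding incseq_def d_def
    by (intro allI impI cINF_superset_mono bdd)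
       (use XK in \<open>auto simp: K_def elim!: midpoint_hull_mono[rotated]\<close>)
  have dB: "d n \<le> B\<^sup>2" for n
  proof -
    have "b (X n) (X n) \<le> B\<^sup>2"
      using nm_sq[OF X, of n] power_mono[OF B nm_nonneg[OF X], of n 2] by simp
    then show ?thesis using dle[OF XK, of n] by simp
  qed
  then obtain D where D: "d \<longlonglongrightarrow> D" "\<And>n. d n \<le> D"
    using incseq_convergent[OF dmono, of "B\<^sup>2"] by auto
  have "\<exists>y\<in>K n. b y y < d n + 1 / real (Suc n)" for n
    using cINF_less_iff[of "K n" "\<lambda>y. b y y" "d n + 1 / real (Suc n)"] bdd[of n] XK[of n]
    by (auto simp: d_def)
  then obtain Y where Y: "\<And>n. Y n \<in> K n" "\<And>n. b (Y n) (Y n) < d n + 1 / real (Suc n)"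
    by metis
  \<comment> \<open>The midpoint of \<open>Y m\<close> and \<open>Y n\<close> lies in
    \<open>K n\<close>, so its squared norm is at least \<open>d n\<close>. The parallelogram law
    converts this lower bound on the sum into an upper bound on the difference.\<close>
  have est: "(nm (\<lambda>x. Y m x - Y n x))\<^sup>2 \<le> 2 * (D - d n) + 4 / real (Suc n)" if "n \<le> m" for m n
  proof -
    have sub: "K m \<subseteq> K n"
      using that unfolding K_def by (auto elim!: midpoint_hull_mono[rotated])
    have Ym: "Y m \<in> K n" using Y(1) sub by blast
    have mid: "(\<lambda>x. (Y m x + Y n x) / 2) \<in> K n"
      using Ym Y(1)[of n] unfolding K_def by (rule midpoint_hull.midpoint)
    have v: "Y m \<in> V" "Y n \<in> V" using Ym Y(1) KV by auto
    have "d n \<le> b (\<lambda>x. (Y m x + Y n x) / 2) (\<lambda>x. (Y m x + Y n x) / 2)"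
      by (rule dle[OF mid])
    also have "\<dots> = 1/4 * b (\<lambda>x. Y m x + Y n x) (\<lambda>x. Y m x + Y n x)"
    proof -
      have "b (\<lambda>x. (Y m x + Y n x) / 2) (\<lambda>x. (Y m x + Y n x) / 2) = (nm (\<lambda>x. (Y m x + Y n x) / 2))\<^sup>2"
        by (rule nm_sq[OF midpoint_in[OF v], symmetric])
      also have "nm (\<lambda>x. (Y m x + Y n x) / 2) = 1/2 * nm (\<lambda>x. Y m x + Y n x)"
        using nm_scale[OF add[OF v], of "1/2"] by simp
      finally show ?thesis
        by (simp add: power_divide nm_sq[OF add[OF v]])
    qed
    also have "\<dots> = 1/4 * (b (Y m) (Y m) + 2 * b (Y m) (Y n) + b (Y n) (Y n))"
      using v by (simp add: form_add_self)
    finally have "4 * d n \<le> b (Y m) (Y m) + 2 * b (Y m) (Y n) + b (Y n) (Y n)" by simp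
    moreover have "(nm (\<lambda>x. Y m x - Y n x))\<^sup>2 = b (Y m) (Y m) - 2 * b (Y m) (Y n) + b (Y n) (Y n)"
      using v by (simp add: nm_sq diff form_diff_self)
    moreover have "b (Y m) (Y m) \<le> D + 1 / real (Suc n)"
      using Y(2)[of m] D(2)[of m] that by (smt (verit) frac_le of_nat_0_less_iff of_nat_le_iff Suc_le_mono zero_less_Suc)
    moreover have "b (Y n) (Y n) \<le> d n + 1 / real (Suc n)" using Y(2)[of n] by simp
    ultimately show ?thesis by simp
  qed
  have "(\<lambda>n. sqrt (2 * (D - d n) + 4 / real (Suc n))) \<longlonglongrightarrow> sqrt (2 * (D - D) + 0)"
    by (intro tendsto_intros D LIMSEQ_Suc lim_const_over_n)
  then have s0: "(\<lambda>n. sqrt (2 * (D - d n) + 4 / real (Suc n))) \<longlonglongrightarrow> 0" by simp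
  have "\<exists>N. \<forall>m\<ge>N. \<forall>n\<ge>N. nm (\<lambda>x. Y m x - Y n x) < e" if "e > 0" for e
  proof -
    obtain N where N: "\<And>n. n \<ge> N \<Longrightarrow> sqrt (2 * (D - d n) + 4 / real (Suc n)) < e"
      using order_tendstoD(2)[OF s0 \<open>e > 0\<close>] unfolding eventually_sequentially by blast
    have "nm (\<lambda>x. Y m x - Y n x) < e" if "n \<le> m" "N \<le> n" for m n
      using real_le_rsqrt[OF est[OF that(1)]] N[OF that(2)] by linarith
    moreover have "nm (\<lambda>x. Y m x - Y n x) = nm (\<lambda>x. Y n x - Y m x)" for m n
      using Y(1) KV by (intro nm_diff_commute) auto
    ultimately show ?thesis by (metis linorder_linear)
  qed
  then obtain f where "f \<in> V" "(\<lambda>n. nm (\<lambda>x. Y n x - f x)) \<longlonglongrightarrow> 0"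
    using complete Y(1) KV unfolding complete_form_def by blast
  then show thesis using that Y(1) unfolding K_def by blast
qed

text \<open>Elements of the hulls of the tails inherit the limit of L along X, and strong
  convergence passes it on to f. This evaluates functionals at f before f is known to be a weak
  limit of X.\<close>

lemma strong_limit_functional:
  assumes L: "bounded_functional L" and X: "\<And>n. X n \<in> V" and f: "f \<in> V"
    and Y: "\<And>n. Y n \<in> midpoint_hull (X ` {n..})"
    and lim: "(\<lambda>n. nm (\<lambda>x. Y n x - f x)) \<longlonglongrightarrow> 0" and l: "(\<lambda>n. L (X n)) \<longlonglongrightarrow> l"
  shows "L f = l"
proof -
  have YV: "Y n \<in> V" for n using Y[of n] midpoint_hull_subset[of "X ` {n..}"] X by blast
  have "(\<lambda>n. L (Y n)) \<longlonglongrightarrow> l"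
  proof (rule LIMSEQ_I)
    fix e :: real assume "e > 0"
    then obtain N where N: "\<And>n. n \<ge> N \<Longrightarrow> \<bar>L (X n) - l\<bar> < e / 2"
      using LIMSEQ_D[OF l, of "e/2"] by auto
    have "\<bar>L (Y n) - l\<bar> \<le> e / 2" if "n \<ge> N" for n
      by (rule bounded_functional_midpoint_hull[OF L _ _ Y]) (use X N that in \<open>auto intro: less_imp_le\<close>)
    then show "\<exists>N. \<forall>n\<ge>N. norm (L (Y n) - l) < e" using \<open>e > 0\<close>
      by (intro exI[of _ N]) (auto intro: le_less_trans[of _ "e/2"])
  qed
  then show ?thesis
    using bounded_functional_tendsto[OF L YV f lim] LIMSEQ_unique by blast
qed

text \<open>A diagonal subsequence makes the products with every \<open>X m\<close> converge, and
  the strong limit f of elements of the tail hulls is the candidate. Convergence of the products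
  extends from the sequence to its hull and then to f. An arbitrary functional is handled by
  contradiction, with a second strong limit, so that it never has to be represented by a
  vector.\<close>

theorem weakly_convergent_subsequence:
  assumes complete: complete_form and X: "\<And>n. X n \<in> V" and B: "\<And>n. nm (X n) \<le> B"
  obtains f r where "f \<in> V" "strict_mono (r :: nat \<Rightarrow> nat)"
    "\<And>L. bounded_functional L \<Longrightarrow> (\<lambda>n. L (X (r n))) \<longlonglongrightarrow> L f"
proof -
  have bdd: "\<bar>b (X n) (X m)\<bar> \<le> B * B" for m n
  proof -
    have "\<bar>b (X n) (X m)\<bar> \<le> nm (X n) * nm (X m)" by (rule Cauchy_Schwarz[OF X X])
    also have "\<dots> \<le> B * B"
      by (intro mult_mono B nm_nonneg X) (use B[of 0] nm_nonneg[OF X, of 0] in linarith)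
    finally show ?thesis .
  qed
  interpret S: subseqs "\<lambda>m r. convergent (\<lambda>n. b (X (r n)) (X m))"
  proof
    fix m and s :: "nat \<Rightarrow> nat" assume "strict_mono s"
    have "bounded (range (\<lambda>n. b (X (s n)) (X m)))"
      using bdd by (auto simp: bounded_iff)
    then obtain l r where "strict_mono (r :: nat \<Rightarrow> nat)" "((\<lambda>n. b (X (s n)) (X m)) \<circ> r) \<longlonglongrightarrow> l"
      using bounded_imp_convergent_subsequence by blast
    then show "\<exists>r'. strict_mono r' \<and> convergent (\<lambda>n. b (X ((s \<circ> r') n)) (X m))"
      by (auto simp: convergent_def o_def)
  qed
  define r where "r = S.diagseq"
  have r: "strict_mono r" unfolding r_def by (rule S.subseq_diagseq)
  \<comment> \<open>The diagonal sequence is a subsequence of the m-th one only from index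
    \<open>Suc m\<close> on, which is enough for convergence.\<close>
  have conv: "convergent (\<lambda>n. b (X (r n)) (X m))" for m
  proof -
    have "convergent (\<lambda>n. b (X ((S.diagseq \<circ> ((+) (Suc m))) n)) (X m))"
      by (rule S.diagseq_holds) (auto dest: convergent_subseq_convergent simp: o_def)
    then have "convergent (\<lambda>n. b (X (r (n + Suc m))) (X m))"
      by (simp only: r_def o_apply add.commute)
    then show ?thesis
      using convergent_ignore_initial_segment[of "\<lambda>n. b (X (r n)) (X m)" "Suc m"] by simp
  qed
  define Z where "Z n = X (r n)" for n
  have Z: "Z n \<in> V" "nm (Z n) \<le> B" for n using X B by (auto simp: Z_def)
  obtain Y f where f: "f \<in> V" and Y: "\<And>n. Y n \<in> midpoint_hull (Z ` {n..})"
    and Yf: "(\<lambda>n. nm (\<lambda>x. Y n x - f x)) \<longlonglongrightarrow> 0"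
    by (rule strong_limit_in_hulls[where X=Z, OF complete Z]) (rule that)
  have YV: "Y n \<in> V" for n using Y[of n] midpoint_hull_subset[of "Z ` {n..}"] Z by blast
  have ZX: "(\<lambda>n. b (Z n) (Z m)) \<longlonglongrightarrow> b f (Z m)" for m
  proof -
    obtain l where l: "(\<lambda>n. b (Z n) (Z m)) \<longlonglongrightarrow> l"
      using conv[of "r m"] unfolding Z_def convergent_def by blast
    show ?thesis
      using strong_limit_functional[OF bounded_functional_form[OF Z(1)] Z(1) f Y Yf l] l by simp
  qed
  have ZY: "(\<lambda>n. b (Z n) y) \<longlonglongrightarrow> b f y" if "y \<in> midpoint_hull (range Z)" for y
    using that
  proof (induction rule: midpoint_hull.induct)
    case (midpoint g h)
    have gh: "g \<in> V" "h \<in> V" using midpoint midpoint_hull_subset[of "range Z"] Z by auto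
    have eq: "b u (\<lambda>x. (g x + h x) / 2) = 1/2 * (b u g + b u h)" if "u \<in> V" for u
      using form_scale_right[OF add[OF gh] that, of "1/2"] form_add_right[OF gh that] by simp
    show ?case
      unfolding eq[OF Z(1)] eq[OF f] by (intro tendsto_intros midpoint.IH)
  qed (use ZX in auto)
  \<comment> \<open>f is a strong limit of hull elements \<open>Y k\<close>, against which
    convergence is known; the norms of \<open>Z n - f\<close> are bounded, so replacing f by a close
    \<open>Y k\<close> costs at most e / 2 uniformly in n.\<close>
  have weak: "(\<lambda>n. b (Z n) f) \<longlonglongrightarrow> b f f"
  proof (rule LIMSEQ_I)
    fix e :: real assume e: "e > 0"
    have Bpos: "B \<ge> 0" using Z(2)[of 0] nm_nonneg[OF Z(1), of 0] by linarith
    define C where "C = B + nm f + 1"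
    have C: "C > 0" using Bpos nm_nonneg[OF f] by (simp add: C_def)
    obtain k where k: "nm (\<lambda>x. Y k x - f x) < e / (2 * C)"
      using LIMSEQ_D[OF Yf, of "e / (2 * C)"] e C nm_nonneg[OF diff[OF YV f]] by auto
    have "Y k \<in> midpoint_hull (range Z)" by (rule midpoint_hull_mono[OF _ Y]) auto
    then obtain N where N: "\<And>n. n \<ge> N \<Longrightarrow> \<bar>b (Z n) (Y k) - b f (Y k)\<bar> < e / 2"
      using LIMSEQ_D[OF ZY, of "Y k" "e / 2"] e by auto
    have "\<bar>b (Z n) f - b f f\<bar> < e" if "n \<ge> N" for n
    proof -
      have "\<bar>b (\<lambda>x. Z n x - f x) (\<lambda>x. Y k x - f x)\<bar> \<le> nm (\<lambda>x. Z n x - f x) * nm (\<lambda>x. Y k x - f x)"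
        by (intro Cauchy_Schwarz diff Z YV f)
      also have "\<dots> \<le> C * (e / (2 * C))"
        using nm_diff_le[OF Z(1) f, of n] Z(2)[of n] k C
        by (intro mult_mono nm_nonneg diff Z YV f) (auto simp: C_def)
      also have "\<dots> = e / 2" using C by simp
      finally have "\<bar>b (\<lambda>x. Z n x - f x) (\<lambda>x. Y k x - f x)\<bar> \<le> e / 2" .
      moreover have "b (\<lambda>x. Z n x - f x) (\<lambda>x. Y k x - f x) =
          (b (Z n) (Y k) - b f (Y k)) - (b (Z n) f - b f f)"
        by (simp add: form_diff form_diff_right Z f YV diff)
      ultimately show ?thesis using N[OF that] by linarith
    qed
    then show "\<exists>N. \<forall>n\<ge>N. norm (b (Z n) f - b f f) < e" by auto
  qed
  define W where "W n = (\<lambda>x. Z n x - f x)" for n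
  have W: "W n \<in> V" for n unfolding W_def by (intro diff Z f)
  have WB: "nm (W n) \<le> B + nm f" for n
    unfolding W_def using nm_diff_le[OF Z(1) f, of n] Z(2)[of n] by linarith
  have WW: "(\<lambda>n. b (W n) (W m)) \<longlonglongrightarrow> 0" for m
  proof -
    have "(\<lambda>n. (b (Z n) (Z m) - b (Z n) f) - (b f (Z m) - b f f)) \<longlonglongrightarrow>
        (b f (Z m) - b f f) - (b f (Z m) - b f f)"
      by (intro tendsto_intros ZX weak)
    then show ?thesis
      by (simp add: W_def form_diff form_diff_right Z f diff)
  qed
  have "(\<lambda>n. L (X (r n))) \<longlonglongrightarrow> L f" if L: "bounded_functional L" for L
  proof (rule ccontr)
    obtain C where C: "\<And>f. f \<in> V \<Longrightarrow> \<bar>L f\<bar> \<le> C * nm f"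
      using L unfolding bounded_functional_def by blast
    assume "\<not> ?thesis"
    then have "\<not> (\<lambda>n. L (W n)) \<longlonglongrightarrow> 0"
      using bounded_functional_diff[OF L Z(1) f] by (simp add: W_def Z_def LIM_zero_iff)
    then obtain e where e: "e > 0" "\<And>N. \<exists>n\<ge>N. \<bar>L (W n)\<bar> \<ge> e"
      unfolding LIMSEQ_def dist_real_def by (auto simp: not_less)
    then have "\<exists>\<^sub>F n in sequentially. \<bar>L (W n)\<bar> \<ge> e"
      unfolding frequently_sequentially by blast
    then have "infinite {n. \<bar>L (W n)\<bar> \<ge> e}"
      by (simp add: frequently_cofinite flip: cofinite_eq_sequentially)
    then obtain s where s: "strict_mono (s :: nat \<Rightarrow> nat)" "\<And>n. \<bar>L (W (s n))\<bar> \<ge> e"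
      using infinite_enumerate by blast
    have "\<bar>L (W n)\<bar> \<le> \<bar>C\<bar> * (B + nm f)" for n
    proof -
      have "\<bar>L (W n)\<bar> \<le> \<bar>C\<bar> * nm (W n)"
        using C[OF W, of n] nm_nonneg[OF W, of n] by (smt (verit) mult_right_mono)
      then show ?thesis using WB[of n] by (smt (verit) mult_left_mono)
    qed
    then have "bounded (range (\<lambda>n. L (W (s n))))" by (auto simp: bounded_iff)
    then obtain l t where t: "strict_mono (t :: nat \<Rightarrow> nat)" "((\<lambda>n. L (W (s n))) \<circ> t) \<longlonglongrightarrow> l"
      using bounded_imp_convergent_subsequence by blast
    \<comment> \<open>U is a subsequence of W along which L tends to some l with
      \<open>e \<le> \<bar>l\<bar>\<close>. A strong limit g of its hulls has
      \<open>L g = l\<close>, but g is orthogonal to every \<open>U m\<close> and therefore to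
      itself, which forces \<open>L g = 0\<close>.\<close>
    define U where "U n = W (s (t n))" for n
    have U: "U n \<in> V" "nm (U n) \<le> B + nm f" for n using W WB by (auto simp: U_def)
    have Ul: "(\<lambda>n. L (U n)) \<longlonglongrightarrow> l" using t by (simp add: U_def o_def)
    have le: "e \<le> \<bar>l\<bar>"
      by (rule tendsto_lowerbound[OF tendsto_rabs[OF Ul]]) (use s in \<open>auto simp: U_def\<close>)
    have UU: "(\<lambda>n. b (U n) (U m)) \<longlonglongrightarrow> 0" for m
      using LIMSEQ_subseq_LIMSEQ[OF WW strict_mono_o[OF s(1) t(1)]] by (simp add: U_def o_def)
    obtain Y' g where g: "g \<in> V" and Y': "\<And>n. Y' n \<in> midpoint_hull (U ` {n..})"
      and Y'g: "(\<lambda>n. nm (\<lambda>x. Y' n x - g x)) \<longlonglongrightarrow> 0"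
      by (rule strong_limit_in_hulls[where X=U, OF complete U]) (rule that)
    have Lg: "L g = l" by (rule strong_limit_functional[OF L U(1) g Y' Y'g Ul])
    have gU: "b g (U m) = 0" for m
      by (rule strong_limit_functional[OF bounded_functional_form[OF U(1)] U(1) g Y' Y'g UU])
    have "b g g = 0"
      using gU by (intro strong_limit_functional[OF bounded_functional_form[OF g] U(1) g Y' Y'g])
        (simp add: form_sym[OF U(1) g])
    then have "L g = 0" using C[OF g] by (simp add: nm_def)
    then show False using Lg le e by simp
  qed
  then show thesis using that f r by blast
qed

end

section \<open>Square-integrable functions\<close>

text \<open>Fatou's lemma, in the shape in which it carries uniform bounds to almost-everywhere
  limits.\<close>

lemma nn_integral_le_of_tendsto:
  fixes u :: "nat \<Rightarrow> 'a \<Rightarrow> ennreal"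
  assumes [measurable]: "\<And>n. u n \<in> borel_measurable M" "v \<in> borel_measurable M"
    and lim: "AE x in M. (\<lambda>n. u n x) \<longlonglongrightarrow> v x"
    and bound: "\<forall>\<^sub>F n in sequentially. (\<integral>\<^sup>+x. u n x \<partial>M) \<le> B"
  shows "(\<integral>\<^sup>+x. v x \<partial>M) \<le> B"
proof -
  have "(\<integral>\<^sup>+x. v x \<partial>M) = (\<integral>\<^sup>+x. liminf (\<lambda>n. u n x) \<partial>M)"
    using lim by (intro nn_integral_cong_AE) (auto elim!: eventually_mono dest!: lim_imp_Liminf[rotated])
  also have "\<dots> \<le> liminf (\<lambda>n. \<integral>\<^sup>+x. u n x \<partial>M)"
    by (rule nn_integral_liminf) simp
  also have "\<dots> \<le> limsup (\<lambda>n. \<integral>\<^sup>+x. u n x \<partial>M)"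
    by (rule Liminf_le_Limsup) simp
  also have "\<dots> \<le> B"
    by (rule Limsup_bounded[OF bound])
  finally show ?thesis .
qed

lemma borel_measurable_cnj [measurable (raw)]:
  "f \<in> borel_measurable M \<Longrightarrow> (\<lambda>x. cnj (f x)) \<in> borel_measurable M"
  by (rule borel_measurable_continuous_on[OF continuous_on_cnj[OF continuous_on_id]])

definition L2 :: "'a measure \<Rightarrow> ('a \<Rightarrow> complex) set" where
  "L2 M = {f \<in> borel_measurable M. integrable M (\<lambda>x. (norm (f x))\<^sup>2)}"

text \<open>The real part of the Hermitian product: it induces the same norm and makes the complex
  space an instance of the real locale.\<close>

definition L2_form :: "'a measure \<Rightarrow> ('a \<Rightarrow> complex) \<Rightarrow> ('a \<Rightarrow> complex) \<Rightarrow> real" where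
  "L2_form M f g = (LINT x|M. Re (f x * cnj (g x)))"

lemma L2_measurable: "f \<in> L2 M \<Longrightarrow> f \<in> borel_measurable M"
  and L2_integrable: "f \<in> L2 M \<Longrightarrow> integrable M (\<lambda>x. (norm (f x))\<^sup>2)"
  by (auto simp: L2_def)

lemma L2_dominated:
  assumes "f \<in> L2 M" "g \<in> borel_measurable M" "AE x in M. norm (g x) \<le> norm (f x)"
  shows "g \<in> L2 M"
  unfolding L2_def
proof (safe intro!: assms)
  have [measurable]: "g \<in> borel_measurable M" by fact
  show "integrable M (\<lambda>x. (norm (g x))\<^sup>2)"
    by (rule Bochner_Integration.integrable_bound[OF L2_integrable[OF assms(1)]])
       (use assms(3) in \<open>auto elim!: eventually_mono intro: power_mono\<close>)
qed

lemma L2_mult_integrable: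
  assumes "f \<in> L2 M" "g \<in> L2 M"
  shows "integrable M (\<lambda>x. f x * cnj (g x))"
proof (rule Bochner_Integration.integrable_bound)
  show "integrable M (\<lambda>x. (norm (f x))\<^sup>2 + (norm (g x))\<^sup>2)"
    using assms by (auto dest: L2_integrable)
  show "(\<lambda>x. f x * cnj (g x)) \<in> borel_measurable M"
    using assms[THEN L2_measurable] by measurable
  have "norm (f x * cnj (g x)) \<le> norm ((norm (f x))\<^sup>2 + (norm (g x))\<^sup>2)" for x
  proof -
    have "2 * norm (f x) * norm (g x) \<le> (norm (f x))\<^sup>2 + (norm (g x))\<^sup>2"
      by (rule sum_squares_bound)
    moreover have "0 \<le> norm (f x) * norm (g x)" by simp
    ultimately have "norm (f x) * norm (g x) \<le> (norm (f x))\<^sup>2 + (norm (g x))\<^sup>2"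
      by (simp only: mult.assoc)
    then show ?thesis by (simp add: norm_mult)
  qed
  then show "AE x in M. norm (f x * cnj (g x)) \<le> norm ((norm (f x))\<^sup>2 + (norm (g x))\<^sup>2)"
    by simp
qed

lemma L2_add:
  assumes "f \<in> L2 M" "g \<in> L2 M"
  shows "(\<lambda>x. f x + g x) \<in> L2 M"
  unfolding L2_def
proof safe
  have [measurable]: "f \<in> borel_measurable M" "g \<in> borel_measurable M"
    using assms L2_measurable by auto
  show "(\<lambda>x. f x + g x) \<in> borel_measurable M" by measurable
  show "integrable M (\<lambda>x. (norm (f x + g x))\<^sup>2)"
  proof (rule Bochner_Integration.integrable_bound)
    show "integrable M (\<lambda>x. 2 * (norm (f x))\<^sup>2 + 2 * (norm (g x))\<^sup>2)"
      by (intro Bochner_Integration.integrable_add integrable_mult_right L2_integrable assms)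
    have "(norm (f x + g x))\<^sup>2 \<le> 2 * (norm (f x))\<^sup>2 + 2 * (norm (g x))\<^sup>2" for x
    proof -
      have "(norm (f x + g x))\<^sup>2 \<le> (norm (f x) + norm (g x))\<^sup>2"
        by (intro power_mono norm_triangle_ineq) simp
      also have "\<dots> \<le> 2 * (norm (f x))\<^sup>2 + 2 * (norm (g x))\<^sup>2"
        using sum_squares_bound[of "norm (f x)" "norm (g x)"] by (simp add: power2_sum)
      finally show ?thesis .
    qed
    then show "AE x in M. norm ((norm (f x + g x))\<^sup>2) \<le> norm (2 * (norm (f x))\<^sup>2 + 2 * (norm (g x))\<^sup>2)"
      by simp
  qed measurable
qed

lemma L2_cmult: "f \<in> L2 M \<Longrightarrow> (\<lambda>x. c * f x) \<in> L2 M"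
  by (auto simp: L2_def norm_mult power_mult_distrib)

interpretation L2: real_form_space "L2 M" "L2_form M" for M
proof
  fix f g h and c :: real assume f: "f \<in> L2 M" and g: "g \<in> L2 M"
  show "L2_form M f g = L2_form M g f"
    unfolding L2_form_def by (intro Bochner_Integration.integral_cong) (auto simp: mult.commute)
  show "L2_form M (\<lambda>x. of_real c * f x) g = c * L2_form M f g"
    unfolding L2_form_def by (simp add: mult.assoc flip: integral_mult_right_zero)
  assume h: "h \<in> L2 M"
  show "L2_form M (\<lambda>x. f x + g x) h = L2_form M f h + L2_form M g h"
  proof -
    have "L2_form M (\<lambda>x. f x + g x) h = (LINT x|M. Re (f x * cnj (h x)) + Re (g x * cnj (h x)))"
      unfolding L2_form_def by (simp add: ring_distribs)
    also have "\<dots> = L2_form M f h + L2_form M g h"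
      unfolding L2_form_def
      by (intro Bochner_Integration.integral_add integrable_Re L2_mult_integrable f g h)
    finally show ?thesis .
  qed
next
  fix f assume "f \<in> L2 M"
  show "0 \<le> L2_form M f f"
    unfolding L2_form_def by (intro integral_nonneg_AE) auto
qed (auto intro: L2_add L2_cmult, simp add: L2_def)

lemma L2_form_self: "L2_form M f f = (LINT x|M. (norm (f x))\<^sup>2)"
  unfolding L2_form_def by (intro Bochner_Integration.integral_cong) (auto simp: complex_mult_cnj cmod_power2)

lemma L2_nm_eq: "L2.nm M f = sqrt (LINT x|M. (norm (f x))\<^sup>2)"
  unfolding L2.nm_def L2_form_self ..

lemma L2_nm_sq: "(L2.nm M f)\<^sup>2 = (LINT x|M. (norm (f x))\<^sup>2)"
  unfolding L2_nm_eq by (simp add: integral_nonneg_AE)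

lemma L2_nm_nonneg [simp]: "0 \<le> L2.nm M f"
  unfolding L2_nm_eq by (simp add: integral_nonneg_AE)

lemma L2_form_eq_Re: "f \<in> L2 M \<Longrightarrow> g \<in> L2 M \<Longrightarrow> L2_form M f g = Re (LINT x|M. f x * cnj (g x))"
  unfolding L2_form_def by (rule integral_Re[OF L2_mult_integrable])

lemma L2_nn_integral:
  "f \<in> L2 M \<Longrightarrow> (\<integral>\<^sup>+x. ennreal ((norm (f x))\<^sup>2) \<partial>M) = ennreal ((L2.nm M f)\<^sup>2)"
  unfolding L2_nm_sq by (intro nn_integral_eq_integral L2_integrable) auto

lemma L2_of_nn_integral:
  assumes [measurable]: "f \<in> borel_measurable M"
    and le: "(\<integral>\<^sup>+x. ennreal ((norm (f x))\<^sup>2) \<partial>M) \<le> ennreal (B\<^sup>2)" and B: "0 \<le> B"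
  shows "f \<in> L2 M" "L2.nm M f \<le> B"
proof -
  show f: "f \<in> L2 M"
    unfolding L2_def using le by (auto intro!: integrableI_bounded dest: le_less_trans[OF _ ennreal_less_top])
  have "(L2.nm M f)\<^sup>2 \<le> B\<^sup>2"
    using le unfolding L2_nn_integral[OF f] by (simp add: ennreal_le_iff)
  then show "L2.nm M f \<le> B" using B by (rule power2_le_imp_le)
qed

lemma L2_nm_mono:
  assumes "f \<in> L2 M" "g \<in> borel_measurable M" "AE x in M. norm (g x) \<le> norm (f x)"
  shows "L2.nm M g \<le> L2.nm M f"
  unfolding L2_nm_eq using assms L2_dominated[OF assms]
  by (intro real_sqrt_le_mono integral_mono_AE) (auto dest: L2_integrable elim!: eventually_mono intro: power_mono)

lemma L2_nm_cong_AE: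
  "f \<in> borel_measurable M \<Longrightarrow> g \<in> borel_measurable M \<Longrightarrow> AE x in M. norm (f x) = norm (g x) \<Longrightarrow>
     L2.nm M f = L2.nm M g"
  unfolding L2_nm_eq by (intro arg_cong[of _ _ sqrt] integral_cong_AE) (auto elim!: eventually_mono)

lemma L2_cong_AE:
  assumes "f \<in> L2 M" "g \<in> borel_measurable M" "AE x in M. f x = g x"
  shows "g \<in> L2 M"
  using assms by (auto intro!: L2_dominated[OF assms(1)] elim!: eventually_mono)

lemma L2_nm_eq_0:
  assumes "f \<in> L2 M"
  shows "L2.nm M f = 0 \<longleftrightarrow> (AE x in M. f x = 0)"
  unfolding L2_nm_eq using integral_nonneg_eq_0_iff_AE[OF L2_integrable[OF assms]] by simp

lemma L2_nm_cmult: "L2.nm M (\<lambda>x. c * f x) = norm c * L2.nm M f"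
  unfolding L2_nm_eq by (simp add: norm_mult power_mult_distrib real_sqrt_mult)

lemma L2_bound_of_tendsto:
  assumes X: "\<And>n. X n \<in> L2 M" and f: "f \<in> borel_measurable M"
    and lim: "AE x in M. (\<lambda>n. X n x) \<longlonglongrightarrow> f x"
    and bound: "\<forall>\<^sub>F n in sequentially. L2.nm M (X n) \<le> B" and B: "0 \<le> B"
  shows "f \<in> L2 M" "L2.nm M f \<le> B"
proof -
  note [measurable] = X[THEN L2_measurable] f
  have "(\<integral>\<^sup>+x. ennreal ((norm (f x))\<^sup>2) \<partial>M) \<le> ennreal (B\<^sup>2)"
  proof (rule nn_integral_le_of_tendsto)
    show "AE x in M. (\<lambda>n. ennreal ((norm (X n x))\<^sup>2)) \<longlonglongrightarrow> ennreal ((norm (f x))\<^sup>2)"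
      using lim by (auto elim!: eventually_mono intro!: tendsto_intros)
    show "\<forall>\<^sub>F n in sequentially. (\<integral>\<^sup>+x. ennreal ((norm (X n x))\<^sup>2) \<partial>M) \<le> ennreal (B\<^sup>2)"
      using bound by eventually_elim (auto simp: L2_nn_integral[OF X] intro!: ennreal_leI power_mono)
  qed measurable
  then show "f \<in> L2 M" "L2.nm M f \<le> B"
    using L2_of_nn_integral[OF f _ B] by auto
qed

section \<open>Almost-everywhere subsequences and completeness of L^2\<close>

lemma L2_AE_subsequence:
  assumes X: "\<And>n. X n \<in> L2 M" and f: "f \<in> L2 M"
    and lim: "(\<lambda>n. L2.nm M (\<lambda>x. X n x - f x)) \<longlonglongrightarrow> 0"
  obtains r where "strict_mono (r :: nat \<Rightarrow> nat)" "AE x in M. (\<lambda>n. X (r n) x) \<longlonglongrightarrow> f x"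
proof -
  have int: "integrable M (\<lambda>x. (norm (X n x - f x))\<^sup>2)" for n
    by (intro L2_integrable L2.diff X f)
  have "(\<lambda>n. LINT x|M. norm ((norm (X n x - f x))\<^sup>2)) \<longlonglongrightarrow> 0"
    using tendsto_power[OF lim, of 2] by (simp add: L2_nm_sq)
  from tendsto_L1_AE_subseq[OF int this] obtain r :: "nat \<Rightarrow> nat" where r: "strict_mono r"
    and ae: "AE x in M. (\<lambda>n. (norm (X (r n) x - f x))\<^sup>2) \<longlonglongrightarrow> 0" by blast
  have "(\<lambda>n. X (r n) x) \<longlonglongrightarrow> f x" if "(\<lambda>n. (norm (X (r n) x - f x))\<^sup>2) \<longlonglongrightarrow> 0" for x
    using tendsto_real_sqrt[OF that] by (simp add: tendsto_norm_zero_iff LIM_zero_iff)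
  then have "AE x in M. (\<lambda>n. X (r n) x) \<longlonglongrightarrow> f x"
    using ae by (auto elim!: eventually_mono)
  then show thesis using that r by blast
qed

lemma L2_limit_unique:
  assumes X: "\<And>n. X n \<in> L2 M" and f: "f \<in> L2 M" and g: "g \<in> L2 M"
    and "((\<lambda>n. L2.nm M (\<lambda>x. X n x - f x)) \<longlongrightarrow> 0) F" "((\<lambda>n. L2.nm M (\<lambda>x. X n x - g x)) \<longlongrightarrow> 0) F"
    and F: "F \<noteq> bot"
  shows "AE x in M. f x = g x"
proof -
  have "((\<lambda>n. L2.nm M (\<lambda>x. X n x - f x) + L2.nm M (\<lambda>x. X n x - g x)) \<longlongrightarrow> 0 + 0) F"
    by (intro tendsto_add assms)
  moreover have "L2.nm M (\<lambda>x. f x - g x) \<le> L2.nm M (\<lambda>x. X n x - f x) + L2.nm M (\<lambda>x. X n x - g x)" for n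
    using L2.nm_triangle_diff[OF f X g, of n] L2.nm_diff_commute[OF f X, of n] by simp
  ultimately have "L2.nm M (\<lambda>x. f x - g x) \<le> 0"
    by (intro tendsto_lowerbound[OF _ _ F]) auto
  then have "L2.nm M (\<lambda>x. f x - g x) = 0"
    using L2_nm_nonneg[of M "\<lambda>x. f x - g x"] by linarith
  then show ?thesis using L2_nm_eq_0[OF L2.diff[OF f g]] by auto
qed

text \<open>Riesz-Fischer, with control over the values: \<open>sobolev_space\<close> asks for
  values in K at every point, so the limit is built as an explicit pointwise limit inside the closed
  set K.\<close>

lemma L2_Cauchy_convergent:
  assumes X: "\<And>n. X n \<in> L2 M"
    and Cauchy: "\<And>e. e > 0 \<Longrightarrow> \<exists>N. \<forall>m\<ge>N. \<forall>n\<ge>N. L2.nm M (\<lambda>x. X m x - X n x) < e"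
    and K: "closed K" "0 \<in> K" "\<And>n. range (X n) \<subseteq> K"
  obtains f where "f \<in> L2 M" "range f \<subseteq> K" "(\<lambda>n. L2.nm M (\<lambda>x. X n x - f x)) \<longlonglongrightarrow> 0"
proof -
  note [measurable] = X[THEN L2_measurable]
  have "\<exists>N. \<forall>m\<ge>N. \<forall>n\<ge>N. L2.nm M (\<lambda>x. X m x - X n x) < (1/4)^k" for k
    by (rule Cauchy) simp
  then obtain N where N: "\<And>k m n. m \<ge> N k \<Longrightarrow> n \<ge> N k \<Longrightarrow> L2.nm M (\<lambda>x. X m x - X n x) < (1/4)^k"
    by metis
  \<comment> \<open>The sum keeps \<open>r n\<close> above \<open>N n\<close>; the summand n makes r
    strictly increasing.\<close>
  define r where "r n = (\<Sum>i\<le>n. N i) + n" for n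
  have r: "strict_mono r" by (rule strict_monoI_Suc) (simp add: r_def)
  have rN: "r n \<ge> N n" for n
    using member_le_sum[of n "{..n}" N] by (simp add: r_def trans_le_add1)
  define d where "d n x = X (r (Suc n)) x - X (r n) x" for n x
  have d: "d n \<in> L2 M" for n unfolding d_def by (intro L2.diff X)
  note [measurable] = d[THEN L2_measurable]
  \<comment> \<open>The squares are at most 16^(-n), so the series of the squared differences with
    weights 4^n has a finite integral. Where it is finite, \<open>norm (d n x)\<close> is of order
    2^(-n), and the telescoping series converges absolutely.\<close>
  have dn: "L2.nm M (d n) \<le> (1/4)^n" for n
    unfolding d_def using N[of n "r (Suc n)" "r n"] rN[of n] strict_monoD[OF r, of n "Suc n"] by simp
  have "(\<integral>\<^sup>+x. (\<Sum>n. ennreal (4^n * (norm (d n x))\<^sup>2)) \<partial>M)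
      = (\<Sum>n. \<integral>\<^sup>+x. ennreal (4^n * (norm (d n x))\<^sup>2) \<partial>M)"
    by (rule nn_integral_suminf) measurable
  also have "\<dots> = (\<Sum>n. ennreal (4^n * (L2.nm M (d n))\<^sup>2))"
    by (simp add: ennreal_mult nn_integral_cmult L2_nn_integral[OF d])
  also have "\<dots> \<le> (\<Sum>n. ennreal ((1/4)^n))"
  proof (intro suminf_le ennreal_leI summableI)
    fix n
    have "4^n * (L2.nm M (d n))\<^sup>2 \<le> 4^n * ((1/4)^n)\<^sup>2"
      by (intro mult_left_mono power_mono dn) auto
    also have "\<dots> = (1/4::real)^n"
      by (simp add: power2_eq_square power_divide)
    finally show "4^n * (L2.nm M (d n))\<^sup>2 \<le> (1/4)^n" .
  qed
  also have "\<dots> < \<infinity>"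
    by (subst suminf_ennreal2) (auto intro!: summable_geometric)
  finally have "AE x in M. (\<Sum>n. ennreal (4^n * (norm (d n x))\<^sup>2)) \<noteq> \<infinity>"
    by (intro nn_integral_PInf_AE) auto
  then have conv: "AE x in M. convergent (\<lambda>n. X (r n) x)"
  proof eventually_elim
    fix x assume fin: "(\<Sum>n. ennreal (4^n * (norm (d n x))\<^sup>2)) \<noteq> \<infinity>"
    define C where "C = enn2real (\<Sum>n. ennreal (4^n * (norm (d n x))\<^sup>2))"
    have C: "(\<Sum>n. ennreal (4^n * (norm (d n x))\<^sup>2)) = ennreal C" "C \<ge> 0"
      using fin by (auto simp: C_def top.not_eq_extremum)
    have "norm (d n x) \<le> sqrt C * (1/2)^n" for n
    proof -
      have "ennreal (4^n * (norm (d n x))\<^sup>2) \<le> ennreal C"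
      proof -
        define F where "F n = ennreal (4^n * (norm (d n x))\<^sup>2)" for n
        have "sum F {n} \<le> suminf F" by (rule sum_le_suminf) auto
        then show ?thesis using C(1) unfolding F_def by simp
      qed
      then have "(norm (d n x))\<^sup>2 \<le> C * (1/4)^n"
        using C by (simp add: field_simps)
      also have "\<dots> = (sqrt C * (1/2)^n)\<^sup>2"
        using C power_mult_distrib[of "1/2::real" "1/2" n] by (simp add: power_mult_distrib power2_eq_square)
      finally show ?thesis by (rule power2_le_imp_le) (use C in auto)
    qed
    moreover have "summable (\<lambda>n. sqrt C * (1/2)^n)"
      by (rule summable_mult, rule summable_geometric) simp
    ultimately have "summable (\<lambda>n. d n x)"
      by (metis summable_comparison_test')
    then have "convergent (\<lambda>n. X (r 0) x + (\<Sum>i<n. d i x))"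
      by (intro convergent_add convergent_const) (simp add: summable_iff_convergent)
    then show "convergent (\<lambda>n. X (r n) x)"
      unfolding d_def using sum_lessThan_telescope[of "\<lambda>i. X (r i) x"] by simp
  qed
  \<comment> \<open>The default 0 lies in K, and the set where the sequence is Cauchy is measurable;
    so f is measurable and takes values in K everywhere.\<close>
  define f where "f x = (if Cauchy (\<lambda>n. X (r n) x) then lim (\<lambda>n. X (r n) x) else 0)" for x
  have [measurable]: "f \<in> borel_measurable M"
    unfolding f_def by measurable
  have lim: "AE x in M. (\<lambda>n. X (r n) x) \<longlonglongrightarrow> f x"
    using conv by (auto elim!: eventually_mono simp: f_def Cauchy_convergent_iff convergent_LIMSEQ_iff)
  have fK: "range f \<subseteq> K"
  proof -
    have "f x \<in> K" for x
    proof (cases "Cauchy (\<lambda>n. X (r n) x)")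
      case True
      then have "(\<lambda>n. X (r n) x) \<longlonglongrightarrow> f x"
        by (simp add: f_def Cauchy_convergent_iff convergent_LIMSEQ_iff)
      then show ?thesis by (rule closed_sequentially[OF K(1), rotated]) (use K in auto)
    qed (simp add: f_def K)
    then show ?thesis by auto
  qed
  \<comment> \<open>The second index of the Cauchy estimate is sent to infinity by Fatou's
    lemma.\<close>
  have close: "(\<lambda>x. X m x - f x) \<in> L2 M \<and> L2.nm M (\<lambda>x. X m x - f x) \<le> e"
    if e: "e > 0" and NN: "\<And>m n. m \<ge> k \<Longrightarrow> n \<ge> k \<Longrightarrow> L2.nm M (\<lambda>x. X m x - X n x) < e" and m: "m \<ge> k" for e k m
  proof -
    have lim': "AE x in M. (\<lambda>n. X m x - X (r n) x) \<longlonglongrightarrow> X m x - f x"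
      using lim by (auto elim!: eventually_mono intro!: tendsto_intros)
    have "n \<ge> k \<Longrightarrow> r n \<ge> k" for n using seq_suble[OF r, of n] by simp
    then have ev: "\<forall>\<^sub>F n in sequentially. L2.nm M (\<lambda>x. X m x - X (r n) x) \<le> e"
      using NN m by (auto simp: eventually_sequentially intro!: exI[of _ k] less_imp_le)
    show ?thesis
      using L2_bound_of_tendsto[OF L2.diff[OF X X] _ lim' ev less_imp_le[OF e]] by simp
  qed
  obtain k where "\<And>m n. m \<ge> k \<Longrightarrow> n \<ge> k \<Longrightarrow> L2.nm M (\<lambda>x. X m x - X n x) < 1"
    using Cauchy[of 1] by auto
  then have "(\<lambda>x. X k x - f x) \<in> L2 M" using close[of 1 k k] by auto
  from L2.diff[OF X[of k] this] have f: "f \<in> L2 M" by simp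
  have "(\<lambda>n. L2.nm M (\<lambda>x. X n x - f x)) \<longlonglongrightarrow> 0"
  proof (rule LIMSEQ_I)
    fix e :: real assume e: "e > 0"
    then obtain k where "\<And>m n. m \<ge> k \<Longrightarrow> n \<ge> k \<Longrightarrow> L2.nm M (\<lambda>x. X m x - X n x) < e / 2"
      using Cauchy[of "e/2"] by auto
    then have "L2.nm M (\<lambda>x. X m x - f x) \<le> e / 2" if "m \<ge> k" for m
      using close[of "e/2" k m] e that by auto
    then show "\<exists>k. \<forall>n\<ge>k. norm (L2.nm M (\<lambda>x. X n x - f x) - 0) < e"
      using e by (intro exI[of _ k]) (auto intro: le_less_trans[of _ "e/2"])
  qed
  then show thesis using that f fK by blast
qed

text \<open>Cauchy-Schwarz for \<open>norm (f x)\<close> against the indicator of E.\<close>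

lemma L2_indicator_integral:
  assumes f: "f \<in> L2 M" and E: "E \<in> sets M" "emeasure M E < \<infinity>" and 0: "\<And>x. x \<notin> E \<Longrightarrow> f x = 0"
  shows "integrable M f" "(LINT x|M. norm (f x)) \<le> sqrt (measure M E) * L2.nm M f"
proof -
  have ind: "(\<lambda>x. indicator E x :: complex) \<in> L2 M"
  proof -
    have "integrable M (indicator E :: _ \<Rightarrow> real)" using E by (simp add: integrable_indicator_iff)
    moreover have "(norm (indicator E x :: complex))\<^sup>2 = indicator E x" for x by (simp add: indicator_def)
    ultimately show ?thesis using E by (simp add: L2_def)
  qed
  have nf: "(\<lambda>x. of_real (norm (f x))) \<in> L2 M"
    using f by (auto simp: L2_def)
  have eq: "of_real (norm (f x)) * cnj (indicator E x) = complex_of_real (norm (f x))" for x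
    using 0[of x] by (cases "x \<in> E") auto
  have int: "integrable M (\<lambda>x. complex_of_real (norm (f x)))"
    using L2_mult_integrable[OF nf ind] unfolding eq .
  then have "integrable M (\<lambda>x. norm (complex_of_real (norm (f x))))" by (rule integrable_norm)
  then show "integrable M f" using L2_measurable[OF f] by (simp add: integrable_norm_iff)
  have "(LINT x|M. norm (f x)) = L2_form M (\<lambda>x. of_real (norm (f x))) (\<lambda>x. indicator E x)"
    unfolding L2_form_def eq by simp
  also have "\<dots> \<le> L2.nm M (\<lambda>x. of_real (norm (f x))) * L2.nm M (\<lambda>x. indicator E x)"
    using L2.Cauchy_Schwarz[OF nf ind] by simp
  also have "L2.nm M (\<lambda>x. of_real (norm (f x))) = L2.nm M f"
    unfolding L2_nm_eq by simp
  also have "L2.nm M (\<lambda>x. indicator E x) = sqrt (measure M E)"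
  proof -
    have "(norm (indicator E x :: complex))\<^sup>2 = indicator E x" for x by (simp add: indicator_def)
    then show ?thesis unfolding L2_nm_eq using E by simp
  qed
  finally show "(LINT x|M. norm (f x)) \<le> sqrt (measure M E) * L2.nm M f" by (simp add: mult.commute)
qed

section \<open>Gaussians and Fourier integrals\<close>

text \<open>\<open>lborel\<close> is the image of a product of one-dimensional Lebesgue measures
  under the coordinate map, so product functions integrate factor by factor.\<close>

lemma lborel_integral_prod:
  fixes f :: "'a::euclidean_space \<Rightarrow> real \<Rightarrow> complex"
  assumes f: "\<And>b. b \<in> Basis \<Longrightarrow> integrable lborel (f b)"
  shows "integrable lborel (\<lambda>x::'a. \<Prod>b\<in>Basis. f b (x \<bullet> b))"
    and "(LINT x|lborel. (\<Prod>b\<in>Basis. f b ((x::'a) \<bullet> b))) = (\<Prod>b\<in>Basis. (LINT x|lborel. f b x))"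
proof -
  interpret product_sigma_finite "\<lambda>_::'a. lborel :: real measure" ..
  have meas: "\<And>b. b \<in> Basis \<Longrightarrow> f b \<in> borel_measurable borel"
    using f[THEN borel_measurable_integrable] by simp
  have T[measurable]: "(\<lambda>f. \<Sum>b\<in>Basis. f b *\<^sub>R b) \<in> (\<Pi>\<^sub>M b\<in>Basis. lborel) \<rightarrow>\<^sub>M (borel :: 'a measure)"
    by measurable
  have coord: "(\<Sum>c\<in>Basis. g c *\<^sub>R c) \<bullet> b = g b" if "b \<in> Basis" for g and b :: 'a
    using that by simp
  have F[measurable]: "(\<lambda>x::'a. \<Prod>b\<in>Basis. f b (x \<bullet> b)) \<in> borel_measurable borel"
    by (intro borel_measurable_prod measurable_compose[OF _ meas]) auto
  have eq: "(\<Prod>b\<in>Basis. f b ((\<Sum>c\<in>Basis. g c *\<^sub>R c) \<bullet> b)) = (\<Prod>b\<in>Basis. f b (g b))" for g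
    by (rule prod.cong[OF refl]) (simp only: coord)
  have "integrable (\<Pi>\<^sub>M b\<in>Basis. lborel) (\<lambda>g. \<Prod>b\<in>Basis. f b (g b))"
    using f by (intro product_integrable_prod) auto
  then have "integrable (distr (\<Pi>\<^sub>M b\<in>Basis. lborel) borel (\<lambda>f. \<Sum>b\<in>Basis. f b *\<^sub>R b)) (\<lambda>x::'a. \<Prod>b\<in>Basis. f b (x \<bullet> b))"
    by (subst integrable_distr_eq[OF T F]) (simp only: eq)
  then show "integrable lborel (\<lambda>x::'a. \<Prod>b\<in>Basis. f b (x \<bullet> b))"
    unfolding lborel_eq[symmetric] .
  have "(LINT x|lborel. (\<Prod>b\<in>Basis. f b ((x::'a) \<bullet> b))) =
      (LINT x|distr (\<Pi>\<^sub>M b\<in>Basis. lborel) borel (\<lambda>f. \<Sum>b\<in>Basis. f b *\<^sub>R b). (\<Prod>b\<in>Basis. f b ((x::'a) \<bullet> b)))"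
    unfolding lborel_eq[symmetric] ..
  also have "\<dots> = (LINT g|(\<Pi>\<^sub>M b\<in>Basis. lborel). (\<Prod>b\<in>Basis. f b (g b)))"
    by (subst integral_distr[OF T F]) (simp only: eq)
  also have "\<dots> = (\<Prod>b\<in>Basis. (LINT x|lborel. f b x))"
    using f by (intro product_integral_prod) auto
  finally show "(LINT x|lborel. (\<Prod>b\<in>Basis. f b ((x::'a) \<bullet> b))) = (\<Prod>b\<in>Basis. (LINT x|lborel. f b x))" .
qed

text \<open>Without a normalizing factor this is its own Fourier transform under the unitary
  normalization of \<open>fourier_integral\<close>.\<close>

definition gaussian :: "'a::euclidean_space \<Rightarrow> real" where
  "gaussian x = exp (- (norm x)\<^sup>2 / 2)"

lemma gaussian_nonneg [simp]: "0 \<le> gaussian x"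
  and gaussian_le_1: "gaussian x \<le> 1"
  by (auto simp: gaussian_def)

lemma borel_measurable_gaussian [measurable]: "gaussian \<in> borel_measurable borel"
  unfolding gaussian_def[abs_def] by measurable

text \<open>The integral is the characteristic function of the standard normal distribution at
  \<open>- t\<close>.\<close>

lemma fourier_std_normal:
  "integrable lborel (\<lambda>x. exp (- (\<i> * of_real (x * t))) * of_real (std_normal_density x))" (is ?I)
  "(LINT x|lborel. exp (- (\<i> * of_real (x * t))) * of_real (std_normal_density x)) = of_real (exp (- t\<^sup>2 / 2))"
proof -
  show ?I
  proof (rule Bochner_Integration.integrable_bound)
    show "integrable lborel std_normal_density" by simp
    show "AE x in lborel. norm (exp (- (\<i> * of_real (x * t))) * of_real (std_normal_density x)) \<le> norm (std_normal_density x)"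
      by (simp add: norm_mult norm_exp_eq_Re)
  qed measurable
  have "char std_normal_distribution (- t) =
      (LINT x|lborel. std_normal_density x *\<^sub>R exp (\<i> * of_real (- t * x)))"
    unfolding char_def by (rule integral_density) (auto simp: normal_density_nonneg)
  also have "\<dots> = (LINT x|lborel. exp (- (\<i> * of_real (x * t))) * of_real (std_normal_density x))"
    by (intro Bochner_Integration.integral_cong refl) (simp add: scaleR_conv_of_real mult_ac)
  finally show "(LINT x|lborel. exp (- (\<i> * of_real (x * t))) * of_real (std_normal_density x)) = of_real (exp (- t\<^sup>2 / 2))"
    by (simp add: char_std_normal_distribution)
qed

lemma norm_sq_Basis: "(norm (x::'a::euclidean_space))\<^sup>2 = (\<Sum>b\<in>Basis. (x \<bullet> b)\<^sup>2)"
  unfolding power2_norm_eq_inner by (subst euclidean_inner) (simp add: power2_eq_square)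

lemma gaussian_eq_prod_exp: "gaussian (x::'a::euclidean_space) = (\<Prod>b\<in>Basis. exp (- (x \<bullet> b)\<^sup>2 / 2))"
  unfolding gaussian_def norm_sq_Basis by (subst exp_sum[symmetric]) (auto simp: sum_negf sum_divide_distrib)

lemma gaussian_eq_prod:
  "gaussian (x::'a::euclidean_space) = sqrt (2 * pi) ^ DIM('a) * (\<Prod>b\<in>Basis. std_normal_density (x \<bullet> b))"
proof -
  have "gaussian x = (\<Prod>b\<in>Basis. sqrt (2 * pi) * std_normal_density (x \<bullet> b))"
    unfolding gaussian_eq_prod_exp by (intro prod.cong refl) (simp add: std_normal_density_def)
  then show ?thesis by (simp add: prod.distrib prod_constant)
qed

text \<open>The character and the Gaussian both factor over the coordinates, which reduces the
  integral to dimension one.\<close>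

lemma fourier_gaussian:
  fixes t :: "'a::euclidean_space"
  shows "integrable lborel (\<lambda>x. exp (- (\<i> * of_real (x \<bullet> t))) * of_real (gaussian x))"
    and "(LINT x|lborel. exp (- (\<i> * of_real (x \<bullet> t))) * of_real (gaussian x)) =
      of_real (sqrt (2 * pi) ^ DIM('a) * gaussian t)"
proof -
  let ?f = "\<lambda>b x. exp (- (\<i> * of_real (x * (t \<bullet> b)))) * complex_of_real (std_normal_density x)"
  have eq: "exp (- (\<i> * of_real (x \<bullet> t))) * of_real (gaussian x) =
      of_real (sqrt (2 * pi) ^ DIM('a)) * (\<Prod>b\<in>Basis. ?f b (x \<bullet> b))" for x
  proof -
    have "- (\<i> * complex_of_real (x \<bullet> t)) = (\<Sum>b\<in>Basis. - (\<i> * of_real ((x \<bullet> b) * (t \<bullet> b))))"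
      by (subst euclidean_inner) (simp add: sum_distrib_left sum_negf)
    then have "exp (- (\<i> * complex_of_real (x \<bullet> t))) = (\<Prod>b\<in>Basis. exp (- (\<i> * of_real ((x \<bullet> b) * (t \<bullet> b)))))"
      by (simp add: exp_sum)
    then show ?thesis unfolding gaussian_eq_prod by (simp add: prod.distrib)
  qed
  show "integrable lborel (\<lambda>x. exp (- (\<i> * of_real (x \<bullet> t))) * of_real (gaussian x))"
    unfolding eq by (intro integrable_mult_right lborel_integral_prod(1) fourier_std_normal)
  have "(LINT x|lborel. exp (- (\<i> * of_real (x \<bullet> t))) * of_real (gaussian x)) =
      of_real (sqrt (2 * pi) ^ DIM('a)) * (\<Prod>b\<in>Basis. (LINT x|lborel. ?f b x))"
    unfolding eq by (subst integral_mult_right_zero, subst lborel_integral_prod(2)[where f="?f", OF fourier_std_normal(1)]) simp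
  also have "(\<Prod>b\<in>Basis. (LINT x|lborel. ?f b x)) = (\<Prod>b\<in>Basis. of_real (exp (- (t \<bullet> b)\<^sup>2 / 2)))"
    unfolding fourier_std_normal(2) ..
  also have "\<dots> = of_real (gaussian t)"
    unfolding gaussian_eq_prod_exp of_real_prod ..
  finally show "(LINT x|lborel. exp (- (\<i> * of_real (x \<bullet> t))) * of_real (gaussian x)) =
      of_real (sqrt (2 * pi) ^ DIM('a) * gaussian t)" by simp
qed

lemma integrable_gaussian: "integrable lborel (gaussian :: 'a::euclidean_space \<Rightarrow> real)"
  and integral_gaussian: "(LINT x|lborel. gaussian (x::'a)) = sqrt (2 * pi) ^ DIM('a)"
proof -
  have i: "integrable lborel (\<lambda>x::'a. complex_of_real (gaussian x))"
    using fourier_gaussian(1)[of "0::'a"] by simp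
  then show "integrable lborel (gaussian :: 'a::euclidean_space \<Rightarrow> real)"
    using integrable_Re[OF i] by simp
  have "complex_of_real (LINT x|lborel. gaussian (x::'a)) = of_real (sqrt (2 * pi) ^ DIM('a))"
    using fourier_gaussian(2)[of "0::'a"] by (simp add: gaussian_def)
  then show "(LINT x|lborel. gaussian (x::'a)) = sqrt (2 * pi) ^ DIM('a)"
    unfolding of_real_eq_iff .
qed

section \<open>Affine substitutions and the rules for Fourier integrals\<close>

lemma lborel_affine_integral:
  fixes f :: "'a::euclidean_space \<Rightarrow> complex"
  assumes [measurable]: "f \<in> borel_measurable borel" and c: "c \<noteq> 0"
  shows "(LINT x|lborel. f x) = of_real (\<bar>c\<bar> ^ DIM('a)) * (LINT x|lborel. f (t + c *\<^sub>R x))"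
proof -
  have "(LINT x|lborel. f x) =
      (LINT x|density (distr lborel borel (\<lambda>x. t + c *\<^sub>R x)) (\<lambda>_. ennreal (\<bar>c\<bar>^DIM('a))). f x)"
    using lborel_affine[OF c, of t] by simp
  also have "\<dots> = (LINT x|distr lborel borel (\<lambda>x. t + c *\<^sub>R x). \<bar>c\<bar>^DIM('a) *\<^sub>R f x)"
    by (rule integral_density) auto
  also have "\<dots> = (LINT x|lborel. \<bar>c\<bar>^DIM('a) *\<^sub>R f (t + c *\<^sub>R x))"
    by (rule integral_distr) auto
  finally show ?thesis by (simp add: scaleR_conv_of_real)
qed

lemma lborel_affine_integrable:
  fixes f :: "'a::euclidean_space \<Rightarrow> 'b::{banach,second_countable_topology}"
  assumes f: "integrable lborel f" and c: "c \<noteq> 0"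
  shows "integrable lborel (\<lambda>x. f (t + c *\<^sub>R x))"
proof -
  have [measurable]: "f \<in> borel_measurable borel" using borel_measurable_integrable[OF f] by simp
  have "integrable (density (distr lborel borel (\<lambda>x. t + c *\<^sub>R x)) (\<lambda>_. ennreal (\<bar>c\<bar>^DIM('a)))) f"
    using f lborel_affine[OF c, of t] by simp
  then have "integrable lborel (\<lambda>x. \<bar>c\<bar> ^ DIM('a) *\<^sub>R f (t + c *\<^sub>R x))"
    by (subst (asm) integrable_density) (auto simp: integrable_distr_eq)
  from integrable_scaleR_right[OF this, of "inverse (\<bar>c\<bar> ^ DIM('a))"] show ?thesis
    using c by simp
qed

lemma lborel_affine_nn_integral:
  fixes f :: "'a::euclidean_space \<Rightarrow> ennreal"
  assumes [measurable]: "f \<in> borel_measurable borel" and c: "\<bar>c\<bar> = 1"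
  shows "(\<integral>\<^sup>+x. f (t + c *\<^sub>R x) \<partial>lborel) = (\<integral>\<^sup>+x. f x \<partial>lborel)"
proof -
  have "c \<noteq> 0" using c by auto
  then have "(\<integral>\<^sup>+x. f x \<partial>lborel) =
      (\<integral>\<^sup>+x. f x \<partial>density (distr lborel borel (\<lambda>x. t + c *\<^sub>R x)) (\<lambda>_. ennreal (\<bar>c\<bar>^DIM('a))))"
    using lborel_affine[of c t] by simp
  also have "\<dots> = (\<integral>\<^sup>+x. f (t + c *\<^sub>R x) \<partial>lborel)"
    by (simp add: nn_integral_density nn_integral_distr c)
  finally show ?thesis ..
qed

lemma norm_character [simp]: "norm (exp (- (\<i> * complex_of_real r))) = 1"
  by (simp add: norm_exp_eq_Re)

lemma integrable_character_mult:
  fixes f :: "'a::euclidean_space \<Rightarrow> complex"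
  assumes f: "integrable lborel f"
  shows "integrable lborel (\<lambda>x. exp (- (\<i> * of_real (x \<bullet> \<xi>))) * f x)"
proof (rule Bochner_Integration.integrable_bound[OF f])
  have [measurable]: "f \<in> borel_measurable borel" using borel_measurable_integrable[OF f] by simp
  show "(\<lambda>x. exp (- (\<i> * of_real (x \<bullet> \<xi>))) * f x) \<in> borel_measurable lborel" by measurable
qed (simp add: norm_mult)

lemma borel_measurable_fourier_integral [measurable (raw)]:
  assumes [measurable]: "f \<in> borel_measurable borel"
  shows "fourier_integral f \<in> borel_measurable borel"
  unfolding fourier_integral_def[abs_def] by measurable

lemma fourier_integral_bound:
  fixes f :: "real ^ 'n \<Rightarrow> complex"
  assumes f: "integrable lborel f"
  shows "norm (fourier_integral f \<xi>) \<le> (2 * pi) powr (- real CARD('n) / 2) * (LINT x|lborel. norm (f x))"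
proof -
  have "norm (LINT x|lborel. exp (- (\<i> * of_real (x \<bullet> \<xi>))) * f x) \<le>
      (LINT x|lborel. norm (exp (- (\<i> * of_real (x \<bullet> \<xi>))) * f x))"
    by (rule integral_norm_bound)
  then show ?thesis unfolding fourier_integral_def by (simp add: norm_mult mult_left_mono)
qed

lemma fourier_integral_add:
  "integrable lborel f \<Longrightarrow> integrable lborel g \<Longrightarrow>
     fourier_integral (\<lambda>x. f x + g x) \<xi> = fourier_integral f \<xi> + fourier_integral g \<xi>"
  unfolding fourier_integral_def
  by (simp add: ring_distribs integrable_character_mult)

lemma fourier_integral_diff:
  "integrable lborel f \<Longrightarrow> integrable lborel g \<Longrightarrow>
     fourier_integral (\<lambda>x. f x - g x) \<xi> = fourier_integral f \<xi> - fourier_integral g \<xi>"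
  unfolding fourier_integral_def
  by (simp add: ring_distribs right_diff_distrib integrable_character_mult)

lemma fourier_integral_cmult: "fourier_integral (\<lambda>x. c * f x) \<xi> = c * fourier_integral f \<xi>"
proof -
  have "(LINT x|lborel. exp (- (\<i> * of_real (x \<bullet> \<xi>))) * (c * f x)) =
      (LINT x|lborel. c * (exp (- (\<i> * of_real (x \<bullet> \<xi>))) * f x))"
    by (intro Bochner_Integration.integral_cong) auto
  then show ?thesis unfolding fourier_integral_def by simp
qed

lemma fourier_integral_translate:
  fixes f :: "real ^ 'n \<Rightarrow> complex"
  assumes [measurable]: "f \<in> borel_measurable borel"
  shows "fourier_integral (\<lambda>x. f (x - y)) \<xi> = exp (- (\<i> * of_real (y \<bullet> \<xi>))) * fourier_integral f \<xi>"
proof -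
  have "(LINT x|lborel. exp (- (\<i> * of_real (x \<bullet> \<xi>))) * f (x - y)) =
      (LINT x|lborel. exp (- (\<i> * of_real ((y + x) \<bullet> \<xi>))) * f x)"
    by (subst lborel_affine_integral[where c=1 and t=y]) auto
  also have "\<dots> = (LINT x|lborel. exp (- (\<i> * of_real (y \<bullet> \<xi>))) * (exp (- (\<i> * of_real (x \<bullet> \<xi>))) * f x))"
    by (intro Bochner_Integration.integral_cong refl) (simp add: inner_add_left ring_distribs exp_add[symmetric] exp_diff exp_minus field_simps)
  finally show ?thesis unfolding fourier_integral_def by simp
qed

lemma fourier_integral_modulate:
  "fourier_integral (\<lambda>x. exp (- (\<i> * of_real (x \<bullet> y))) * f x) \<xi> = fourier_integral f (\<xi> + y)"
proof -
  have "(LINT x|lborel. exp (- (\<i> * of_real (x \<bullet> \<xi>))) * (exp (- (\<i> * of_real (x \<bullet> y))) * f x)) =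
      (LINT x|lborel. exp (- (\<i> * of_real (x \<bullet> (\<xi> + y)))) * f x)"
    by (intro Bochner_Integration.integral_cong refl) (simp add: inner_add_right ring_distribs exp_diff exp_minus field_simps exp_add)
  then show ?thesis unfolding fourier_integral_def by simp
qed

lemma cnj_fourier_integral:
  fixes f :: "real ^ 'n \<Rightarrow> complex"
  assumes [measurable]: "f \<in> borel_measurable borel"
  shows "cnj (fourier_integral f \<xi>) = fourier_integral (\<lambda>x. cnj (f (- x))) \<xi>"
proof -
  have "cnj (LINT x|lborel. exp (- (\<i> * of_real (x \<bullet> \<xi>))) * f x) =
      (LINT x|lborel. cnj (exp (- (\<i> * of_real (x \<bullet> \<xi>))) * f x))"
    by (rule Bochner_Integration.integral_cnj[symmetric])
  also have "\<dots> = (LINT x|lborel. exp (- (\<i> * of_real (x \<bullet> \<xi>))) * cnj (f (- x)))"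
    by (subst lborel_affine_integral[where c="-1" and t=0]) (auto simp: exp_cnj)
  finally show ?thesis unfolding fourier_integral_def by simp
qed

text \<open>Fubini: the kernel is symmetric in its two variables and has modulus 1, so the double
  integrand is dominated by a product of integrable functions.\<close>

lemma fourier_integral_multiplication:
  fixes f g :: "real ^ 'n \<Rightarrow> complex"
  assumes f: "integrable lborel f" and g: "integrable lborel g"
  shows "(LINT \<xi>|lborel. fourier_integral f \<xi> * g \<xi>) = (LINT x|lborel. f x * fourier_integral g x)"
proof -
  have [measurable]: "f \<in> borel_measurable borel" "g \<in> borel_measurable borel"
    using borel_measurable_integrable f g by auto
  define k where "k = (\<lambda>x \<xi>. exp (- (\<i> * complex_of_real (x \<bullet> \<xi>))) * f x * g \<xi>)"
  have [measurable]: "case_prod k \<in> borel_measurable (lborel \<Otimes>\<^sub>M lborel)"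
    unfolding k_def by measurable
  have norm_k: "norm (k x \<xi>) = norm (f x) * norm (g \<xi>)" for x \<xi>
    by (simp add: k_def norm_mult)
  have "integrable (lborel \<Otimes>\<^sub>M lborel) (case_prod k)"
  proof (rule lborel_pair.Fubini_integrable)
    show "integrable lborel (\<lambda>x. LINT y|lborel. norm (case_prod k (x, y)))"
      using f by (simp add: norm_k)
    have "integrable lborel (k x)" for x
      unfolding k_def using integrable_mult_right[OF integrable_character_mult[OF g, of x], of "f x"]
      by (simp add: mult_ac inner_commute)
    then show "AE x in lborel. integrable lborel (\<lambda>y. case_prod k (x, y))" by simp
  qed measurable
  then have eq: "(LINT \<xi>|lborel. LINT x|lborel. k x \<xi>) = (LINT x|lborel. LINT \<xi>|lborel. k x \<xi>)"
    by (rule lborel_pair.Fubini_integral)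
  have 1: "(LINT x|lborel. k x \<xi>) = (LINT x|lborel. exp (- (\<i> * of_real (x \<bullet> \<xi>))) * f x) * g \<xi>" for \<xi>
    unfolding k_def by simp
  have 2: "(LINT \<xi>|lborel. k x \<xi>) = f x * (LINT \<xi>|lborel. exp (- (\<i> * of_real (\<xi> \<bullet> x))) * g \<xi>)" for x
    unfolding k_def by (subst integral_mult_right_zero[symmetric]) (simp add: mult_ac inner_commute)
  define c where "c = complex_of_real ((2 * pi) powr (- real CARD('n) / 2))"
  have "(LINT \<xi>|lborel. fourier_integral f \<xi> * g \<xi>) = c * (LINT \<xi>|lborel. LINT x|lborel. k x \<xi>)"
    unfolding 1 by (subst integral_mult_right_zero[symmetric]) (simp add: fourier_integral_def c_def mult.assoc)
  also have "\<dots> = c * (LINT x|lborel. LINT \<xi>|lborel. k x \<xi>)"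
    unfolding eq ..
  also have "\<dots> = (LINT x|lborel. f x * fourier_integral g x)"
    unfolding 2 by (subst integral_mult_right_zero[symmetric]) (simp add: fourier_integral_def c_def mult_ac)
  finally show ?thesis .
qed

section \<open>Plancherel's theorem\<close>

lemma fourier_normalization: "(2 * pi) powr (- real N / 2) * sqrt (2 * pi) ^ N = 1"
proof -
  have "sqrt (2 * pi) ^ N = ((2 * pi) powr (1/2)) powr real N"
    by (simp add: powr_half_sqrt powr_realpow)
  also have "\<dots> = (2 * pi) powr (real N / 2)"
    by (simp add: powr_powr)
  finally show ?thesis
    by (simp flip: powr_add)
qed

definition normal_kernel :: "real ^ 'n \<Rightarrow> real" where
  "normal_kernel w = (2 * pi) powr (- real CARD('n) / 2) * gaussian w"

lemma normal_kernel_nonneg [simp]: "0 \<le> normal_kernel w"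
  by (simp add: normal_kernel_def)

lemma borel_measurable_normal_kernel [measurable]: "normal_kernel \<in> borel_measurable borel"
  unfolding normal_kernel_def[abs_def] by measurable

lemma borel_measurable_ennreal_normal_kernel: "(\<lambda>w. ennreal (normal_kernel w)) \<in> borel_measurable lborel"
  by measurable

lemma integrable_normal_kernel: "integrable lborel (normal_kernel :: real ^ 'n \<Rightarrow> real)"
  unfolding normal_kernel_def[abs_def] using integrable_gaussian by auto

lemma integral_normal_kernel: "(LINT w|lborel. normal_kernel (w :: real ^ 'n)) = 1"
  unfolding normal_kernel_def[abs_def]
  using fourier_normalization[of "CARD('n)"] by (simp add: integral_gaussian)

lemma nn_integral_normal_kernel: "(\<integral>\<^sup>+w. ennreal (normal_kernel (w :: real ^ 'n)) \<partial>lborel) = 1"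
  using nn_integral_eq_integral[OF integrable_normal_kernel] by (simp add: integral_normal_kernel)

lemma integrable_gaussian_scaled:
  assumes "\<epsilon> \<noteq> 0"
  shows "integrable lborel (\<lambda>x::'a::euclidean_space. complex_of_real (gaussian (\<epsilon> *\<^sub>R x)))"
  using lborel_affine_integrable[OF integrable_gaussian assms, of 0] by auto

lemma fourier_integral_gaussian_scaled:
  fixes \<xi> :: "real ^ 'n"
  assumes e: "\<epsilon> > 0"
  shows "fourier_integral (\<lambda>x. of_real (gaussian (\<epsilon> *\<^sub>R x))) \<xi> =
    of_real (inverse \<epsilon> ^ CARD('n) * gaussian (inverse \<epsilon> *\<^sub>R \<xi>))"
proof -
  let ?c = "(2 * pi) powr (- real CARD('n) / 2)"
  have "(LINT x|lborel. exp (- (\<i> * of_real (x \<bullet> \<xi>))) * of_real (gaussian (\<epsilon> *\<^sub>R x))) =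
      of_real (\<bar>inverse \<epsilon>\<bar> ^ CARD('n)) *
      (LINT x|lborel. exp (- (\<i> * of_real (x \<bullet> (inverse \<epsilon> *\<^sub>R \<xi>)))) * complex_of_real (gaussian (x :: real ^ 'n)))"
    using e by (subst lborel_affine_integral[where c="inverse \<epsilon>" and t=0]) auto
  also have "\<dots> = of_real (inverse \<epsilon> ^ CARD('n) * (sqrt (2 * pi) ^ CARD('n) * gaussian (inverse \<epsilon> *\<^sub>R \<xi>)))"
    using e unfolding fourier_gaussian(2) by simp
  finally have "fourier_integral (\<lambda>x. of_real (gaussian (\<epsilon> *\<^sub>R x))) \<xi> =
      of_real ((?c * sqrt (2 * pi) ^ CARD('n)) * (inverse \<epsilon> ^ CARD('n) * gaussian (inverse \<epsilon> *\<^sub>R \<xi>)))"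
    unfolding fourier_integral_def by (simp only: of_real_mult mult_ac)
  then show ?thesis unfolding fourier_normalization by simp
qed

lemma integrable_bounded_mult:
  fixes f g :: "'a \<Rightarrow> complex"
  assumes f: "integrable M f" and g: "g \<in> borel_measurable M" and B: "\<And>x. norm (g x) \<le> B"
  shows "integrable M (\<lambda>x. g x * f x)"
proof (rule Bochner_Integration.integrable_bound)
  show "integrable M (\<lambda>x. B * norm (f x))" using f by simp
  have "norm (g x * f x) \<le> norm (B * norm (f x))" for x
    using mult_right_mono[OF B[of x] norm_ge_zero[of "f x"]] by (simp add: norm_mult)
  then show "AE x in M. norm (g x * f x) \<le> norm (B * norm (f x))" by simp
qed (use f g in auto)

text \<open>Plancherel's identity with a Gaussian convergence factor. The squared modulus is the
  product of the transforms of f and of \<open>f'\<close>, the conjugated reflection of f. The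
  multiplication formula removes the transform from f, and a second use of it turns the other factor
  into a Gaussian average of the conjugate of f at scale \<epsilon>.\<close>

lemma fourier_integral_gaussian_identity:
  fixes f :: "real ^ 'n \<Rightarrow> complex"
  assumes f: "integrable lborel f" and e: "\<epsilon> > 0"
  shows "integrable lborel (\<lambda>\<xi>. (norm (fourier_integral f \<xi>))\<^sup>2 * gaussian (\<epsilon> *\<^sub>R \<xi>))"
    and "of_real (LINT \<xi>|lborel. (norm (fourier_integral f \<xi>))\<^sup>2 * gaussian (\<epsilon> *\<^sub>R \<xi>)) =
      (LINT x|lborel. f x * (LINT w|lborel. cnj (f (x - \<epsilon> *\<^sub>R w)) * of_real (normal_kernel w)))"
proof -
  have [measurable]: "f \<in> borel_measurable borel"
    using borel_measurable_integrable[OF f] by simp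
  let ?c = "(2 * pi) powr (- real CARD('n) / 2)"
  define f' where "f' x = cnj (f (- x))" for x
  have f': "integrable lborel f'"
    unfolding f'_def using lborel_affine_integrable[OF f, of "-1" 0] by simp
  have [measurable]: "f' \<in> borel_measurable borel"
    using borel_measurable_integrable[OF f'] by simp
  define E where "E \<xi> = complex_of_real (gaussian (\<epsilon> *\<^sub>R \<xi>))" for \<xi> :: "real ^ 'n"
  have E: "integrable lborel E"
    unfolding E_def using e by (intro integrable_gaussian_scaled) simp
  have G: "integrable lborel (\<lambda>\<xi>. fourier_integral f' \<xi> * E \<xi>)"
    by (rule integrable_bounded_mult[OF E _ fourier_integral_bound[OF f']]) measurable
  have sq: "of_real ((norm (fourier_integral f \<xi>))\<^sup>2 * gaussian (\<epsilon> *\<^sub>R \<xi>)) =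
      fourier_integral f \<xi> * (fourier_integral f' \<xi> * E \<xi>)" for \<xi>
    unfolding f'_def E_def by (simp add: cnj_fourier_integral[symmetric] complex_norm_square del: of_real_power)
  have "integrable lborel (\<lambda>\<xi>. fourier_integral f \<xi> * (fourier_integral f' \<xi> * E \<xi>))"
    by (rule integrable_bounded_mult[OF G _ fourier_integral_bound[OF f]]) measurable
  then have "integrable lborel (\<lambda>\<xi>. complex_of_real ((norm (fourier_integral f \<xi>))\<^sup>2 * gaussian (\<epsilon> *\<^sub>R \<xi>)))"
    unfolding sq .
  from integrable_Re[OF this]
  show int: "integrable lborel (\<lambda>\<xi>. (norm (fourier_integral f \<xi>))\<^sup>2 * gaussian (\<epsilon> *\<^sub>R \<xi>))"
    by simp
  have G': "fourier_integral (\<lambda>\<xi>. fourier_integral f' \<xi> * E \<xi>) x =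
      (LINT w|lborel. cnj (f (x - \<epsilon> *\<^sub>R w)) * of_real (normal_kernel w))" for x
  proof -
    \<comment> \<open>With the character moved onto E, the transform falls on a modulated Gaussian,
      and that is a translated Gaussian.\<close>
    define h where "h \<xi> = exp (- (\<i> * of_real (\<xi> \<bullet> x))) * E \<xi>" for \<xi>
    have h: "integrable lborel h"
      unfolding h_def by (rule integrable_character_mult[OF E])
    have "(LINT \<xi>|lborel. exp (- (\<i> * of_real (\<xi> \<bullet> x))) * (fourier_integral f' \<xi> * E \<xi>)) =
        (LINT \<xi>|lborel. fourier_integral f' \<xi> * h \<xi>)"
      by (intro Bochner_Integration.integral_cong refl) (simp add: h_def)
    also have "\<dots> = (LINT y|lborel. f' y * fourier_integral h y)"
      by (rule fourier_integral_multiplication[OF f' h])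
    also have "\<dots> = (LINT y|lborel. f' y * of_real (inverse \<epsilon> ^ CARD('n) * gaussian (inverse \<epsilon> *\<^sub>R (y + x))))"
      unfolding h_def fourier_integral_modulate unfolding E_def
      by (simp only: fourier_integral_gaussian_scaled[OF e])
    also have "\<dots> = of_real (\<bar>\<epsilon>\<bar> ^ CARD('n)) *
        (LINT w|lborel. f' (- x + \<epsilon> *\<^sub>R w) * of_real (inverse \<epsilon> ^ CARD('n) * gaussian w))"
      using e by (subst lborel_affine_integral[where c=\<epsilon> and t="- x"]) (auto simp: f'_def)
    also have "\<dots> = (LINT w|lborel. f' (- x + \<epsilon> *\<^sub>R w) * of_real (gaussian w))"
      using e by (subst integral_mult_right_zero[symmetric])
        (auto intro!: Bochner_Integration.integral_cong simp: field_simps)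
    finally have "fourier_integral (\<lambda>\<xi>. fourier_integral f' \<xi> * E \<xi>) x =
        of_real ?c * (LINT w|lborel. f' (- x + \<epsilon> *\<^sub>R w) * of_real (gaussian w))"
      unfolding fourier_integral_def[of "\<lambda>\<xi>. fourier_integral f' \<xi> * E \<xi>"] by simp
    also have "\<dots> = (LINT w|lborel. cnj (f (x - \<epsilon> *\<^sub>R w)) * of_real (normal_kernel w))"
      by (subst integral_mult_right_zero[symmetric])
        (auto intro!: Bochner_Integration.integral_cong simp: normal_kernel_def f'_def mult_ac)
    finally show ?thesis .
  qed
  have "complex_of_real (LINT \<xi>|lborel. (norm (fourier_integral f \<xi>))\<^sup>2 * gaussian (\<epsilon> *\<^sub>R \<xi>)) =
      (LINT \<xi>|lborel. fourier_integral f \<xi> * (fourier_integral f' \<xi> * E \<xi>))"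
    unfolding sq[symmetric] by (rule integral_complex_of_real[symmetric])
  also have "\<dots> = (LINT x|lborel. f x * fourier_integral (\<lambda>\<xi>. fourier_integral f' \<xi> * E \<xi>) x)"
    by (rule fourier_integral_multiplication[OF f G])
  finally show "of_real (LINT \<xi>|lborel. (norm (fourier_integral f \<xi>))\<^sup>2 * gaussian (\<epsilon> *\<^sub>R \<xi>)) =
      (LINT x|lborel. f x * (LINT w|lborel. cnj (f (x - \<epsilon> *\<^sub>R w)) * of_real (normal_kernel w)))"
    unfolding G' .
qed

lemma norm_integral_le_nn_integral:
  fixes f :: "'a \<Rightarrow> complex"
  shows "ennreal (norm (LINT x|M. f x)) \<le> (\<integral>\<^sup>+x. ennreal (norm (f x)) \<partial>M)"
proof (cases "integrable M f")
  case True then show ?thesis by (rule integral_norm_bound_ennreal)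
qed (simp add: not_integrable_integral_eq)

text \<open>The product of two values of f is at most half the sum of their squares. By Tonelli and
  translation invariance each of the two squares integrates to the same number for every w, and the
  kernel has total mass 1.\<close>

lemma fourier_integral_gaussian_bound:
  fixes f :: "real ^ 'n \<Rightarrow> complex"
  assumes f: "integrable lborel f" and f2: "f \<in> L2 lborel" and e: "\<epsilon> > 0"
  shows "(\<integral>\<^sup>+\<xi>. ennreal ((norm (fourier_integral f \<xi>))\<^sup>2 * gaussian (\<epsilon> *\<^sub>R \<xi>)) \<partial>lborel) \<le>
    ennreal ((L2.nm lborel f)\<^sup>2)"
proof -
  have [measurable]: "f \<in> borel_measurable borel"
    using borel_measurable_integrable[OF f] by simp
  define A where "A = ennreal ((L2.nm lborel f)\<^sup>2)"
  have A: "(\<integral>\<^sup>+x. ennreal ((norm (f x))\<^sup>2) \<partial>lborel) = A"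
    unfolding A_def by (rule L2_nn_integral[OF f2])
  have A': "(\<integral>\<^sup>+x. ennreal ((norm (f (x - \<epsilon> *\<^sub>R w)))\<^sup>2) \<partial>lborel) = A" for w
    using lborel_affine_nn_integral[of "\<lambda>x. ennreal ((norm (f x))\<^sup>2)" 1 "- \<epsilon> *\<^sub>R w"] A by simp
  let ?I = "\<lambda>x. LINT w|lborel. cnj (f (x - \<epsilon> *\<^sub>R w)) * of_real (normal_kernel w)"
  have "(\<integral>\<^sup>+\<xi>. ennreal ((norm (fourier_integral f \<xi>))\<^sup>2 * gaussian (\<epsilon> *\<^sub>R \<xi>)) \<partial>lborel) =
      ennreal (LINT \<xi>|lborel. (norm (fourier_integral f \<xi>))\<^sup>2 * gaussian (\<epsilon> *\<^sub>R \<xi>))"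
    by (rule nn_integral_eq_integral[OF fourier_integral_gaussian_identity(1)[OF f e]]) simp
  also have "\<dots> \<le> ennreal (norm (complex_of_real
      (LINT \<xi>|lborel. (norm (fourier_integral f \<xi>))\<^sup>2 * gaussian (\<epsilon> *\<^sub>R \<xi>))))"
    by (rule ennreal_leI) simp
  also have "\<dots> \<le> (\<integral>\<^sup>+x. ennreal (norm (f x * ?I x)) \<partial>lborel)"
    unfolding fourier_integral_gaussian_identity(2)[OF f e] by (rule norm_integral_le_nn_integral)
  also have "\<dots> \<le> (\<integral>\<^sup>+x. (\<integral>\<^sup>+w. (ennreal ((norm (f x))\<^sup>2) + ennreal ((norm (f (x - \<epsilon> *\<^sub>R w)))\<^sup>2)) *
      ennreal (normal_kernel w / 2) \<partial>lborel) \<partial>lborel)"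
  proof (rule nn_integral_mono)
    fix x
    have "ennreal (norm (f x * ?I x)) = ennreal (norm (f x)) * ennreal (norm (?I x))"
      by (simp add: norm_mult ennreal_mult)
    also have "\<dots> \<le> ennreal (norm (f x)) * (\<integral>\<^sup>+w. ennreal (norm (cnj (f (x - \<epsilon> *\<^sub>R w)) * of_real (normal_kernel w))) \<partial>lborel)"
      by (intro mult_left_mono norm_integral_le_nn_integral) simp
    also have "\<dots> = (\<integral>\<^sup>+w. ennreal (norm (f x)) * ennreal (norm (cnj (f (x - \<epsilon> *\<^sub>R w)) * of_real (normal_kernel w))) \<partial>lborel)"
      by (rule nn_integral_cmult[symmetric]) measurable
    also have "\<dots> \<le> (\<integral>\<^sup>+w. (ennreal ((norm (f x))\<^sup>2) + ennreal ((norm (f (x - \<epsilon> *\<^sub>R w)))\<^sup>2)) * ennreal (normal_kernel w / 2) \<partial>lborel)"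
    proof (rule nn_integral_mono)
      fix w
      have "norm (f x) * (norm (f (x - \<epsilon> *\<^sub>R w)) * normal_kernel w) \<le>
          ((norm (f x))\<^sup>2 + (norm (f (x - \<epsilon> *\<^sub>R w)))\<^sup>2) * (normal_kernel w / 2)"
        using mult_right_mono[OF sum_squares_bound[of "norm (f x)" "norm (f (x - \<epsilon> *\<^sub>R w))"], of "normal_kernel w / 2"]
        by (simp add: field_simps)
      then show "ennreal (norm (f x)) * ennreal (norm (cnj (f (x - \<epsilon> *\<^sub>R w)) * of_real (normal_kernel w))) \<le>
          (ennreal ((norm (f x))\<^sup>2) + ennreal ((norm (f (x - \<epsilon> *\<^sub>R w)))\<^sup>2)) * ennreal (normal_kernel w / 2)"
        by (simp add: norm_mult ennreal_leI flip: ennreal_mult ennreal_plus)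
    qed
    finally show "ennreal (norm (f x * ?I x)) \<le> (\<integral>\<^sup>+w. (ennreal ((norm (f x))\<^sup>2) + ennreal ((norm (f (x - \<epsilon> *\<^sub>R w)))\<^sup>2)) * ennreal (normal_kernel w / 2) \<partial>lborel)" .
  qed
  also have "\<dots> = (\<integral>\<^sup>+w. (\<integral>\<^sup>+x. (ennreal ((norm (f x))\<^sup>2) + ennreal ((norm (f (x - \<epsilon> *\<^sub>R w)))\<^sup>2)) *
      ennreal (normal_kernel w / 2) \<partial>lborel) \<partial>lborel)"
    by (rule lborel_pair.Fubini'[symmetric]) measurable
  also have "\<dots> = (\<integral>\<^sup>+(w::real^'n). (A + A) * ennreal (normal_kernel w / 2) \<partial>lborel)"
    by (intro nn_integral_cong) (simp add: nn_integral_multc nn_integral_add A A')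
  also have "\<dots> = (A + A) * (\<integral>\<^sup>+(w::real^'n). ennreal (normal_kernel w / 2) \<partial>lborel)"
    by (rule nn_integral_cmult) measurable
  also have "(\<integral>\<^sup>+(w::real^'n). ennreal (normal_kernel w / 2) \<partial>lborel) = ennreal (1/2)"
  proof -
    have "ennreal (normal_kernel w / 2) = ennreal (1/2) * ennreal (normal_kernel w)" for w :: "real ^ 'n"
      by (subst ennreal_mult[symmetric]) auto
    then show ?thesis
      by (simp only: nn_integral_cmult borel_measurable_ennreal_normal_kernel nn_integral_normal_kernel mult_1_right)
  qed
  also have "(A + A) * ennreal (1/2) = A"
  proof -
    have "A + A = ennreal ((L2.nm lborel f)\<^sup>2 + (L2.nm lborel f)\<^sup>2)"
      unfolding A_def by (rule ennreal_plus[symmetric]) auto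
    then have "(A + A) * ennreal (1/2) = ennreal (((L2.nm lborel f)\<^sup>2 + (L2.nm lborel f)\<^sup>2) * (1/2))"
      by (simp only:) (rule ennreal_mult[symmetric], auto)
    then show ?thesis unfolding A_def by simp
  qed
  finally show ?thesis unfolding A_def .
qed

lemma gaussian_scaled_tendsto: "(\<lambda>n. gaussian (inverse (real (Suc n)) *\<^sub>R x)) \<longlonglongrightarrow> 1"
proof -
  have "(\<lambda>n. exp (- (inverse (real (Suc n)) * norm x)\<^sup>2 / 2)) \<longlonglongrightarrow> exp (- (0 * norm x)\<^sup>2 / 2)"
    by (intro tendsto_intros LIMSEQ_inverse_real_of_nat) simp
  then show ?thesis by (simp add: gaussian_def)
qed

text \<open>Removing the Gaussian factor by Fatou's lemma gives only one inequality of Plancherel's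
  theorem. It is also what allows the reverse inequality to be extended by density.\<close>

lemma fourier_integral_contraction:
  fixes f :: "real ^ 'n \<Rightarrow> complex"
  assumes f: "integrable lborel f" and f2: "f \<in> L2 lborel"
  shows "fourier_integral f \<in> L2 lborel" "L2.nm lborel (fourier_integral f) \<le> L2.nm lborel f"
proof -
  have [measurable]: "f \<in> borel_measurable borel"
    using borel_measurable_integrable[OF f] by simp
  have "(\<integral>\<^sup>+\<xi>. ennreal ((norm (fourier_integral f \<xi>))\<^sup>2) \<partial>lborel) \<le> ennreal ((L2.nm lborel f)\<^sup>2)"
  proof (rule nn_integral_le_of_tendsto)
    have "(\<lambda>n. ennreal ((norm (fourier_integral f \<xi>))\<^sup>2 * gaussian (inverse (real (Suc n)) *\<^sub>R \<xi>)))
        \<longlonglongrightarrow> ennreal ((norm (fourier_integral f \<xi>))\<^sup>2 * 1)" for \<xi>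
      by (intro tendsto_intros gaussian_scaled_tendsto)
    then show "AE \<xi> in lborel. (\<lambda>n. ennreal ((norm (fourier_integral f \<xi>))\<^sup>2 * gaussian (inverse (real (Suc n)) *\<^sub>R \<xi>)))
        \<longlonglongrightarrow> ennreal ((norm (fourier_integral f \<xi>))\<^sup>2)" by simp
    have "(\<integral>\<^sup>+\<xi>. ennreal ((norm (fourier_integral f \<xi>))\<^sup>2 * gaussian (inverse (real (Suc n)) *\<^sub>R \<xi>)) \<partial>lborel)
        \<le> ennreal ((L2.nm lborel f)\<^sup>2)" for n
      by (rule fourier_integral_gaussian_bound[OF f f2]) simp
    then show "\<forall>\<^sub>F n in sequentially. (\<integral>\<^sup>+\<xi>. ennreal ((norm (fourier_integral f \<xi>))\<^sup>2 * gaussian (inverse (real (Suc n)) *\<^sub>R \<xi>)) \<partial>lborel)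
        \<le> ennreal ((L2.nm lborel f)\<^sup>2)" by simp
  qed measurable
  from L2_of_nn_integral[OF _ this]
  show "fourier_integral f \<in> L2 lborel" "L2.nm lborel (fourier_integral f) \<le> L2.nm lborel f"
    by auto
qed

section \<open>The reverse inequality: continuous functions of bounded support, then density\<close>

lemma compact_support_bounded:
  fixes g :: "'a::euclidean_space \<Rightarrow> complex"
  assumes g: "continuous_on UNIV g" and R: "\<And>x. norm x > R \<Longrightarrow> g x = 0"
  obtains M where "M \<ge> 0" "\<And>x. norm (g x) \<le> M"
proof -
  have "bounded (g ` cball 0 R)"
    by (intro compact_imp_bounded compact_continuous_image continuous_on_subset[OF g]) auto
  then obtain M where "\<forall>y\<in>g ` cball 0 R. norm y \<le> M"
    unfolding bounded_iff by blast
  then have M: "\<And>x. norm x \<le> R \<Longrightarrow> norm (g x) \<le> M" by auto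
  have "norm (g x) \<le> \<bar>M\<bar>" for x
    using M[of x] R[of x] by (cases "norm x \<le> R") auto
  then show thesis using that[of "\<bar>M\<bar>"] by auto
qed

lemma emeasure_cball_less_top: "emeasure lborel (cball (0::'a::euclidean_space) R) < top"
  using emeasure_lborel_cball_finite[of "0::'a" R] unfolding infinity_ennreal_def .

lemma integrable_indicator_cball: "integrable lborel (\<lambda>x::'a::euclidean_space. indicator (cball 0 R) x :: real)"
  using emeasure_cball_less_top[of R, where ?'a='a] by (simp add: integrable_indicator_iff)

lemma bounded_support_L2:
  fixes g :: "'a::euclidean_space \<Rightarrow> complex"
  assumes g: "g \<in> borel_measurable borel" and R: "\<And>x. norm x > R \<Longrightarrow> g x = 0" and M: "\<And>x. norm (g x) \<le> M"
  shows "g \<in> L2 lborel"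
proof (rule L2_dominated)
  have [measurable]: "cball 0 R \<in> sets (borel :: 'a measure)" by simp
  have m: "(\<lambda>x::'a. complex_of_real (M * indicator (cball 0 R) x)) \<in> borel_measurable lborel"
    by measurable
  have "(norm (complex_of_real (M * indicator (cball 0 R) x)))\<^sup>2 = M\<^sup>2 * indicator (cball 0 R) x" for x :: 'a
    by (simp add: indicator_def)
  then have eq: "(\<lambda>x::'a. (norm (complex_of_real (M * indicator (cball 0 R) x)))\<^sup>2) = (\<lambda>x. M\<^sup>2 * indicator (cball 0 R) x)"
    by (intro ext)
  have "integrable lborel (\<lambda>x::'a. (norm (complex_of_real (M * indicator (cball 0 R) x)))\<^sup>2)"
    unfolding eq by (intro integrable_mult_right integrable_indicator_cball)
  then show "(\<lambda>x::'a. complex_of_real (M * indicator (cball 0 R) x)) \<in> L2 lborel"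
    unfolding L2_def mem_Collect_eq using m by (intro conjI)
  have "norm (g x) \<le> norm (complex_of_real (M * indicator (cball 0 R) x))" for x
    using R[of x] M[of x] norm_ge_zero[of "g x"] by (cases "norm x \<le> R") (auto simp: indicator_def)
  then show "AE x in lborel. norm (g x) \<le> norm (complex_of_real (M * indicator (cball 0 R) x))"
    by simp
qed (use g in simp)

lemma bounded_support_integrable:
  fixes g :: "'a::euclidean_space \<Rightarrow> complex"
  assumes g: "g \<in> L2 lborel" and R: "\<And>x. norm x > R \<Longrightarrow> g x = 0"
  shows "integrable lborel g"
  by (rule L2_indicator_integral(1)[OF g, of "cball 0 R"])
     (use R in \<open>auto simp: emeasure_cball_less_top\<close>)

text \<open>Continuity and boundedness of g let the Gaussian averages \<open>I n\<close> converge
  pointwise to the conjugate of g. So the right side of the regularized identity tends to the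
  squared norm of g, while its left side never exceeds the squared norm of the transform.\<close>

lemma fourier_integral_isometry_compact_support:
  fixes g :: "real ^ 'n \<Rightarrow> complex"
  assumes g: "continuous_on UNIV g" and R: "\<And>x. norm x > R \<Longrightarrow> g x = 0"
  shows "L2.nm lborel (fourier_integral g) = L2.nm lborel g"
proof -
  have [measurable]: "g \<in> borel_measurable borel"
    using g by (rule borel_measurable_continuous_onI)
  obtain M where M: "M \<ge> 0" "\<And>x. norm (g x) \<le> M"
    using compact_support_bounded[of g R] g R by blast
  have g2: "g \<in> L2 lborel" by (rule bounded_support_L2[OF _ R M(2)]) measurable
  have g1: "integrable lborel g" by (rule bounded_support_integrable[OF g2 R])
  note contr = fourier_integral_contraction[OF g1 g2]
  define \<epsilon> where "\<epsilon> n = inverse (real (Suc n))" for n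
  have e0: "\<epsilon> n > 0" for n by (simp add: \<epsilon>_def)
  have elim: "\<epsilon> \<longlonglongrightarrow> 0" unfolding \<epsilon>_def by (rule LIMSEQ_inverse_real_of_nat)
  define I where "I n x = (LINT w|lborel. cnj (g (x - \<epsilon> n *\<^sub>R w)) * of_real (normal_kernel w))" for n x
  have I_meas [measurable]: "I n \<in> borel_measurable borel" for n
    unfolding I_def[abs_def] by measurable
  have Mk: "norm (cnj (g (x - \<epsilon> n *\<^sub>R w)) * of_real (normal_kernel w)) \<le> M * normal_kernel w" for x n w
    using M(2) by (auto simp: norm_mult intro!: mult_right_mono)
  have Mint: "integrable lborel (\<lambda>w::real^'n. M * normal_kernel w)"
    using integrable_normal_kernel by auto
  have I_bound: "norm (I n x) \<le> M" for n x
  proof -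
    have "norm (I n x) \<le> (LINT w|lborel. norm (cnj (g (x - \<epsilon> n *\<^sub>R w)) * of_real (normal_kernel w)))"
      unfolding I_def by (rule integral_norm_bound)
    also have "\<dots> \<le> (LINT w|lborel. M * normal_kernel (w :: real ^ 'n))"
      by (rule Bochner_Integration.integral_mono_AE')
        (use Mk Mint M(1) in auto)
    finally show ?thesis by (simp add: integral_normal_kernel)
  qed
  have I_lim: "(\<lambda>n. I n x) \<longlonglongrightarrow> cnj (g x)" for x
  proof -
    have "(\<lambda>n. I n x) \<longlonglongrightarrow> (LINT w|lborel. cnj (g x) * of_real (normal_kernel (w :: real ^ 'n)))"
      unfolding I_def
    proof (rule integral_dominated_convergence[OF _ _ Mint])
      have "(\<lambda>n. cnj (g (x - \<epsilon> n *\<^sub>R w)) * of_real (normal_kernel w)) \<longlonglongrightarrow> cnj (g (x - 0 *\<^sub>R w)) * of_real (normal_kernel w)" for w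
        by (intro tendsto_intros continuous_on_tendsto_compose[OF g] elim) auto
      then show "AE w in lborel. (\<lambda>n. cnj (g (x - \<epsilon> n *\<^sub>R w)) * of_real (normal_kernel w)) \<longlonglongrightarrow> cnj (g x) * of_real (normal_kernel w)"
        by simp
    qed (use Mk in auto)
    also have "(LINT w|lborel. cnj (g x) * of_real (normal_kernel (w :: real ^ 'n))) = cnj (g x)"
      by (simp add: integral_normal_kernel)
    finally show ?thesis .
  qed
  have lim: "(\<lambda>n. LINT x|lborel. g x * I n x) \<longlonglongrightarrow> (LINT x|lborel. g x * cnj (g x))"
  proof (rule integral_dominated_convergence[where w="\<lambda>x. norm (g x) * M"])
    show "integrable lborel (\<lambda>x. norm (g x) * M)" using g1 by auto
    show "AE x in lborel. (\<lambda>n. g x * I n x) \<longlonglongrightarrow> g x * cnj (g x)"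
      by (intro AE_I2 tendsto_intros I_lim)
    show "AE x in lborel. norm (g x * I n x) \<le> norm (g x) * M" for n
      using I_bound by (auto simp: norm_mult intro!: mult_left_mono)
  qed measurable
  have "(LINT x|lborel. g x * cnj (g x)) = of_real ((L2.nm lborel g)\<^sup>2)"
    unfolding L2_nm_sq complex_norm_square[symmetric] by (rule integral_complex_of_real)
  then have "(\<lambda>n. Re (LINT x|lborel. g x * I n x)) \<longlonglongrightarrow> (L2.nm lborel g)\<^sup>2"
    using tendsto_Re[OF lim] by simp
  moreover have "Re (LINT x|lborel. g x * I n x) \<le> (L2.nm lborel (fourier_integral g))\<^sup>2" for n
  proof -
    have "Re (LINT x|lborel. g x * I n x) = (LINT \<xi>|lborel. (norm (fourier_integral g \<xi>))\<^sup>2 * gaussian (\<epsilon> n *\<^sub>R \<xi>))"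
      unfolding I_def fourier_integral_gaussian_identity(2)[OF g1 e0, symmetric] by simp
    also have "\<dots> \<le> (LINT \<xi>|lborel. (norm (fourier_integral g \<xi>))\<^sup>2)"
      by (intro integral_mono fourier_integral_gaussian_identity(1)[OF g1 e0] L2_integrable contr)
         (simp add: mult_left_le gaussian_le_1)
    finally show ?thesis by (simp add: L2_nm_sq)
  qed
  ultimately have "(L2.nm lborel g)\<^sup>2 \<le> (L2.nm lborel (fourier_integral g))\<^sup>2"
    by (intro tendsto_upperbound) auto
  then have "L2.nm lborel g \<le> L2.nm lborel (fourier_integral g)"
    by (rule power2_le_imp_le) simp
  then show ?thesis using contr by simp
qed

lemma L2_dominated_convergence:
  assumes X: "\<And>n. X n \<in> borel_measurable M" and f: "f \<in> borel_measurable M" and w: "w \<in> L2 M"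
    and bound: "\<And>n x. norm (X n x) \<le> norm (w x)"
    and lim: "AE x in M. ((\<lambda>n. X n x) \<longlonglongrightarrow> f x)"
  shows "(\<lambda>n. L2.nm M (\<lambda>x. X n x - f x)) \<longlonglongrightarrow> 0"
proof -
  note [measurable] = X f
  have fw: "AE x in M. norm (f x) \<le> norm (w x)"
    using lim by eventually_elim (rule tendsto_upperbound[OF tendsto_norm], assumption, auto simp: bound)
  have "(\<lambda>n. LINT x|M. (norm (X n x - f x))\<^sup>2) \<longlonglongrightarrow> (LINT x|M. 0)"
  proof (rule integral_dominated_convergence[where w="\<lambda>x. 4 * (norm (w x))\<^sup>2"])
    show "integrable M (\<lambda>x. 4 * (norm (w x))\<^sup>2)"
      by (intro integrable_mult_right L2_integrable w)
    show "AE x in M. (\<lambda>n. (norm (X n x - f x))\<^sup>2) \<longlonglongrightarrow> 0"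
      using lim
    proof eventually_elim
      fix x assume "(\<lambda>n. X n x) \<longlonglongrightarrow> f x"
      then have "(\<lambda>n. (norm (X n x - f x))\<^sup>2) \<longlonglongrightarrow> (norm (f x - f x))\<^sup>2"
        by (intro tendsto_intros)
      then show "(\<lambda>n. (norm (X n x - f x))\<^sup>2) \<longlonglongrightarrow> 0" by simp
    qed
    show "AE x in M. norm ((norm (X n x - f x))\<^sup>2) \<le> 4 * (norm (w x))\<^sup>2" for n
      using fw
    proof eventually_elim
      fix x assume "norm (f x) \<le> norm (w x)"
      then have "norm (X n x - f x) \<le> 2 * norm (w x)"
        using norm_triangle_ineq4[of "X n x" "f x"] bound[of n x] by linarith
      then have "(norm (X n x - f x))\<^sup>2 \<le> (2 * norm (w x))\<^sup>2" by (rule power_mono) simp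
      then show "norm ((norm (X n x - f x))\<^sup>2) \<le> 4 * (norm (w x))\<^sup>2" by (simp add: power_mult_distrib)
    qed
  qed measurable
  then show ?thesis
    unfolding L2_nm_eq using tendsto_real_sqrt by fastforce
qed

lemma norm_of_nat_add_1: "norm (complex_of_nat n + 1) = real n + 1"
  using norm_of_nat[of "Suc n", where 'a=complex] by (simp add: add.commute)

lemma L2_approx_bounded_support:
  fixes f :: "'a::euclidean_space \<Rightarrow> complex"
  assumes f: "f \<in> L2 lborel" and e: "e > 0"
  obtains g R where "continuous_on UNIV g" "\<And>x. norm x > R \<Longrightarrow> g x = 0"
    "L2.nm lborel (\<lambda>x. g x - f x) < e"
proof -
  note [measurable] = L2_measurable[OF f]
  define X where "X n x = (if norm x \<le> real n \<and> norm (f x) \<le> real n then f x else 0)" for n x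
  have X [measurable]: "X n \<in> borel_measurable lborel" for n
    unfolding X_def[abs_def] by measurable
  have "(\<lambda>n. L2.nm lborel (\<lambda>x. X n x - f x)) \<longlonglongrightarrow> 0"
  proof (rule L2_dominated_convergence[OF X _ f])
    have "(\<lambda>n. X n x) \<longlonglongrightarrow> f x" for x
    proof (rule tendsto_eventually)
      obtain N where "max (norm x) (norm (f x)) \<le> real N" using real_arch_simple by blast
      then show "\<forall>\<^sub>F n in sequentially. X n x = f x"
        by (auto simp: eventually_sequentially X_def intro!: exI[of _ N])
    qed
    then show "AE x in lborel. (\<lambda>n. X n x) \<longlonglongrightarrow> f x" by simp
  qed (auto simp: X_def)
  then obtain n where n: "L2.nm lborel (\<lambda>x. X n x - f x) < e / 2"
    using LIMSEQ_D[of _ 0 "e/2"] e by (auto dest!: LIMSEQ_D[of _ 0 "e/2"])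
  have Xn: "X n \<in> L2 lborel" by (rule L2_dominated[OF f X]) (auto simp: X_def)
  \<comment> \<open>This supplies continuous functions converging to \<open>X n\<close> off a
    negligible set, but without domination or bounded support; both are imposed afterwards.\<close>
  have "X n measurable_on UNIV"
    by (rule lebesgue_measurable_imp_measurable_on) (auto intro: measurable_completion X)
  then obtain N G where N: "negligible N" and G: "\<And>k. continuous_on UNIV (G k)"
    and lim: "\<And>x. x \<notin> N \<Longrightarrow> (\<lambda>k. G k x) \<longlonglongrightarrow> X n x"
    unfolding measurable_on_def by auto
  \<comment> \<open>Clipping the values at \<open>n\<close> and multiplying by a cutoff keeps the limit, as \<open>X n\<close> is bounded by \<open>n\<close>
    and vanishes outside the ball of radius \<open>n\<close>.\<close>
  define \<phi> where "\<phi> x = max 0 (min 1 (real n + 1 - norm x))" for x :: 'a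
  define H where "H k x = of_real (\<phi> x * ((real n + 1) / max (real n + 1) (norm (G k x)))) * G k x" for k x
  have Hcont: "continuous_on UNIV (H k)" for k
    unfolding H_def \<phi>_def by (intro continuous_intros G) (auto simp: max_def)
  have H0: "H k x = 0" if "norm x > real n + 1" for k x
    using that by (simp add: H_def \<phi>_def)
  have \<phi>: "0 \<le> \<phi> x" "\<phi> x \<le> 1" for x by (auto simp: \<phi>_def)
  have clip: "(real n + 1) / max (real n + 1) r * r \<le> real n + 1" if "r \<ge> 0" for r
  proof -
    have "(real n + 1) * r \<le> (real n + 1) * max (real n + 1) r" by (intro mult_left_mono) auto
    moreover have "max (real n + 1) r > 0" by auto
    ultimately show ?thesis by (simp add: divide_le_eq)
  qed
  have Hbound: "norm (H k x) \<le> real n + 1" for k x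
  proof -
    have "norm (H k x) = \<phi> x * ((real n + 1) / max (real n + 1) (norm (G k x)) * norm (G k x))"
      using \<phi>[of x] unfolding H_def norm_mult norm_of_real by (simp add: abs_mult)
    also have "\<dots> \<le> 1 * (real n + 1)"
      using \<phi>[of x] clip[of "norm (G k x)"] by (intro mult_mono) auto
    finally show ?thesis by simp
  qed
  have Hlim: "(\<lambda>k. H k x) \<longlonglongrightarrow> X n x" if "x \<notin> N" for x
  proof -
    have m: "max (real n + 1) (norm (X n x)) = real n + 1"
      by (auto simp: X_def)
    have "(\<lambda>k. H k x) \<longlonglongrightarrow> of_real (\<phi> x * ((real n + 1) / max (real n + 1) (norm (X n x)))) * X n x"
      unfolding H_def by (intro tendsto_intros lim[OF that]) (auto simp: max_def)
    also have "of_real (\<phi> x * ((real n + 1) / max (real n + 1) (norm (X n x)))) * X n x = X n x"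
      unfolding m by (auto simp: X_def \<phi>_def)
    finally show ?thesis .
  qed
  have Hmeas: "H k \<in> borel_measurable borel" for k
    using Hcont by (rule borel_measurable_continuous_onI)
  have HL2: "H k \<in> L2 lborel" for k
    by (rule bounded_support_L2[OF Hmeas H0 Hbound])
  let ?w = "\<lambda>x::'a. complex_of_real ((real n + 1) * indicator (cball 0 (real n + 1)) x)"
  have "(\<lambda>k. L2.nm lborel (\<lambda>x. H k x - X n x)) \<longlonglongrightarrow> 0"
  proof (rule L2_dominated_convergence[where w="?w"])
    show "?w \<in> L2 lborel"
    proof (rule bounded_support_L2[where R="real n + 1" and M="real n + 1"])
      have [measurable]: "cball 0 (real n + 1) \<in> sets (borel :: 'a measure)" by simp
      show "?w \<in> borel_measurable borel" by measurable
    qed (auto simp: indicator_def norm_of_nat_add_1)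
    show "norm (H k x) \<le> norm (?w x)" for k x
      using Hbound[of k x] H0[of x k] by (cases "norm x \<le> real n + 1") (auto simp: indicator_def norm_of_nat_add_1)
    have "AE x in lebesgue. x \<notin> N"
      using N by (simp add: negligible_iff_null_sets AE_not_in)
    then have "AE x in lebesgue. (\<lambda>k. H k x) \<longlonglongrightarrow> X n x"
      by eventually_elim (rule Hlim)
    then show "AE x in lborel. (\<lambda>k. H k x) \<longlonglongrightarrow> X n x"
      by (simp add: AE_completion_iff)
  qed (use Hmeas X in auto)
  then obtain k where k: "L2.nm lborel (\<lambda>x. H k x - X n x) < e / 2"
    using e by (auto dest!: LIMSEQ_D[of _ 0 "e/2"])
  have "L2.nm lborel (\<lambda>x. H k x - f x) < e"
    using L2.nm_triangle_diff[OF HL2 Xn f, of k] k n by linarith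
  then show thesis using that[OF Hcont H0] by blast
qed

text \<open>By the contraction estimate both norms depend continuously on f, so the isometry extends
  from a dense class.\<close>

theorem plancherel_integrable:
  fixes f :: "real ^ 'n \<Rightarrow> complex"
  assumes f: "integrable lborel f" and f2: "f \<in> L2 lborel"
  shows "L2.nm lborel (fourier_integral f) = L2.nm lborel f"
proof -
  have "L2.nm lborel f \<le> L2.nm lborel (fourier_integral f) + e" if "e > 0" for e
  proof -
    obtain g R where g: "continuous_on UNIV g" "\<And>x. norm x > R \<Longrightarrow> g x = 0"
      and close: "L2.nm lborel (\<lambda>x. g x - f x) < e / 2"
      by (rule L2_approx_bounded_support[OF f2, of "e/2"]) (use \<open>e > 0\<close> in simp, rule that)
    obtain M where M: "M \<ge> 0" "\<And>x. norm (g x) \<le> M"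
      using compact_support_bounded[of g R] g by blast
    have g2: "g \<in> L2 lborel"
      by (rule bounded_support_L2[OF _ g(2) M(2)]) (rule borel_measurable_continuous_onI[OF g(1)])
    have g1: "integrable lborel g" by (rule bounded_support_integrable[OF g2 g(2)])
    have d: "L2.nm lborel (\<lambda>\<xi>. fourier_integral g \<xi> - fourier_integral f \<xi>) \<le> L2.nm lborel (\<lambda>x. g x - f x)"
    proof -
      have eq: "(\<lambda>\<xi>. fourier_integral g \<xi> - fourier_integral f \<xi>) = fourier_integral (\<lambda>x. g x - f x)"
        by (intro ext) (simp add: fourier_integral_diff[OF g1 f])
      show ?thesis
        unfolding eq using f g1 f2 g2 by (intro fourier_integral_contraction(2) L2.diff) auto
    qed
    have "L2.nm lborel f \<le> L2.nm lborel g + L2.nm lborel (\<lambda>x. g x - f x)"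
      using L2.nm_reverse_triangle[OF g2 f2] by linarith
    also have "L2.nm lborel g = L2.nm lborel (fourier_integral g)"
      by (rule fourier_integral_isometry_compact_support[OF g, symmetric])
    also have "\<dots> \<le> L2.nm lborel (fourier_integral f) + L2.nm lborel (\<lambda>x. g x - f x)"
      using L2.nm_reverse_triangle[OF fourier_integral_contraction(1)[OF g1 g2] fourier_integral_contraction(1)[OF f f2]] d
      by linarith
    finally show ?thesis using close by linarith
  qed
  then have "L2.nm lborel f \<le> L2.nm lborel (fourier_integral f)" by (rule field_le_epsilon)
  then show ?thesis using fourier_integral_contraction(2)[OF f f2] by linarith
qed

section \<open>The Fourier transform on \<open>L\<^sup>2\<close> and frequency localization\<close>

lemma square_integrable_iff: "square_integrable f \<longleftrightarrow> f \<in> L2 lborel"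
  by (simp add: square_integrable_def L2_def)

lemma L2_nm_zero [simp]: "L2.nm M (\<lambda>x. 0) = 0"
  and L2_nm_minus: "L2.nm M (\<lambda>x. - f x) = L2.nm M f"
  by (simp_all add: L2_nm_eq)

lemma L2_translate:
  assumes f: "f \<in> L2 lborel"
  shows "(\<lambda>x. f (x - y)) \<in> L2 lborel" "L2.nm lborel (\<lambda>x. f (x - y)) = L2.nm lborel f"
proof -
  have [measurable]: "f \<in> borel_measurable borel" using L2_measurable[OF f] by simp
  have "(\<integral>\<^sup>+x. ennreal ((norm (f (x - y)))\<^sup>2) \<partial>lborel) = (\<integral>\<^sup>+x. ennreal ((norm (f x))\<^sup>2) \<partial>lborel)"
    using lborel_affine_nn_integral[of "\<lambda>x. ennreal ((norm (f x))\<^sup>2)" 1 "- y"] by simp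
  then have eq: "(\<integral>\<^sup>+x. ennreal ((norm (f (x - y)))\<^sup>2) \<partial>lborel) = ennreal ((L2.nm lborel f)\<^sup>2)"
    by (simp add: L2_nn_integral[OF f])
  show fy: "(\<lambda>x. f (x - y)) \<in> L2 lborel"
    by (rule L2_of_nn_integral(1)[of _ _ "L2.nm lborel f"]) (auto simp: eq)
  have "(L2.nm lborel (\<lambda>x. f (x - y)))\<^sup>2 = (L2.nm lborel f)\<^sup>2"
    using eq unfolding L2_nn_integral[OF fy] by simp
  then show "L2.nm lborel (\<lambda>x. f (x - y)) = L2.nm lborel f"
    by (simp add: power2_eq_iff_nonneg)
qed

lemma L2_reflect:
  assumes f: "f \<in> L2 lborel"
  shows "(\<lambda>x. f (- x)) \<in> L2 lborel" "L2.nm lborel (\<lambda>x. f (- x)) = L2.nm lborel f"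
proof -
  have [measurable]: "f \<in> borel_measurable borel" using L2_measurable[OF f] by simp
  have "(\<integral>\<^sup>+x. ennreal ((norm (f (- x)))\<^sup>2) \<partial>lborel) = (\<integral>\<^sup>+x. ennreal ((norm (f x))\<^sup>2) \<partial>lborel)"
    using lborel_affine_nn_integral[of "\<lambda>x. ennreal ((norm (f x))\<^sup>2)" "-1" 0] by simp
  then have eq: "(\<integral>\<^sup>+x. ennreal ((norm (f (- x)))\<^sup>2) \<partial>lborel) = ennreal ((L2.nm lborel f)\<^sup>2)"
    by (simp add: L2_nn_integral[OF f])
  show fy: "(\<lambda>x. f (- x)) \<in> L2 lborel"
    by (rule L2_of_nn_integral(1)[of _ _ "L2.nm lborel f"]) (auto simp: eq)
  have "(L2.nm lborel (\<lambda>x. f (- x)))\<^sup>2 = (L2.nm lborel f)\<^sup>2"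
    using eq unfolding L2_nn_integral[OF fy] by simp
  then show "L2.nm lborel (\<lambda>x. f (- x)) = L2.nm lborel f"
    by (simp add: power2_eq_iff_nonneg)
qed

lemma L2_restrict:
  assumes f: "f \<in> L2 M" and E: "E \<in> sets M"
  shows "(\<lambda>x. indicator E x *\<^sub>R f x) \<in> L2 M" "L2.nm M (\<lambda>x. indicator E x *\<^sub>R f x) \<le> L2.nm M f"
proof -
  have m: "(\<lambda>x. indicator E x *\<^sub>R f x) \<in> borel_measurable M"
    using L2_measurable[OF f] E by measurable
  have b: "AE x in M. norm (indicator E x *\<^sub>R f x) \<le> norm (f x)"
    by (simp add: indicator_def)
  show "(\<lambda>x. indicator E x *\<^sub>R f x) \<in> L2 M" by (rule L2_dominated[OF f m b])
  show "L2.nm M (\<lambda>x. indicator E x *\<^sub>R f x) \<le> L2.nm M f" by (rule L2_nm_mono[OF f m b])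
qed

lemma L2_restrict_integrable:
  fixes f :: "'a::euclidean_space \<Rightarrow> complex"
  assumes f: "f \<in> L2 lborel" and E: "E \<in> sets borel" "E \<subseteq> cball 0 R"
  shows "integrable lborel (\<lambda>x. indicator E x *\<^sub>R f x)"
  by (rule bounded_support_integrable[OF L2_restrict(1)[OF f], where R=R]) (use E in \<open>auto simp: indicator_def\<close>)

section \<open>Existence of the L^2 Fourier transform\<close>

lemma L2_truncation_tendsto:
  fixes f :: "'a::euclidean_space \<Rightarrow> complex"
  assumes f: "f \<in> L2 lborel"
  shows "((\<lambda>R. L2.nm lborel (\<lambda>x. indicator (cball 0 R) x *\<^sub>R f x - f x)) \<longlongrightarrow> 0) at_top"
proof (rule tendsto_at_topI_sequentially)
  fix X :: "nat \<Rightarrow> real" assume X: "filterlim X at_top sequentially"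
  show "(\<lambda>n. L2.nm lborel (\<lambda>x. indicator (cball 0 (X n)) x *\<^sub>R f x - f x)) \<longlonglongrightarrow> 0"
  proof (rule L2_dominated_convergence[OF _ L2_measurable[OF f] f])
    show "(\<lambda>x. indicator (cball 0 (X n)) x *\<^sub>R f x) \<in> borel_measurable lborel" for n
      by (rule L2_measurable[OF L2_restrict(1)[OF f]]) simp
    have "(\<lambda>n. indicator (cball 0 (X n)) x *\<^sub>R f x) \<longlonglongrightarrow> f x" for x
    proof (rule tendsto_eventually)
      have "\<forall>\<^sub>F n in sequentially. norm x \<le> X n" using X by (simp add: filterlim_at_top)
      then show "\<forall>\<^sub>F n in sequentially. indicator (cball 0 (X n)) x *\<^sub>R f x = f x"
        by eventually_elim simp
    qed
    then show "AE x in lborel. (\<lambda>n. indicator (cball 0 (X n)) x *\<^sub>R f x) \<longlonglongrightarrow> f x" by simp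
  qed (simp add: indicator_def)
qed

lemma is_fourier_transform_iff:
  fixes f :: "real ^ 'n \<Rightarrow> complex"
  assumes f: "f \<in> L2 lborel"
  shows "is_fourier_transform f g \<longleftrightarrow> g \<in> L2 lborel \<and>
    ((\<lambda>R. L2.nm lborel (\<lambda>\<xi>. fourier_integral (\<lambda>x. indicator (cball 0 R) x *\<^sub>R f x) \<xi> - g \<xi>)) \<longlongrightarrow> 0) at_top"
    (is "_ \<longleftrightarrow> _ \<and> ((\<lambda>R. L2.nm lborel (?d R)) \<longlongrightarrow> 0) at_top")
proof -
  have "((\<lambda>R. \<integral>\<^sup>+\<xi>. ennreal ((norm (?d R \<xi>))\<^sup>2) \<partial>lborel) \<longlongrightarrow> 0) at_top \<longleftrightarrow>
      ((\<lambda>R. L2.nm lborel (?d R)) \<longlongrightarrow> 0) at_top" if g: "g \<in> L2 lborel"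
  proof -
    have "?d R \<in> L2 lborel" for R
      by (intro L2.diff g fourier_integral_contraction(1) L2_restrict_integrable[where R=R] L2_restrict f) auto
    then have "((\<lambda>R. \<integral>\<^sup>+\<xi>. ennreal ((norm (?d R \<xi>))\<^sup>2) \<partial>lborel) \<longlongrightarrow> 0) at_top \<longleftrightarrow>
        ((\<lambda>R. ennreal ((L2.nm lborel (?d R))\<^sup>2)) \<longlongrightarrow> ennreal 0) at_top"
      by (simp add: L2_nn_integral)
    also have "\<dots> \<longleftrightarrow> ((\<lambda>R. (L2.nm lborel (?d R))\<^sup>2) \<longlongrightarrow> 0) at_top"
      by (rule tendsto_ennreal_iff) auto
    also have "\<dots> \<longleftrightarrow> ((\<lambda>R. L2.nm lborel (?d R)) \<longlongrightarrow> 0) at_top"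
    proof
      assume "((\<lambda>R. (L2.nm lborel (?d R))\<^sup>2) \<longlongrightarrow> 0) at_top"
      from tendsto_real_sqrt[OF this] show "((\<lambda>R. L2.nm lborel (?d R)) \<longlongrightarrow> 0) at_top" by simp
    next
      assume "((\<lambda>R. L2.nm lborel (?d R)) \<longlongrightarrow> 0) at_top"
      from tendsto_power[OF this, of 2] show "((\<lambda>R. (L2.nm lborel (?d R))\<^sup>2) \<longlongrightarrow> 0) at_top" by simp
    qed
    finally show ?thesis .
  qed
  then show ?thesis
    unfolding is_fourier_transform_def square_integrable_iff by blast
qed

lemma fourier_integral_isometry_diff:
  fixes f g :: "real ^ 'n \<Rightarrow> complex"
  assumes f: "integrable lborel f" "f \<in> L2 lborel" and g: "integrable lborel g" "g \<in> L2 lborel"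
  shows "L2.nm lborel (\<lambda>\<xi>. fourier_integral f \<xi> - fourier_integral g \<xi>) = L2.nm lborel (\<lambda>x. f x - g x)"
proof -
  have eq: "(\<lambda>\<xi>. fourier_integral f \<xi> - fourier_integral g \<xi>) = fourier_integral (\<lambda>x. f x - g x)"
    by (intro ext) (simp add: fourier_integral_diff f g)
  show ?thesis
    unfolding eq using f g by (intro plancherel_integrable L2.diff) auto
qed

text \<open>Transforms of truncations are Cauchy by the isometry, so the choice in
  \<open>fourier\<close> has something to choose. The second claim admits every integrable h in L^2,
  not just truncations; this later permits whichever approximating sequence suits a given
  rule.\<close>

lemma
  fixes f :: "real ^ 'n \<Rightarrow> complex"
  assumes f: "f \<in> L2 lborel"
  shows fourier_L2: "fourier f \<in> L2 lborel"
    and fourier_isometry_diff: "integrable lborel h \<Longrightarrow> h \<in> L2 lborel \<Longrightarrow>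
      L2.nm lborel (\<lambda>\<xi>. fourier_integral h \<xi> - fourier f \<xi>) = L2.nm lborel (\<lambda>x. h x - f x)"
proof -
  define t where "t R = (\<lambda>x. indicator (cball 0 R) x *\<^sub>R f x)" for R
  have t2: "t R \<in> L2 lborel" for R unfolding t_def by (intro L2_restrict f) auto
  have t1: "integrable lborel (t R)" for R
    unfolding t_def by (rule L2_restrict_integrable[OF f, where R=R]) auto
  have tlim: "((\<lambda>R. L2.nm lborel (\<lambda>x. t R x - f x)) \<longlongrightarrow> 0) at_top"
    unfolding t_def by (rule L2_truncation_tendsto[OF f])
  have tseq: "(\<lambda>n. L2.nm lborel (\<lambda>x. t (real n) x - f x)) \<longlonglongrightarrow> 0"
    by (rule filterlim_compose[OF tlim filterlim_real_sequentially])
  have F2: "fourier_integral (t R) \<in> L2 lborel" for R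
    by (rule fourier_integral_contraction(1)[OF t1 t2])
  have iso: "L2.nm lborel (\<lambda>\<xi>. fourier_integral h \<xi> - g \<xi>) = L2.nm lborel (\<lambda>x. h x - f x)"
    if h: "integrable lborel h" "h \<in> L2 lborel" and g: "g \<in> L2 lborel"
      and lim: "(\<lambda>n. L2.nm lborel (\<lambda>\<xi>. fourier_integral (t (real n)) \<xi> - g \<xi>)) \<longlonglongrightarrow> 0" for h g
  proof (rule LIMSEQ_unique)
    have Fh: "fourier_integral h \<in> L2 lborel" by (rule fourier_integral_contraction(1)[OF h])
    show "(\<lambda>n. L2.nm lborel (\<lambda>\<xi>. fourier_integral h \<xi> - fourier_integral (t (real n)) \<xi>)) \<longlonglongrightarrow>
        L2.nm lborel (\<lambda>\<xi>. fourier_integral h \<xi> - g \<xi>)"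
    proof (rule L2.nm_tendsto[OF L2.diff[OF Fh F2] L2.diff[OF Fh g]])
      have "L2.nm lborel (\<lambda>\<xi>. (fourier_integral h \<xi> - fourier_integral (t (real n)) \<xi>) - (fourier_integral h \<xi> - g \<xi>)) =
          L2.nm lborel (\<lambda>\<xi>. fourier_integral (t (real n)) \<xi> - g \<xi>)" for n
        using L2.nm_diff_commute[OF F2 g, of "real n"] by simp
      then show "(\<lambda>n. L2.nm lborel (\<lambda>\<xi>. (fourier_integral h \<xi> - fourier_integral (t (real n)) \<xi>) - (fourier_integral h \<xi> - g \<xi>))) \<longlonglongrightarrow> 0"
        using lim by simp
    qed
    have "(\<lambda>n. L2.nm lborel (\<lambda>x. h x - t (real n) x)) \<longlonglongrightarrow> L2.nm lborel (\<lambda>x. h x - f x)"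
    proof (rule L2.nm_tendsto[OF L2.diff[OF h(2) t2] L2.diff[OF h(2) f]])
      have "L2.nm lborel (\<lambda>x. (h x - t (real n) x) - (h x - f x)) = L2.nm lborel (\<lambda>x. t (real n) x - f x)" for n
        using L2.nm_diff_commute[OF t2 f, of "real n"] by simp
      then show "(\<lambda>n. L2.nm lborel (\<lambda>x. (h x - t (real n) x) - (h x - f x))) \<longlonglongrightarrow> 0"
        using tseq by simp
    qed
    then show "(\<lambda>n. L2.nm lborel (\<lambda>\<xi>. fourier_integral h \<xi> - fourier_integral (t (real n)) \<xi>)) \<longlonglongrightarrow>
        L2.nm lborel (\<lambda>x. h x - f x)"
      by (simp only: fourier_integral_isometry_diff[OF h t1 t2])
  qed
  have "\<exists>g\<in>L2 lborel. (\<lambda>n. L2.nm lborel (\<lambda>\<xi>. fourier_integral (t (real n)) \<xi> - g \<xi>)) \<longlonglongrightarrow> 0"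
  proof -
    have "\<exists>N. \<forall>m\<ge>N. \<forall>n\<ge>N. L2.nm lborel (\<lambda>\<xi>. fourier_integral (t (real m)) \<xi> - fourier_integral (t (real n)) \<xi>) < e"
      if e: "e > 0" for e
    proof -
      obtain N where N: "\<And>n. n \<ge> N \<Longrightarrow> L2.nm lborel (\<lambda>x. t (real n) x - f x) < e / 2"
        using LIMSEQ_D[OF tseq, of "e/2"] e by auto
      have "L2.nm lborel (\<lambda>\<xi>. fourier_integral (t (real m)) \<xi> - fourier_integral (t (real n)) \<xi>) < e"
        if "m \<ge> N" "n \<ge> N" for m n
      proof -
        have "L2.nm lborel (\<lambda>x. t (real m) x - t (real n) x) \<le>
            L2.nm lborel (\<lambda>x. t (real m) x - f x) + L2.nm lborel (\<lambda>x. t (real n) x - f x)"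
          using L2.nm_triangle_diff[OF t2 f t2, of "real m" "real n"] L2.nm_diff_commute[OF t2 f, of "real n"] by simp
        then show ?thesis
          using N[OF that(1)] N[OF that(2)] by (simp add: fourier_integral_isometry_diff t1 t2)
      qed
      then show ?thesis by blast
    qed
    then show ?thesis
      by (rule L2_Cauchy_convergent[where K=UNIV and X="\<lambda>n. fourier_integral (t (real n))", OF F2]) auto
  qed
  then obtain g where g: "g \<in> L2 lborel"
    and lim: "(\<lambda>n. L2.nm lborel (\<lambda>\<xi>. fourier_integral (t (real n)) \<xi> - g \<xi>)) \<longlonglongrightarrow> 0" by blast
  \<comment> \<open>g was obtained along integer radii. The isometry replaces the distance to g by
    the distance from the truncation to f, which tends to 0 along all real radii.\<close>
  have "is_fourier_transform f g"
    unfolding is_fourier_transform_iff[OF f] t_def[symmetric] iso[OF t1 t2 g lim] using g tlim by blast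
  then have "is_fourier_transform f (fourier f)"
    unfolding fourier_def by (rule someI[of "is_fourier_transform f"])
  then have F: "fourier f \<in> L2 lborel"
    and Flim: "((\<lambda>R. L2.nm lborel (\<lambda>\<xi>. fourier_integral (t R) \<xi> - fourier f \<xi>)) \<longlongrightarrow> 0) at_top"
    unfolding is_fourier_transform_iff[OF f] t_def by auto
  show "fourier f \<in> L2 lborel" by (rule F)
  show "L2.nm lborel (\<lambda>\<xi>. fourier_integral h \<xi> - fourier f \<xi>) = L2.nm lborel (\<lambda>x. h x - f x)"
    if "integrable lborel h" "h \<in> L2 lborel"
    by (rule iso[OF that F filterlim_compose[OF Flim filterlim_real_sequentially]])
qed

lemma fourier_measurable [measurable (raw)]:
  fixes f :: "real ^ 'n \<Rightarrow> complex"
  shows "f \<in> L2 lborel \<Longrightarrow> fourier f \<in> borel_measurable borel"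
  using fourier_L2[THEN L2_measurable] by simp

text \<open>The isometry for differences, taken at \<open>h = 0\<close>.\<close>

theorem plancherel:
  fixes f :: "real ^ 'n \<Rightarrow> complex"
  assumes f: "f \<in> L2 lborel"
  shows "L2.nm lborel (fourier f) = L2.nm lborel f"
proof -
  have z: "fourier_integral (\<lambda>x :: real ^ 'n. 0) = (\<lambda>\<xi>. 0)"
    by (simp add: fourier_integral_def fun_eq_iff)
  show ?thesis
    using fourier_isometry_diff[OF f, of "\<lambda>x. 0"] by (simp add: z L2.zero L2_nm_minus)
qed

text \<open>The transfer principle from Fourier integrals to \<open>fourier\<close>: any integrable
  L^2 approximation of f determines \<open>fourier f\<close> up to a null set.\<close>

lemma fourier_AE_eqI:
  fixes f g :: "real ^ 'n \<Rightarrow> complex"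
  assumes f: "f \<in> L2 lborel" and g: "g \<in> L2 lborel"
    and h: "\<And>n::nat. integrable lborel (h n)" "\<And>n. h n \<in> L2 lborel"
    and hf: "(\<lambda>n. L2.nm lborel (\<lambda>x. h n x - f x)) \<longlonglongrightarrow> 0"
    and hg: "(\<lambda>n. L2.nm lborel (\<lambda>\<xi>. fourier_integral (h n) \<xi> - g \<xi>)) \<longlonglongrightarrow> 0"
  shows "AE \<xi> in lborel. fourier f \<xi> = g \<xi>"
  by (rule L2_limit_unique[OF fourier_integral_contraction(1)[OF h] fourier_L2[OF f] g _ hg])
     (use hf in \<open>simp_all add: fourier_isometry_diff[OF f h]\<close>)

lemma fourier_eq_fourier_integral:
  fixes f :: "real ^ 'n \<Rightarrow> complex"
  assumes "integrable lborel f" "f \<in> L2 lborel"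
  shows "AE \<xi> in lborel. fourier f \<xi> = fourier_integral f \<xi>"
  by (rule fourier_AE_eqI[where h="\<lambda>n. f"])
     (use assms in \<open>auto intro: fourier_integral_contraction(1)\<close>)

lemma L2_truncation_sequence:
  fixes f :: "real ^ 'n \<Rightarrow> complex"
  assumes f: "f \<in> L2 lborel"
  obtains h where "\<And>n::nat. integrable lborel (h n)" "\<And>n. h n \<in> L2 lborel"
    "(\<lambda>n. L2.nm lborel (\<lambda>x. h n x - f x)) \<longlonglongrightarrow> 0"
    "(\<lambda>n. L2.nm lborel (\<lambda>\<xi>. fourier_integral (h n) \<xi> - fourier f \<xi>)) \<longlonglongrightarrow> 0"
proof -
  define h where "h n = (\<lambda>x. indicator (cball 0 (real n)) x *\<^sub>R f x)" for n :: nat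
  have h: "integrable lborel (h n)" "h n \<in> L2 lborel" for n
    unfolding h_def by (auto intro!: L2_restrict_integrable[OF f, where R="real n"] L2_restrict(1)[OF f])
  have lim: "(\<lambda>n. L2.nm lborel (\<lambda>x. h n x - f x)) \<longlonglongrightarrow> 0"
    unfolding h_def by (rule filterlim_compose[OF L2_truncation_tendsto[OF f] filterlim_real_sequentially])
  then show thesis using that[OF h lim] by (simp add: fourier_isometry_diff[OF f h])
qed

lemma L2_tendsto_add:
  assumes "\<And>n. X n \<in> L2 M" "\<And>n. Y n \<in> L2 M" "f \<in> L2 M" "g \<in> L2 M"
    and "((\<lambda>n. L2.nm M (\<lambda>x. X n x - f x)) \<longlongrightarrow> 0) F" "((\<lambda>n. L2.nm M (\<lambda>x. Y n x - g x)) \<longlongrightarrow> 0) F"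
  shows "((\<lambda>n. L2.nm M (\<lambda>x. (X n x + Y n x) - (f x + g x))) \<longlongrightarrow> 0) F"
proof (rule Lim_null_comparison[OF always_eventually])
  show "((\<lambda>n. L2.nm M (\<lambda>x. X n x - f x) + L2.nm M (\<lambda>x. Y n x - g x)) \<longlongrightarrow> 0) F"
    using tendsto_add[OF assms(5,6)] by simp
  have "L2.nm M (\<lambda>x. (X n x + Y n x) - (f x + g x)) \<le> L2.nm M (\<lambda>x. X n x - f x) + L2.nm M (\<lambda>x. Y n x - g x)" for n
    using L2.nm_triangle[OF L2.diff[OF assms(1,3)] L2.diff[OF assms(2,4)], of n n] by (simp add: algebra_simps)
  then show "\<forall>n. norm (L2.nm M (\<lambda>x. (X n x + Y n x) - (f x + g x))) \<le> L2.nm M (\<lambda>x. X n x - f x) + L2.nm M (\<lambda>x. Y n x - g x)"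
    by simp
qed

section \<open>Rules for the L^2 Fourier transform\<close>

lemma fourier_add:
  fixes f g :: "real ^ 'n \<Rightarrow> complex"
  assumes f: "f \<in> L2 lborel" and g: "g \<in> L2 lborel"
  shows "AE \<xi> in lborel. fourier (\<lambda>x. f x + g x) \<xi> = fourier f \<xi> + fourier g \<xi>"
proof -
  obtain h where h: "\<And>n::nat. integrable lborel (h n)" "\<And>n. h n \<in> L2 lborel"
    "(\<lambda>n. L2.nm lborel (\<lambda>x. h n x - f x)) \<longlonglongrightarrow> 0"
    "(\<lambda>n. L2.nm lborel (\<lambda>\<xi>. fourier_integral (h n) \<xi> - fourier f \<xi>)) \<longlonglongrightarrow> 0"
    by (rule L2_truncation_sequence[OF f]) (rule that)
  obtain k where k: "\<And>n::nat. integrable lborel (k n)" "\<And>n. k n \<in> L2 lborel"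
    "(\<lambda>n. L2.nm lborel (\<lambda>x. k n x - g x)) \<longlonglongrightarrow> 0"
    "(\<lambda>n. L2.nm lborel (\<lambda>\<xi>. fourier_integral (k n) \<xi> - fourier g \<xi>)) \<longlonglongrightarrow> 0"
    by (rule L2_truncation_sequence[OF g]) (rule that)
  show ?thesis
  proof (rule fourier_AE_eqI[where h="\<lambda>n x. h n x + k n x"])
    show "(\<lambda>n. L2.nm lborel (\<lambda>x. h n x + k n x - (f x + g x))) \<longlonglongrightarrow> 0"
      by (rule L2_tendsto_add[OF h(2) k(2) f g h(3) k(3)])
    show "(\<lambda>n. L2.nm lborel (\<lambda>\<xi>. fourier_integral (\<lambda>x. h n x + k n x) \<xi> - (fourier f \<xi> + fourier g \<xi>))) \<longlonglongrightarrow> 0"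
      unfolding fourier_integral_add[OF h(1) k(1)]
      by (rule L2_tendsto_add[OF _ _ fourier_L2[OF f] fourier_L2[OF g] h(4) k(4)])
         (intro fourier_integral_contraction(1) h k)+
  qed (auto intro: h k L2_add f g fourier_L2)
qed

lemma fourier_cmult:
  fixes f :: "real ^ 'n \<Rightarrow> complex"
  assumes f: "f \<in> L2 lborel"
  shows "AE \<xi> in lborel. fourier (\<lambda>x. c * f x) \<xi> = c * fourier f \<xi>"
proof -
  obtain h where h: "\<And>n::nat. integrable lborel (h n)" "\<And>n. h n \<in> L2 lborel"
    "(\<lambda>n. L2.nm lborel (\<lambda>x. h n x - f x)) \<longlonglongrightarrow> 0"
    "(\<lambda>n. L2.nm lborel (\<lambda>\<xi>. fourier_integral (h n) \<xi> - fourier f \<xi>)) \<longlonglongrightarrow> 0"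
    by (rule L2_truncation_sequence[OF f]) (rule that)
  have eq: "L2.nm lborel (\<lambda>x. c * u x - c * v x) = norm c * L2.nm lborel (\<lambda>x. u x - v x)" for u v :: "real ^ 'n \<Rightarrow> complex"
    using L2_nm_cmult[of lborel c "\<lambda>x. u x - v x"] by (simp add: right_diff_distrib)
  show ?thesis
  proof (rule fourier_AE_eqI[where h="\<lambda>n x. c * h n x"])
    show "(\<lambda>n. L2.nm lborel (\<lambda>x. c * h n x - c * f x)) \<longlonglongrightarrow> 0"
      unfolding eq using tendsto_mult_left[OF h(3), of "norm c"] by simp
    show "(\<lambda>n. L2.nm lborel (\<lambda>\<xi>. fourier_integral (\<lambda>x. c * h n x) \<xi> - c * fourier f \<xi>)) \<longlonglongrightarrow> 0"
      unfolding fourier_integral_cmult eq using tendsto_mult_left[OF h(4), of "norm c"] by simp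
  qed (auto intro: h L2_cmult f fourier_L2)
qed

lemma fourier_diff:
  fixes f g :: "real ^ 'n \<Rightarrow> complex"
  assumes f: "f \<in> L2 lborel" and g: "g \<in> L2 lborel"
  shows "AE \<xi> in lborel. fourier (\<lambda>x. f x - g x) \<xi> = fourier f \<xi> - fourier g \<xi>"
  using fourier_add[OF f L2_cmult[OF g, of "-1"]] fourier_cmult[OF g, of "-1"]
  by eventually_elim simp

lemma fourier_translate:
  fixes f :: "real ^ 'n \<Rightarrow> complex"
  assumes f: "f \<in> L2 lborel"
  shows "AE \<xi> in lborel. fourier (\<lambda>x. f (x - y)) \<xi> = exp (- (\<i> * of_real (y \<bullet> \<xi>))) * fourier f \<xi>"
proof -
  obtain h where h: "\<And>n::nat. integrable lborel (h n)" "\<And>n. h n \<in> L2 lborel"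
    "(\<lambda>n. L2.nm lborel (\<lambda>x. h n x - f x)) \<longlonglongrightarrow> 0"
    "(\<lambda>n. L2.nm lborel (\<lambda>\<xi>. fourier_integral (h n) \<xi> - fourier f \<xi>)) \<longlonglongrightarrow> 0"
    by (rule L2_truncation_sequence[OF f]) (rule that)
  have hm: "h n \<in> borel_measurable borel" for n using L2_measurable[OF h(2)] by simp
  let ?e = "\<lambda>\<xi>. exp (- (\<i> * complex_of_real (y \<bullet> \<xi>)))"
  have [measurable]: "?e \<in> borel_measurable borel" by measurable
  show ?thesis
  proof (rule fourier_AE_eqI[where h="\<lambda>n x. h n (x - y)"])
    show "integrable lborel (\<lambda>x. h n (x - y))" for n
      using lborel_affine_integrable[OF h(1)[of n], of 1 "-y"] by simp
    show "(\<lambda>n. L2.nm lborel (\<lambda>x. h n (x - y) - f (x - y))) \<longlonglongrightarrow> 0"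
      using h(3) L2_translate(2)[OF L2.diff[OF h(2) f], of _ y] by simp
    have "L2.nm lborel (\<lambda>\<xi>. ?e \<xi> * fourier_integral (h n) \<xi> - ?e \<xi> * fourier f \<xi>) =
        L2.nm lborel (\<lambda>\<xi>. fourier_integral (h n) \<xi> - fourier f \<xi>)" for n
      unfolding right_diff_distrib[symmetric] L2_nm_eq by (simp add: norm_mult)
    then show "(\<lambda>n. L2.nm lborel (\<lambda>\<xi>. fourier_integral (\<lambda>x. h n (x - y)) \<xi> - ?e \<xi> * fourier f \<xi>)) \<longlonglongrightarrow> 0"
      unfolding fourier_integral_translate[OF hm] using h(4) by simp
    have [measurable]: "fourier f \<in> borel_measurable borel" using f by measurable
    show "(\<lambda>\<xi>. ?e \<xi> * fourier f \<xi>) \<in> L2 lborel"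
      by (rule L2_dominated[OF fourier_L2[OF f]]) (auto simp: norm_mult)
  qed (auto intro: h L2_translate f)
qed

text \<open>The sharp Fourier projection onto E, written as an inverse Fourier integral, whence the
  argument \<open>- x\<close>. For bounded E the integrand is integrable, and the result has a
  definite value at every point that does not depend on the representative chosen by
  \<open>fourier\<close>.\<close>

definition band :: "(real ^ 'n) set \<Rightarrow> (real ^ 'n \<Rightarrow> complex) \<Rightarrow> real ^ 'n \<Rightarrow> complex" where
  "band E f x = fourier_integral (\<lambda>\<xi>. indicator E \<xi> *\<^sub>R fourier f \<xi>) (- x)"

context
  fixes E :: "(real ^ 'n) set" and R :: real
  assumes E [measurable]: "E \<in> sets borel" and ER: "E \<subseteq> cball 0 R"
begin

lemma band_integrable: "f \<in> L2 lborel \<Longrightarrow> integrable lborel (\<lambda>\<xi>. indicator E \<xi> *\<^sub>R fourier f \<xi>)"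
  by (rule L2_restrict_integrable[OF fourier_L2 E ER])

lemma restrict_fourier_L2: "f \<in> L2 lborel \<Longrightarrow> (\<lambda>\<xi>. indicator E \<xi> *\<^sub>R fourier f \<xi>) \<in> L2 lborel"
  by (intro L2_restrict fourier_L2) (use E in auto)

lemma band_L2: "f \<in> L2 lborel \<Longrightarrow> band E f \<in> L2 lborel"
  unfolding band_def[abs_def]
  by (intro L2_reflect fourier_integral_contraction(1) band_integrable restrict_fourier_L2)

lemma nm_band: "f \<in> L2 lborel \<Longrightarrow> L2.nm lborel (band E f) = L2.nm lborel (\<lambda>\<xi>. indicator E \<xi> *\<^sub>R fourier f \<xi>)"
  unfolding band_def[abs_def]
  by (simp add: L2_reflect(2) fourier_integral_contraction(1) plancherel_integrable band_integrable restrict_fourier_L2)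

lemma nm_band_le: "f \<in> L2 lborel \<Longrightarrow> L2.nm lborel (band E f) \<le> L2.nm lborel f"
  using L2_restrict(2)[OF fourier_L2, of f E] E by (simp add: nm_band plancherel)

text \<open>Cauchy-Schwarz over E in frequency space; the volume of E is the price for passing from
  L^2 to the supremum.\<close>

lemma band_bound:
  assumes f: "f \<in> L2 lborel"
  shows "norm (band E f x) \<le> (2 * pi) powr (- real CARD('n) / 2) *
    (sqrt (measure lborel E) * L2.nm lborel (\<lambda>\<xi>. indicator E \<xi> *\<^sub>R fourier f \<xi>))"
proof -
  have "emeasure lborel E < \<infinity>"
    using emeasure_mono[OF ER, of lborel] emeasure_cball_less_top[of R, where ?'a="real^'n"]
    by (auto intro: le_less_trans)
  then have "(LINT \<xi>|lborel. norm (indicator E \<xi> *\<^sub>R fourier f \<xi>)) \<le>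
      sqrt (measure lborel E) * L2.nm lborel (\<lambda>\<xi>. indicator E \<xi> *\<^sub>R fourier f \<xi>)"
    by (intro L2_indicator_integral(2) restrict_fourier_L2 f) auto
  moreover have "norm (band E f x) \<le> (2 * pi) powr (- real CARD('n) / 2) *
      (LINT \<xi>|lborel. norm (indicator E \<xi> *\<^sub>R fourier f \<xi>))"
    unfolding band_def by (rule fourier_integral_bound[OF band_integrable[OF f]])
  ultimately show ?thesis
    by (meson mult_left_mono order_trans powr_ge_zero)
qed

text \<open>Through this congruence the almost-everywhere rules for \<open>fourier\<close> become
  rules for \<open>band\<close> at each x.\<close>

lemma band_cong_AE:
  assumes f: "f \<in> L2 lborel" and g: "g \<in> borel_measurable borel" and eq: "AE \<xi> in lborel. fourier f \<xi> = g \<xi>"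
  shows "band E f x = fourier_integral (\<lambda>\<xi>. indicator E \<xi> *\<^sub>R g \<xi>) (- x)"
proof -
  have [measurable]: "fourier f \<in> borel_measurable borel" "g \<in> borel_measurable borel" using f g by auto
  show ?thesis
    unfolding band_def fourier_integral_def
    by (intro arg_cong2[where f="(*)"] refl integral_cong_AE) (use eq in auto)
qed

lemma band_add:
  assumes f: "f \<in> L2 lborel" and g: "g \<in> L2 lborel"
  shows "band E (\<lambda>x. f x + g x) x = band E f x + band E g x"
proof -
  have [measurable]: "fourier f \<in> borel_measurable borel" "fourier g \<in> borel_measurable borel" using f g by auto
  have "band E (\<lambda>x. f x + g x) x = fourier_integral (\<lambda>\<xi>. indicator E \<xi> *\<^sub>R (fourier f \<xi> + fourier g \<xi>)) (- x)"
    by (rule band_cong_AE[OF L2_add[OF f g] _ fourier_add[OF f g]]) measurable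
  then show ?thesis
    unfolding band_def scaleR_add_right by (simp only: fourier_integral_add[OF band_integrable[OF f] band_integrable[OF g]])
qed

lemma band_cmult:
  assumes f: "f \<in> L2 lborel"
  shows "band E (\<lambda>x. c * f x) x = c * band E f x"
proof -
  have [measurable]: "fourier f \<in> borel_measurable borel" using f by auto
  have "band E (\<lambda>x. c * f x) x = fourier_integral (\<lambda>\<xi>. indicator E \<xi> *\<^sub>R (c * fourier f \<xi>)) (- x)"
    by (rule band_cong_AE[OF L2_cmult[OF f] _ fourier_cmult[OF f]]) measurable
  also have "(\<lambda>\<xi>. indicator E \<xi> *\<^sub>R (c * fourier f \<xi>)) = (\<lambda>\<xi>. c * (indicator E \<xi> *\<^sub>R fourier f \<xi>))"
    by (intro ext) simp
  finally show ?thesis unfolding fourier_integral_cmult band_def .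
qed

lemma band_diff:
  assumes f: "f \<in> L2 lborel" and g: "g \<in> L2 lborel"
  shows "band E (\<lambda>x. f x - g x) x = band E f x - band E g x"
  using band_add[OF f L2_cmult[OF g, of "-1"]] band_cmult[OF g, of "-1"] by simp

lemma band_translate:
  assumes f: "f \<in> L2 lborel"
  shows "band E (\<lambda>x. f (x - y)) x = band E f (x - y)"
proof -
  have [measurable]: "fourier f \<in> borel_measurable borel" using f by auto
  have "band E (\<lambda>x. f (x - y)) x =
      fourier_integral (\<lambda>\<xi>. indicator E \<xi> *\<^sub>R (exp (- (\<i> * of_real (y \<bullet> \<xi>))) * fourier f \<xi>)) (- x)"
    by (rule band_cong_AE[OF L2_translate(1)[OF f] _ fourier_translate[OF f]]) measurable
  also have "(\<lambda>\<xi>. indicator E \<xi> *\<^sub>R (exp (- (\<i> * of_real (y \<bullet> \<xi>))) * fourier f \<xi>)) =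
      (\<lambda>\<xi>. exp (- (\<i> * of_real (\<xi> \<bullet> y))) * (indicator E \<xi> *\<^sub>R fourier f \<xi>))"
    by (intro ext) (simp add: inner_commute)
  finally show ?thesis unfolding fourier_integral_modulate band_def by simp
qed

text \<open>Fourier inversion in the form of a norm identity. Expanding the squares, the norms agree
  by Plancherel. The mixed terms agree by the multiplication formula, first for integrable
  approximations of f and then in the limit.\<close>

lemma nm_band_diff:
  assumes f: "f \<in> L2 lborel"
  shows "L2.nm lborel (\<lambda>x. band E f x - f x) = L2.nm lborel (\<lambda>\<xi>. indicator E \<xi> *\<^sub>R fourier f \<xi> - fourier f \<xi>)"
proof -
  define g where "g \<xi> = indicator E \<xi> *\<^sub>R fourier f \<xi>" for \<xi>
  have g: "integrable lborel g" "g \<in> L2 lborel"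
    unfolding g_def using band_integrable[OF f] restrict_fourier_L2[OF f] by auto
  obtain h where h: "\<And>n::nat. integrable lborel (h n)" "\<And>n. h n \<in> L2 lborel"
    "(\<lambda>n. L2.nm lborel (\<lambda>x. h n x - f x)) \<longlonglongrightarrow> 0"
    "(\<lambda>n. L2.nm lborel (\<lambda>\<xi>. fourier_integral (h n) \<xi> - fourier f \<xi>)) \<longlonglongrightarrow> 0"
    by (rule L2_truncation_sequence[OF f]) (rule that)
  have Fh: "fourier_integral (h n) \<in> L2 lborel" for n
    by (rule fourier_integral_contraction(1)[OF h(1,2)])
  have duality: "L2_form lborel (band E f) (h n) = L2_form lborel g (fourier_integral (h n))" for n
  proof -
    have [measurable]: "h n \<in> borel_measurable borel" "g \<in> borel_measurable borel"
      using L2_measurable[OF h(2)] L2_measurable[OF g(2)] by auto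
    have h': "integrable lborel (\<lambda>x. cnj (h n (- x)))"
      using lborel_affine_integrable[OF h(1)[of n], of "-1" 0] by simp
    have "(LINT x|lborel. band E f x * cnj (h n x)) = (LINT x|lborel. fourier_integral g x * cnj (h n (- x)))"
      unfolding band_def g_def[symmetric]
      by (subst lborel_affine_integral[where c="-1" and t=0]) auto
    also have "\<dots> = (LINT \<xi>|lborel. g \<xi> * fourier_integral (\<lambda>x. cnj (h n (- x))) \<xi>)"
      by (rule fourier_integral_multiplication[OF g(1) h'])
    also have "\<dots> = (LINT \<xi>|lborel. g \<xi> * cnj (fourier_integral (h n) \<xi>))"
      by (simp add: cnj_fourier_integral)
    finally show ?thesis
      by (simp add: L2_form_eq_Re band_L2[OF f] h(2) g(2) Fh)
  qed
  have "(\<lambda>n. L2_form lborel (h n) (band E f)) \<longlonglongrightarrow> L2_form lborel f (band E f)"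
    by (rule L2.form_tendsto[OF h(2) f band_L2[OF f] h(3)])
  moreover have "(\<lambda>n. L2_form lborel (fourier_integral (h n)) g) \<longlonglongrightarrow> L2_form lborel (fourier f) g"
    by (rule L2.form_tendsto[OF Fh fourier_L2[OF f] g(2) h(4)])
  ultimately have form: "L2_form lborel (band E f) f = L2_form lborel g (fourier f)"
    using duality LIMSEQ_unique
    by (simp add: L2.form_sym[OF h(2) band_L2[OF f]] L2.form_sym[OF Fh g(2)]
        L2.form_sym[OF f band_L2[OF f]] L2.form_sym[OF fourier_L2[OF f] g(2)])
  have "(L2.nm lborel (\<lambda>x. band E f x - f x))\<^sup>2 = (L2.nm lborel (\<lambda>\<xi>. g \<xi> - fourier f \<xi>))\<^sup>2"
    using nm_band[OF f] plancherel[OF f]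
    by (simp add: L2.nm_sq[OF L2.diff] L2.form_diff_self band_L2 f g fourier_L2 form
      flip: L2.nm_sq[OF band_L2[OF f]] L2.nm_sq[OF f] L2.nm_sq[OF g(2)] L2.nm_sq[OF fourier_L2[OF f]])
       (simp add: g_def[abs_def])
  then show ?thesis unfolding g_def by (simp add: power2_eq_iff_nonneg)
qed

end

lemma band_disjoint_union:
  fixes f :: "real ^ 'n \<Rightarrow> complex"
  assumes f: "f \<in> L2 lborel" and A: "A \<in> sets borel" "A \<subseteq> cball 0 R" and B: "B \<in> sets borel" "B \<subseteq> cball 0 R"
    and AB: "A \<inter> B = {}"
  shows "band (A \<union> B) f x = band A f x + band B f x"
proof -
  have "(\<lambda>\<xi>. indicator (A \<union> B) \<xi> *\<^sub>R fourier f \<xi>) = (\<lambda>\<xi>. indicator A \<xi> *\<^sub>R fourier f \<xi> + indicator B \<xi> *\<^sub>R fourier f \<xi>)"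
    using AB by (intro ext) (auto simp: indicator_def)
  then show ?thesis
    unfolding band_def by (simp only: fourier_integral_add[OF band_integrable[OF A f] band_integrable[OF B f]])
qed

lemma band_cball_tendsto:
  fixes f :: "real ^ 'n \<Rightarrow> complex"
  assumes f: "f \<in> L2 lborel"
  shows "((\<lambda>R. L2.nm lborel (\<lambda>x. band (cball 0 R) f x - f x)) \<longlongrightarrow> 0) at_top"
  using L2_truncation_tendsto[OF fourier_L2[OF f]]
  by (simp add: nm_band_diff[OF _ subset_refl f])

section \<open>Subcritical Sobolev estimates\<close>

text \<open>Convexity of the power q, applied to x + y as the combination of x / (1 - t) and y / t
  with weights 1 - t and t. The free t matters: 1/2 for plain splittings, a value tuned to
  \<open>ratio\<close> for summing dyadic blocks, and t near 0 for splitting masses with factor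
  close to 1.\<close>

lemma powr_add_le:
  fixes x y q t :: real
  assumes q: "1 \<le> q" and t: "0 < t" "t < 1" and xy: "0 \<le> x" "0 \<le> y"
  shows "(x + y) powr q \<le> (1 - t) powr (1 - q) * x powr q + t powr (1 - q) * y powr q"
proof -
  have sc: "s * (z / s) powr q = s powr (1 - q) * z powr q" if "s > 0" "z \<ge> 0" for s z :: real
  proof -
    have "s * (z / s) powr q = s powr 1 * (z powr q / s powr q)"
      using that by (simp add: powr_divide)
    also have "\<dots> = s powr (1 - q) * z powr q"
      using that by (simp add: powr_diff)
    finally show ?thesis .
  qed
  have ge1: "1 \<le> s powr (1 - q)" if "0 < s" "s < 1" for s :: real
    using powr_mono'[of "1 - q" 0 s] that q by simp
  show ?thesis
  proof (cases "x = 0 \<or> y = 0")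
    case True
    then show ?thesis
      using mult_right_mono[OF ge1[OF t], of "y powr q"] mult_right_mono[OF ge1[of "1 - t"], of "x powr q"] t
      by auto
  next
    case False
    then have "((1 - t) *\<^sub>R (x / (1 - t)) + t *\<^sub>R (y / t)) powr q \<le>
        (1 - t) * (x / (1 - t)) powr q + t * (y / t) powr q"
      using t xy by (intro convex_onD[OF powr_convex[OF q]]) auto
    then show ?thesis
      using t xy sc[of "1 - t" x] sc[of t y] by simp
  qed
qed

lemma norm_add_powr_le:
  fixes a b :: complex
  assumes q: "1 \<le> q" and t: "0 < t" "t < 1"
  shows "norm (a + b) powr q \<le> (1 - t) powr (1 - q) * norm a powr q + t powr (1 - q) * norm b powr q"
proof -
  have "norm (a + b) powr q \<le> (norm a + norm b) powr q"
    using q by (intro powr_mono2 norm_triangle_ineq) auto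
  also have "\<dots> \<le> (1 - t) powr (1 - q) * norm a powr q + t powr (1 - q) * norm b powr q"
    by (rule powr_add_le[OF q t]) auto
  finally show ?thesis .
qed

lemma nn_integral_powr_add_le:
  fixes f g :: "'a \<Rightarrow> complex"
  assumes q: "1 \<le> q" and t: "0 < t" "t < 1"
    and [measurable]: "f \<in> borel_measurable M" "g \<in> borel_measurable M"
  shows "(\<integral>\<^sup>+x. ennreal (norm (f x + g x) powr q) \<partial>M) \<le>
    ennreal ((1 - t) powr (1 - q)) * (\<integral>\<^sup>+x. ennreal (norm (f x) powr q) \<partial>M) +
    ennreal (t powr (1 - q)) * (\<integral>\<^sup>+x. ennreal (norm (g x) powr q) \<partial>M)"
proof -
  have "(\<integral>\<^sup>+x. ennreal (norm (f x + g x) powr q) \<partial>M) \<le>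
      (\<integral>\<^sup>+x. ennreal ((1 - t) powr (1 - q)) * ennreal (norm (f x) powr q) +
        ennreal (t powr (1 - q)) * ennreal (norm (g x) powr q) \<partial>M)"
    using norm_add_powr_le[OF q t] by (intro nn_integral_mono) (simp add: ennreal_leI flip: ennreal_mult ennreal_plus)
  then show ?thesis by (simp add: nn_integral_add nn_integral_cmult)
qed

text \<open>Interpolation between L^infinity and L^2: q - 2 of the q factors are estimated by
  B.\<close>

lemma nn_integral_powr_interpolation:
  assumes f: "f \<in> L2 M" and M: "\<And>x. norm (f x) \<le> B" and q: "2 \<le> q"
  shows "(\<integral>\<^sup>+x. ennreal (norm (f x) powr q) \<partial>M) \<le> ennreal (B powr (q - 2) * (L2.nm M f)\<^sup>2)"
proof -
  have [measurable]: "f \<in> borel_measurable M" using L2_measurable[OF f] .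
  have le: "norm (f x) powr q \<le> B powr (q - 2) * (norm (f x))\<^sup>2" for x
  proof (cases "f x = 0")
    case False
    have "norm (f x) powr q = norm (f x) powr ((q - 2) + 2)" by simp
    also have "\<dots> = norm (f x) powr (q - 2) * norm (f x) powr 2" by (rule powr_add)
    also have "norm (f x) powr 2 = (norm (f x))\<^sup>2" using False by simp
    also have "norm (f x) powr (q - 2) \<le> B powr (q - 2)"
      using q M by (intro powr_mono2) auto
    finally show ?thesis by (simp add: mult_right_mono)
  qed simp
  have "(\<integral>\<^sup>+x. ennreal (norm (f x) powr q) \<partial>M) \<le> (\<integral>\<^sup>+x. ennreal (B powr (q - 2)) * ennreal ((norm (f x))\<^sup>2) \<partial>M)"
    using le by (intro nn_integral_mono) (simp add: ennreal_leI flip: ennreal_mult)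
  also have "\<dots> = ennreal (B powr (q - 2) * (L2.nm M f)\<^sup>2)"
    by (subst nn_integral_cmult) (simp_all add: L2_nn_integral[OF f] ennreal_mult)
  finally show ?thesis .
qed

text \<open>Its L^2 norm is \<open>sobolev_norm\<close>, so the inner product of the Sobolev space
  is pulled back from L^2 along this map.\<close>

definition weighted_fourier :: "real \<Rightarrow> (real ^ 'n \<Rightarrow> complex) \<Rightarrow> real ^ 'n \<Rightarrow> complex" where
  "weighted_fourier \<alpha> f \<xi> = (1 + (norm \<xi>)\<^sup>2) powr (\<alpha> / 2) *\<^sub>R fourier f \<xi>"

lemma sobolev_space_iff:
  "f \<in> sobolev_space K \<alpha> \<longleftrightarrow> range f \<subseteq> K \<and> f \<in> L2 lborel \<and> weighted_fourier \<alpha> f \<in> L2 lborel"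
  by (auto simp: sobolev_space_def square_integrable_iff weighted_fourier_def[abs_def])

lemma sobolev_spaceD:
  assumes "f \<in> sobolev_space K \<alpha>"
  shows "f \<in> L2 lborel" "weighted_fourier \<alpha> f \<in> L2 lborel" "range f \<subseteq> K"
  using assms by (auto simp: sobolev_space_iff)

lemma sobolev_norm_eq: "sobolev_norm \<alpha> f = L2.nm lborel (weighted_fourier \<alpha> f)"
proof -
  have "(1 + (norm \<xi>)\<^sup>2) powr \<alpha> * (norm (fourier f \<xi>))\<^sup>2 = (norm (weighted_fourier \<alpha> f \<xi>))\<^sup>2" for \<xi>
  proof -
    have "(1 + (norm \<xi>)\<^sup>2) powr \<alpha> = ((1 + (norm \<xi>)\<^sup>2) powr (\<alpha> / 2))\<^sup>2"
      by (simp add: power2_eq_square flip: powr_add)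
    then show ?thesis by (simp add: weighted_fourier_def power_mult_distrib)
  qed
  then show ?thesis unfolding sobolev_norm_def L2_nm_eq by simp
qed

lemma sobolev_norm_nonneg [simp]: "0 \<le> sobolev_norm \<alpha> f"
  by (simp add: sobolev_norm_eq)

lemma weight_ge_1: "\<alpha> \<ge> 0 \<Longrightarrow> 1 \<le> (1 + (norm \<xi>)\<^sup>2) powr (\<alpha> / 2)"
  by (rule ge_one_powr_ge_zero) auto

lemma L2_nm_le_sobolev_norm:
  assumes f: "f \<in> sobolev_space K \<alpha>" and a: "\<alpha> \<ge> 0"
  shows "L2.nm lborel f \<le> sobolev_norm \<alpha> f"
proof -
  have "L2.nm lborel (fourier f) \<le> L2.nm lborel (weighted_fourier \<alpha> f)"
  proof (rule L2_nm_mono[OF sobolev_spaceD(2)[OF f]])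
    have "norm (fourier f \<xi>) \<le> norm (weighted_fourier \<alpha> f \<xi>)" for \<xi>
      using mult_right_mono[OF weight_ge_1[OF a, of \<xi>] norm_ge_zero[of "fourier f \<xi>"]]
      by (simp add: weighted_fourier_def)
    then show "AE \<xi> in lborel. norm (fourier f \<xi>) \<le> norm (weighted_fourier \<alpha> f \<xi>)" by simp
  qed (use sobolev_spaceD(1)[OF f] in simp)
  then show ?thesis by (simp add: plancherel[OF sobolev_spaceD(1)[OF f]] sobolev_norm_eq)
qed

text \<open>On A the Sobolev weight is at least \<open>r powr \<alpha>\<close>.\<close>

lemma high_frequency_decay:
  assumes f: "f \<in> sobolev_space K \<alpha>" and a: "\<alpha> \<ge> 0" and r: "r > 0"
    and A: "A \<in> sets borel" "\<And>\<xi>. \<xi> \<in> A \<Longrightarrow> r \<le> norm \<xi>"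
  shows "L2.nm lborel (\<lambda>\<xi>. indicator A \<xi> *\<^sub>R fourier f \<xi>) \<le> r powr (- \<alpha>) * sobolev_norm \<alpha> f"
proof -
  have [measurable]: "fourier f \<in> borel_measurable borel" "A \<in> sets borel"
    using sobolev_spaceD(1)[OF f] A by auto
  have g: "(\<lambda>\<xi>. of_real (r powr (- \<alpha>)) * weighted_fourier \<alpha> f \<xi>) \<in> L2 lborel"
    by (intro L2_cmult sobolev_spaceD(2)[OF f])
  have "norm (indicator A \<xi> *\<^sub>R fourier f \<xi>) \<le> norm (of_real (r powr (- \<alpha>)) * weighted_fourier \<alpha> f \<xi>)" for \<xi>
  proof (cases "\<xi> \<in> A")
    case True
    have "r powr \<alpha> \<le> norm \<xi> powr \<alpha>" using A(2)[OF True] r a by (intro powr_mono2) auto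
    also have "\<dots> = ((norm \<xi>)\<^sup>2) powr (\<alpha> / 2)"
      using A(2)[OF True] r by (simp add: powr_powr flip: powr_numeral)
    also have "\<dots> \<le> (1 + (norm \<xi>)\<^sup>2) powr (\<alpha> / 2)"
      using a by (intro powr_mono2) auto
    finally have "1 \<le> r powr (- \<alpha>) * (1 + (norm \<xi>)\<^sup>2) powr (\<alpha> / 2)"
      using r by (simp add: powr_minus field_simps)
    from mult_right_mono[OF this norm_ge_zero[of "fourier f \<xi>"]] show ?thesis
      using True by (simp add: weighted_fourier_def norm_mult mult_ac)
  qed simp
  then have "L2.nm lborel (\<lambda>\<xi>. indicator A \<xi> *\<^sub>R fourier f \<xi>) \<le>
      L2.nm lborel (\<lambda>\<xi>. of_real (r powr (- \<alpha>)) * weighted_fourier \<alpha> f \<xi>)"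
    by (intro L2_nm_mono[OF g]) auto
  then show ?thesis by (simp add: L2_nm_cmult sobolev_norm_eq)
qed

section \<open>Dyadic decomposition and the embedding into L^q\<close>

abbreviation low :: "nat \<Rightarrow> (real ^ 'n \<Rightarrow> complex) \<Rightarrow> real ^ 'n \<Rightarrow> complex" where
  "low k \<equiv> band (cball 0 (2 ^ k))"

lemma low_bound:
  fixes f :: "real ^ 'n \<Rightarrow> complex"
  assumes f: "f \<in> L2 lborel"
  shows "norm (low k f x) \<le> (2 * pi) powr (- real CARD('n) / 2) *
    sqrt (measure lborel (cball (0 :: real ^ 'n) (2 ^ k))) * L2.nm lborel f"
proof -
  have "norm (low k f x) \<le> (2 * pi) powr (- real CARD('n) / 2) *
    (sqrt (measure lborel (cball (0 :: real ^ 'n) (2 ^ k))) *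
      L2.nm lborel (\<lambda>\<xi>. indicator (cball 0 (2 ^ k)) \<xi> *\<^sub>R fourier f \<xi>))"
    by (rule band_bound[OF _ subset_refl f]) simp
  also have "\<dots> \<le> (2 * pi) powr (- real CARD('n) / 2) *
    (sqrt (measure lborel (cball (0 :: real ^ 'n) (2 ^ k))) * L2.nm lborel f)"
    using L2_restrict(2)[OF fourier_L2[OF f], of "cball 0 (2 ^ k)"] plancherel[OF f]
    by (intro mult_left_mono) auto
  finally show ?thesis by (simp add: mult.assoc)
qed

text \<open>The inequality \<open>sub\<close> covers both cases of \<open>critical_exponent\<close>
  at once, and it is exactly what makes \<open>ratio\<close> less than 1. The parameter
  \<open>dim\<close> fixes the dimension through its type.\<close>

locale subcritical =
  fixes \<alpha> q :: real and dim :: "'n::finite itself"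
  assumes a: "\<alpha> > 0" and q: "q > 2"
    and sub: "real CARD('n) * (q - 2) < 2 * \<alpha> * q"
begin

text \<open>From one dyadic block to the next the sup bound changes by 2^(N/2 - \<alpha>) and the
  L^2 bound by 2^(-\<alpha>). Interpolation takes the former to the power q - 2 and the latter to
  the power 2.\<close>

definition ratio :: real where "ratio = 2 powr (real CARD('n) * (q - 2) / 2 - \<alpha> * q)"

lemma ratio: "0 < ratio" "ratio < 1"
  using sub by (auto simp: ratio_def powr_less_one)

text \<open>The shell of frequencies has volume O(2^(k N)), and the transform on it has L^2 norm
  O(2^(-k \<alpha>)). Cauchy-Schwarz gives the supremum of the block, Plancherel its L^2
  norm.\<close>

lemma dyadic_block_bound:
  obtains C where "C \<ge> 0" "\<And>(f :: real ^ 'n \<Rightarrow> complex) K k. f \<in> sobolev_space K \<alpha> \<Longrightarrow>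
    (\<integral>\<^sup>+x. ennreal (norm (band (cball 0 (2 ^ Suc k) - cball 0 (2 ^ k)) f x) powr q) \<partial>lborel) \<le>
    ennreal (C * ratio ^ k * sobolev_norm \<alpha> f powr q)"
proof -
  define N where "N = real CARD('n)"
  define C1 where "C1 = (2 * pi) powr (- N / 2) * sqrt (unit_ball_vol N * 2 powr N)"
  have C1: "C1 \<ge> 0" by (simp add: C1_def unit_ball_vol_nonneg N_def)
  have "(\<integral>\<^sup>+x. ennreal (norm (band (cball 0 (2 ^ Suc k) - cball 0 (2 ^ k)) f x) powr q) \<partial>lborel) \<le>
      ennreal (C1 powr (q - 2) * ratio ^ k * sobolev_norm \<alpha> f powr q)"
    if f: "f \<in> sobolev_space K \<alpha>" for f :: "real ^ 'n \<Rightarrow> complex" and K k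
  proof -
    define A where "A = cball (0 :: real ^ 'n) (2 ^ Suc k) - cball 0 (2 ^ k)"
    define S where "S = sobolev_norm \<alpha> f"
    have S: "S \<ge> 0" by (simp add: S_def)
    have A: "A \<in> sets borel" "A \<subseteq> cball 0 (2 ^ Suc k)" by (auto simp: A_def)
    note f2 = sobolev_spaceD(1)[OF f]
    have tw: "(2::real) ^ k = 2 powr real k" by (simp add: powr_realpow)
    have "L2.nm lborel (\<lambda>\<xi>. indicator A \<xi> *\<^sub>R fourier f \<xi>) \<le> (2 ^ k) powr (- \<alpha>) * S"
      unfolding S_def using a by (intro high_frequency_decay[OF f _ _ A(1)]) (auto simp: A_def)
    then have dec: "L2.nm lborel (\<lambda>\<xi>. indicator A \<xi> *\<^sub>R fourier f \<xi>) \<le> 2 powr (- real k * \<alpha>) * S"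
      by (simp add: tw powr_powr)
    have meas: "measure lborel A \<le> unit_ball_vol N * 2 powr N * 2 powr (real k * N)"
    proof -
      have "measure lborel A \<le> measure lborel (cball (0 :: real ^ 'n) (2 ^ Suc k))"
        using A emeasure_cball_less_top[of "2 ^ Suc k", where ?'a="real^'n"]
        by (intro measure_mono_fmeasurable) (auto simp: fmeasurable_def)
      also have "\<dots> = unit_ball_vol N * (2 ^ Suc k) ^ CARD('n)"
        by (simp add: content_cball N_def)
      also have "(2 ^ Suc k :: real) ^ CARD('n) = 2 powr N * 2 powr (real k * N)"
        by (simp add: N_def powr_realpow power_mult_distrib powr_powr[symmetric] flip: tw)
      finally show ?thesis by simp
    qed
    have bound: "norm (band A f x) \<le> C1 * 2 powr (real k * (N / 2 - \<alpha>)) * S" for x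
    proof -
      have "norm (band A f x) \<le> (2 * pi) powr (- N / 2) *
          (sqrt (measure lborel A) * L2.nm lborel (\<lambda>\<xi>. indicator A \<xi> *\<^sub>R fourier f \<xi>))"
        unfolding N_def by (rule band_bound[OF A f2])
      also have "\<dots> \<le> (2 * pi) powr (- N / 2) *
          (sqrt (unit_ball_vol N * 2 powr N * 2 powr (real k * N)) * (2 powr (- real k * \<alpha>) * S))"
        by (intro mult_left_mono mult_mono real_sqrt_le_mono meas dec)
           (auto simp: unit_ball_vol_nonneg N_def)
      also have "sqrt (unit_ball_vol N * 2 powr N * 2 powr (real k * N)) =
          sqrt (unit_ball_vol N * 2 powr N) * 2 powr (real k * N / 2)"
        by (simp add: real_sqrt_mult powr_half_sqrt[symmetric] powr_powr)
      also have "(2 * pi) powr (- N / 2) * (sqrt (unit_ball_vol N * 2 powr N) * 2 powr (real k * N / 2) *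
          (2 powr (- real k * \<alpha>) * S)) = C1 * (2 powr (real k * N / 2) * 2 powr (- real k * \<alpha>)) * S"
        by (simp add: C1_def)
      also have "2 powr (real k * N / 2) * 2 powr (- real k * \<alpha>) = 2 powr (real k * (N / 2 - \<alpha>))"
        by (simp add: powr_add[symmetric] right_diff_distrib)
      finally show ?thesis .
    qed
    have "(\<integral>\<^sup>+x. ennreal (norm (band A f x) powr q) \<partial>lborel) \<le>
        ennreal ((C1 * 2 powr (real k * (N / 2 - \<alpha>)) * S) powr (q - 2) * (L2.nm lborel (band A f))\<^sup>2)"
      using q by (intro nn_integral_powr_interpolation[OF band_L2[OF A f2] bound]) auto
    also have "\<dots> \<le> ennreal (C1 powr (q - 2) * ratio ^ k * S powr q)"
    proof (rule ennreal_leI)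
      have "(L2.nm lborel (band A f))\<^sup>2 \<le> (2 powr (- real k * \<alpha>) * S)\<^sup>2"
        unfolding nm_band[OF A f2] by (intro power_mono dec) simp
      also have "\<dots> = 2 powr (- 2 * real k * \<alpha>) * S\<^sup>2"
        by (simp add: power_mult_distrib power2_eq_square powr_add[symmetric] mult_ac)
      finally have "(C1 * 2 powr (real k * (N / 2 - \<alpha>)) * S) powr (q - 2) * (L2.nm lborel (band A f))\<^sup>2 \<le>
          (C1 * 2 powr (real k * (N / 2 - \<alpha>)) * S) powr (q - 2) * (2 powr (- 2 * real k * \<alpha>) * S\<^sup>2)"
        by (rule mult_left_mono) simp
      also have "\<dots> = C1 powr (q - 2) *
          (2 powr (real k * (N / 2 - \<alpha>) * (q - 2)) * 2 powr (- 2 * real k * \<alpha>)) * (S powr (q - 2) * S\<^sup>2)"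
        using C1 S by (simp add: powr_mult powr_powr)
      also have "S powr (q - 2) * S\<^sup>2 = S powr q"
        using S q by (cases "S = 0") (auto simp flip: powr_numeral powr_add)
      also have "2 powr (real k * (N / 2 - \<alpha>) * (q - 2)) * 2 powr (- 2 * real k * \<alpha>) = ratio ^ k"
      proof -
        have "real k * (N / 2 - \<alpha>) * (q - 2) + (- 2 * real k * \<alpha>) = (N * (q - 2) / 2 - \<alpha> * q) * real k"
          by (simp add: field_simps)
        then show ?thesis
          unfolding ratio_def N_def[symmetric] by (simp flip: powr_add powr_realpow add: powr_powr)
      qed
      finally show "(C1 * 2 powr (real k * (N / 2 - \<alpha>)) * S) powr (q - 2) * (L2.nm lborel (band A f))\<^sup>2 \<le>
          C1 powr (q - 2) * ratio ^ k * S powr q" .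
    qed
    finally show ?thesis unfolding A_def S_def .
  qed
  then show thesis using that[of "C1 powr (q - 2)"] by simp
qed

text \<open>Finitely many blocks are summed by induction, peeling off the lowest one; the statement
  must hold for all k, since the rest starts at \<open>Suc k\<close> and thereby gains a factor
  \<open>ratio\<close>. With t = ratio^(1/q) the recursion factor t^(1-q) ratio equals t, which is
  below 1, so one constant serves any number of blocks. Fatou's lemma along an almost-everywhere
  convergent subsequence of \<open>low (k + j) f\<close> then reaches f.\<close>

lemma low_tail_bound:
  obtains D where "D \<ge> 0" "\<And>(f :: real ^ 'n \<Rightarrow> complex) K k. f \<in> sobolev_space K \<alpha> \<Longrightarrow>
    (\<integral>\<^sup>+x. ennreal (norm (f x - low k f x) powr q) \<partial>lborel) \<le> ennreal (D * ratio ^ k * sobolev_norm \<alpha> f powr q)"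
proof -
  obtain C where C: "C \<ge> 0" "\<And>(f :: real ^ 'n \<Rightarrow> complex) K k. f \<in> sobolev_space K \<alpha> \<Longrightarrow>
    (\<integral>\<^sup>+x. ennreal (norm (band (cball 0 (2 ^ Suc k) - cball 0 (2 ^ k)) f x) powr q) \<partial>lborel) \<le>
    ennreal (C * ratio ^ k * sobolev_norm \<alpha> f powr q)"
    by (rule dyadic_block_bound) (rule that)
  \<comment> \<open>\<open>D\<close> solves \<open>(1 - t) powr (1 - q) * C + t powr (1 - q) * ratio * D = D\<close>, which closes the induction.\<close>
  define t where "t = ratio powr (1 / q)"
  have t: "0 < t" "t < 1"
    using ratio q powr_less_mono2[of "1 / q" ratio 1] by (auto simp: t_def)
  have tq: "t powr (1 - q) * ratio = t"
  proof -
    have "ratio = t powr q" using ratio q by (simp add: t_def powr_powr)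
    then have "t powr (1 - q) * ratio = t powr ((1 - q) + q)" by (simp only: powr_add)
    then show ?thesis using t by simp
  qed
  define D where "D = C * (1 - t) powr (- q)"
  have D: "D \<ge> 0" using C by (simp add: D_def)
  have Deq: "(1 - t) powr (1 - q) * C + t powr (1 - q) * (D * ratio) = D"
  proof -
    have "(1 - t) powr (1 - q) = (1 - t) * (1 - t) powr (- q)"
      using t powr_add[of "1 - t" 1 "- q"] by simp
    moreover have "t powr (1 - q) * (D * ratio) = D * t"
      using tq by (metis mult.left_commute mult.commute)
    moreover have "(1 - t) * (1 - t) powr (- q) * C = (1 - t) * D"
      by (simp only: D_def mult_ac)
    ultimately show ?thesis by (simp only:) (simp add: algebra_simps)
  qed
  have step: "(\<integral>\<^sup>+x. ennreal (norm (low (k + j) f x - low k f x) powr q) \<partial>lborel) \<le>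
      ennreal (D * ratio ^ k * sobolev_norm \<alpha> f powr q)"
    if f: "f \<in> sobolev_space K \<alpha>" for f :: "real ^ 'n \<Rightarrow> complex" and K k j
  proof (induction j arbitrary: k)
    case 0
    then show ?case using q by simp
  next
    case (Suc j)
    note f2 = sobolev_spaceD(1)[OF f]
    let ?A = "cball (0 :: real ^ 'n) (2 ^ Suc k) - cball 0 (2 ^ k)"
    have sub: "(2::real) ^ k \<le> 2 ^ Suc k" by simp
    have "cball (0 :: real ^ 'n) (2 ^ Suc k) = ?A \<union> cball 0 (2 ^ k)"
      using subset_cball[OF sub, of "0 :: real ^ 'n"] by blast
    then have "low (Suc k) f x = band ?A f x + low k f x" for x
      using band_disjoint_union[OF f2, of ?A "2 ^ Suc k" "cball 0 (2 ^ k)" x] subset_cball[OF sub, of "0 :: real ^ 'n"]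
      by auto
    then have eq: "low (k + Suc j) f x - low k f x = band ?A f x + (low (Suc k + j) f x - low (Suc k) f x)" for x
      by simp
    have [measurable]: "low i f \<in> borel_measurable lborel" for i
      using band_L2[OF _ subset_refl f2, of "2 ^ i"] by (auto dest: L2_measurable)
    have [measurable]: "band ?A f \<in> borel_measurable lborel"
      by (rule L2_measurable[OF band_L2[OF _ _ f2]]) auto
    have "(\<integral>\<^sup>+x. ennreal (norm (low (k + Suc j) f x - low k f x) powr q) \<partial>lborel) \<le>
        ennreal ((1 - t) powr (1 - q)) * (\<integral>\<^sup>+x. ennreal (norm (band ?A f x) powr q) \<partial>lborel) +
        ennreal (t powr (1 - q)) * (\<integral>\<^sup>+x. ennreal (norm (low (Suc k + j) f x - low (Suc k) f x) powr q) \<partial>lborel)"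
      unfolding eq by (rule nn_integral_powr_add_le) (use q t in simp, use t in simp, use t in simp, measurable)
    also have "\<dots> \<le> ennreal ((1 - t) powr (1 - q)) * ennreal (C * ratio ^ k * sobolev_norm \<alpha> f powr q) +
        ennreal (t powr (1 - q)) * ennreal (D * ratio ^ Suc k * sobolev_norm \<alpha> f powr q)"
      by (intro add_mono mult_left_mono C(2)[OF f] Suc.IH) auto
    also have "\<dots> = ennreal ((1 - t) powr (1 - q) * (C * ratio ^ k * sobolev_norm \<alpha> f powr q) +
        t powr (1 - q) * (D * ratio ^ Suc k * sobolev_norm \<alpha> f powr q))"
      using C(1) D ratio by (simp add: ennreal_mult ennreal_plus)
    also have "(1 - t) powr (1 - q) * (C * ratio ^ k * sobolev_norm \<alpha> f powr q) +
        t powr (1 - q) * (D * ratio ^ Suc k * sobolev_norm \<alpha> f powr q) =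
        ((1 - t) powr (1 - q) * C + t powr (1 - q) * (D * ratio)) * (ratio ^ k * sobolev_norm \<alpha> f powr q)"
      by (simp add: algebra_simps)
    finally show ?case unfolding Deq by (simp add: mult.assoc)
  qed
  have "(\<integral>\<^sup>+x. ennreal (norm (f x - low k f x) powr q) \<partial>lborel) \<le> ennreal (D * ratio ^ k * sobolev_norm \<alpha> f powr q)"
    if f: "f \<in> sobolev_space K \<alpha>" for f :: "real ^ 'n \<Rightarrow> complex" and K k
  proof -
    note f2 = sobolev_spaceD(1)[OF f]
    have l2: "low i f \<in> L2 lborel" for i by (rule band_L2[OF _ subset_refl f2]) simp
    note [measurable] = L2_measurable[OF f2] L2_measurable[OF l2]
    have "filterlim (\<lambda>j. 2 ^ (k + j) :: real) at_top sequentially"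
    proof (rule filterlim_at_top_mono[OF filterlim_real_sequentially always_eventually])
      have "real j \<le> 2 ^ (k + j)" for j
        using of_nat_less_two_power[of j, where 'a=real] power_increasing[of j "k + j" "2::real"] by linarith
      then show "\<forall>j. real j \<le> 2 ^ (k + j)" by simp
    qed
    then have "(\<lambda>j. L2.nm lborel (\<lambda>x. low (k + j) f x - f x)) \<longlonglongrightarrow> 0"
      by (rule filterlim_compose[OF band_cball_tendsto[OF f2]])
    then obtain r where r: "AE x in lborel. (\<lambda>j. low (k + r j) f x) \<longlonglongrightarrow> f x"
      by (rule L2_AE_subsequence[OF l2 f2]) (rule that)
    show ?thesis
    proof (rule nn_integral_le_of_tendsto[where u="\<lambda>j x. ennreal (norm (low (k + r j) f x - low k f x) powr q)"])
      show "AE x in lborel. (\<lambda>j. ennreal (norm (low (k + r j) f x - low k f x) powr q)) \<longlonglongrightarrow> ennreal (norm (f x - low k f x) powr q)"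
        using r
      proof eventually_elim
        case (elim x)
        then show ?case
          using q by (intro tendsto_intros tendsto_powr') auto
      qed
      show "\<forall>\<^sub>F j in sequentially. (\<integral>\<^sup>+x. ennreal (norm (low (k + r j) f x - low k f x) powr q) \<partial>lborel)
          \<le> ennreal (D * ratio ^ k * sobolev_norm \<alpha> f powr q)"
        using step[OF f] by simp
    qed measurable
  qed
  then show thesis using that D by blast
qed

text \<open>Splitting at frequency 1: the tail bound with \<open>k = 0\<close> controls one part;
  the other is bounded and in L^2, so interpolation applies.\<close>

lemma sobolev_embedding:
  obtains C where "C > 0" "\<And>(f :: real ^ 'n \<Rightarrow> complex) K. f \<in> sobolev_space K \<alpha> \<Longrightarrow>
    (\<integral>\<^sup>+x. ennreal (norm (f x) powr q) \<partial>lborel) \<le> ennreal (C * sobolev_norm \<alpha> f powr q)"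
proof -
  obtain D where D: "D \<ge> 0" "\<And>(f :: real ^ 'n \<Rightarrow> complex) K k. f \<in> sobolev_space K \<alpha> \<Longrightarrow>
    (\<integral>\<^sup>+x. ennreal (norm (f x - low k f x) powr q) \<partial>lborel) \<le> ennreal (D * ratio ^ k * sobolev_norm \<alpha> f powr q)"
    by (rule low_tail_bound) (rule that)
  define B where "B = (2 * pi) powr (- real CARD('n) / 2) * sqrt (measure lborel (cball (0 :: real ^ 'n) (2 ^ 0)))"
  have B: "B \<ge> 0" by (simp add: B_def)
  define c where "c = (1/2) powr (1 - q)"
  define C where "C = c * (D + B powr (q - 2)) + 1"
  have C: "C > 0" using D(1) by (auto simp: C_def c_def intro!: add_nonneg_pos)
  have "(\<integral>\<^sup>+x. ennreal (norm (f x) powr q) \<partial>lborel) \<le> ennreal (C * sobolev_norm \<alpha> f powr q)"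
    if f: "f \<in> sobolev_space K \<alpha>" for f :: "real ^ 'n \<Rightarrow> complex" and K
  proof -
    define S where "S = sobolev_norm \<alpha> f"
    note f2 = sobolev_spaceD(1)[OF f]
    have fS: "L2.nm lborel f \<le> S" unfolding S_def using a by (intro L2_nm_le_sobolev_norm[OF f]) simp
    have S: "S \<ge> 0" by (simp add: S_def)
    have l2: "low 0 f \<in> L2 lborel" by (rule band_L2[OF _ subset_refl f2]) simp
    note [measurable] = L2_measurable[OF f2] L2_measurable[OF l2]
    have lb: "norm (low 0 f x) \<le> B * S" for x
    proof -
      have "norm (low 0 f x) \<le> B * L2.nm lborel f" unfolding B_def by (rule low_bound[OF f2])
      also have "\<dots> \<le> B * S" by (intro mult_left_mono fS B)
      finally show ?thesis .
    qed
    have "(\<integral>\<^sup>+x. ennreal (norm (low 0 f x) powr q) \<partial>lborel) \<le> ennreal ((B * S) powr (q - 2) * (L2.nm lborel (low 0 f))\<^sup>2)"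
      using q by (intro nn_integral_powr_interpolation[OF l2 lb]) auto
    also have "\<dots> \<le> ennreal ((B * S) powr (q - 2) * S\<^sup>2)"
      using order_trans[OF nm_band_le[OF _ subset_refl f2] fS, of "2 ^ 0"]
      by (intro ennreal_leI mult_left_mono power_mono) auto
    also have "(B * S) powr (q - 2) * S\<^sup>2 = B powr (q - 2) * S powr q"
      using S q B by (cases "S = 0") (auto simp: powr_mult simp flip: powr_numeral powr_add)
    finally have lo: "(\<integral>\<^sup>+x. ennreal (norm (low 0 f x) powr q) \<partial>lborel) \<le> ennreal (B powr (q - 2) * S powr q)" .
    have "(\<integral>\<^sup>+x. ennreal (norm (f x) powr q) \<partial>lborel) =
        (\<integral>\<^sup>+x. ennreal (norm ((f x - low 0 f x) + low 0 f x) powr q) \<partial>lborel)" by simp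
    also have "\<dots> \<le> ennreal ((1 - 1/2) powr (1 - q)) * (\<integral>\<^sup>+x. ennreal (norm (f x - low 0 f x) powr q) \<partial>lborel) +
        ennreal ((1/2) powr (1 - q)) * (\<integral>\<^sup>+x. ennreal (norm (low 0 f x) powr q) \<partial>lborel)"
      by (rule nn_integral_powr_add_le) (use q in simp, simp, simp, measurable)
    also have "\<dots> \<le> ennreal c * ennreal (D * ratio ^ 0 * S powr q) + ennreal c * ennreal (B powr (q - 2) * S powr q)"
      unfolding S_def using lo[unfolded S_def] by (intro add_mono mult_mono D(2)[OF f]) (auto simp: c_def)
    also have "\<dots> = ennreal (c * (D * S powr q) + c * (B powr (q - 2) * S powr q))"
      using D(1) by (simp add: ennreal_mult ennreal_plus c_def)
    also have "\<dots> \<le> ennreal (C * S powr q)"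
      by (intro ennreal_leI) (simp add: C_def algebra_simps)
    finally show ?thesis unfolding S_def .
  qed
  then show thesis using that C by blast
qed

end

section \<open>The Sobolev space as a Hilbert space\<close>

lemma weighted_fourier_measurable [measurable (raw)]:
  fixes f :: "real ^ 'n \<Rightarrow> complex"
  assumes f: "f \<in> L2 lborel"
  shows "weighted_fourier \<alpha> f \<in> borel_measurable borel"
proof -
  have [measurable]: "fourier f \<in> borel_measurable borel" using f by measurable
  show ?thesis unfolding weighted_fourier_def[abs_def] by measurable
qed

lemma weighted_fourier_add:
  fixes f g :: "real ^ 'n \<Rightarrow> complex"
  assumes "f \<in> L2 lborel" "g \<in> L2 lborel"
  shows "AE \<xi> in lborel. weighted_fourier \<alpha> (\<lambda>x. f x + g x) \<xi> = weighted_fourier \<alpha> f \<xi> + weighted_fourier \<alpha> g \<xi>"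
  using fourier_add[OF assms] by eventually_elim (simp add: weighted_fourier_def scaleR_add_right)

lemma weighted_fourier_diff:
  fixes f g :: "real ^ 'n \<Rightarrow> complex"
  assumes "f \<in> L2 lborel" "g \<in> L2 lborel"
  shows "AE \<xi> in lborel. weighted_fourier \<alpha> (\<lambda>x. f x - g x) \<xi> = weighted_fourier \<alpha> f \<xi> - weighted_fourier \<alpha> g \<xi>"
  using fourier_diff[OF assms] by eventually_elim (simp add: weighted_fourier_def scaleR_diff_right)

lemma weighted_fourier_cmult:
  fixes f :: "real ^ 'n \<Rightarrow> complex"
  assumes "f \<in> L2 lborel"
  shows "AE \<xi> in lborel. weighted_fourier \<alpha> (\<lambda>x. c * f x) \<xi> = c * weighted_fourier \<alpha> f \<xi>"
  using fourier_cmult[OF assms, of c] by eventually_elim (simp add: weighted_fourier_def)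

lemma sobolev_norm_diff:
  fixes f g :: "real ^ 'n \<Rightarrow> complex"
  assumes "f \<in> sobolev_space K \<alpha>" "g \<in> sobolev_space K \<alpha>"
  shows "sobolev_norm \<alpha> (\<lambda>x. f x - g x) = L2.nm lborel (\<lambda>\<xi>. weighted_fourier \<alpha> f \<xi> - weighted_fourier \<alpha> g \<xi>)"
proof -
  note f = sobolev_spaceD[OF assms(1)] and g = sobolev_spaceD[OF assms(2)]
  show ?thesis
    unfolding sobolev_norm_eq
    using f g L2.diff[OF f(1) g(1)] L2.diff[OF f(2) g(2)] weighted_fourier_diff[OF f(1) g(1), of \<alpha>]
    by (intro L2_nm_cong_AE) (auto dest: L2_measurable)
qed

text \<open>Translation multiplies the transform by a character of modulus 1.\<close>

lemma
  fixes f :: "real ^ 'n \<Rightarrow> complex"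
  assumes f: "f \<in> sobolev_space K \<alpha>"
  shows sobolev_space_translate: "(\<lambda>x. f (x - y)) \<in> sobolev_space K \<alpha>"
    and sobolev_norm_translate: "sobolev_norm \<alpha> (\<lambda>x. f (x - y)) = sobolev_norm \<alpha> f"
proof -
  note fD = sobolev_spaceD[OF f]
  have eq: "AE \<xi> in lborel. norm (weighted_fourier \<alpha> (\<lambda>x. f (x - y)) \<xi>) = norm (weighted_fourier \<alpha> f \<xi>)"
    using fourier_translate[OF fD(1), of y] by eventually_elim (simp add: weighted_fourier_def norm_mult)
  have m: "weighted_fourier \<alpha> (\<lambda>x. f (x - y)) \<in> borel_measurable lborel"
    using L2_translate(1)[OF fD(1)] by simp
  have "weighted_fourier \<alpha> (\<lambda>x. f (x - y)) \<in> L2 lborel"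
    by (rule L2_dominated[OF fD(2) m]) (use eq in \<open>auto elim: eventually_mono\<close>)
  then show "(\<lambda>x. f (x - y)) \<in> sobolev_space K \<alpha>"
    using fD(1,3) L2_translate(1)[OF fD(1)] by (auto simp: sobolev_space_iff)
  show "sobolev_norm \<alpha> (\<lambda>x. f (x - y)) = sobolev_norm \<alpha> f"
    unfolding sobolev_norm_eq by (rule L2_nm_cong_AE[OF m L2_measurable[OF fD(2)] eq])
qed

lemma sobolev_space_add:
  fixes f g :: "real ^ 'n \<Rightarrow> complex"
  assumes K: "K = \<real> \<or> K = UNIV" and f: "f \<in> sobolev_space K \<alpha>" and g: "g \<in> sobolev_space K \<alpha>"
  shows "(\<lambda>x. f x + g x) \<in> sobolev_space K \<alpha>"
proof -
  note fD = sobolev_spaceD[OF f] and gD = sobolev_spaceD[OF g]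
  have "weighted_fourier \<alpha> (\<lambda>x. f x + g x) \<in> L2 lborel"
    using weighted_fourier_add[OF fD(1) gD(1), of \<alpha>] L2_add[OF fD(1) gD(1)]
    by (intro L2_cong_AE[OF L2_add[OF fD(2) gD(2)]]) (auto elim: eventually_mono)
  then show ?thesis
    using K fD(1,3) gD(1,3) by (auto simp: sobolev_space_iff image_subset_iff intro: L2_add)
qed

lemma sobolev_space_cmult:
  fixes f :: "real ^ 'n \<Rightarrow> complex"
  assumes K: "K = \<real> \<or> K = UNIV" and f: "f \<in> sobolev_space K \<alpha>"
  shows "(\<lambda>x. of_real c * f x) \<in> sobolev_space K \<alpha>"
proof -
  note fD = sobolev_spaceD[OF f]
  have "weighted_fourier \<alpha> (\<lambda>x. of_real c * f x) \<in> L2 lborel"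
    using weighted_fourier_cmult[OF fD(1), of \<alpha> "of_real c"] L2_cmult[OF fD(1), of "of_real c"]
    by (intro L2_cong_AE[OF L2_cmult[OF fD(2), of "of_real c"]]) (auto elim: eventually_mono)
  then show ?thesis
    using K fD(1,3) by (auto simp: sobolev_space_iff image_subset_iff intro: L2_cmult)
qed

lemma sobolev_space_zero:
  assumes K: "K = \<real> \<or> K = UNIV"
  shows "(\<lambda>x :: real ^ 'n. 0) \<in> sobolev_space K \<alpha>"
proof -
  have z: "(\<lambda>x :: real ^ 'n. 0) \<in> L2 lborel" by (rule L2.zero)
  have "weighted_fourier \<alpha> (\<lambda>x :: real ^ 'n. 0) \<in> L2 lborel"
    using weighted_fourier_cmult[OF z, of \<alpha> 0] z
    by (intro L2_cong_AE[OF z]) (auto elim: eventually_mono)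
  then show ?thesis using K z by (auto simp: sobolev_space_iff)
qed

definition sobolev_form :: "real \<Rightarrow> (real ^ 'n \<Rightarrow> complex) \<Rightarrow> (real ^ 'n \<Rightarrow> complex) \<Rightarrow> real" where
  "sobolev_form \<alpha> f g = L2_form lborel (weighted_fourier \<alpha> f) (weighted_fourier \<alpha> g)"

lemma L2_form_cong_AE:
  assumes "f \<in> borel_measurable M" "f' \<in> borel_measurable M" "g \<in> borel_measurable M"
    and "AE x in M. f x = f' x"
  shows "L2_form M f g = L2_form M f' g"
  unfolding L2_form_def using assms by (intro integral_cong_AE) auto

lemma sobolev_real_form_space:
  assumes K: "K = \<real> \<or> K = UNIV"
  shows "real_form_space (sobolev_space K \<alpha> :: (real ^ 'n \<Rightarrow> complex) set) (sobolev_form \<alpha>)"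
proof
  fix f g h :: "real ^ 'n \<Rightarrow> complex" and c :: real
  assume f: "f \<in> sobolev_space K \<alpha>" and g: "g \<in> sobolev_space K \<alpha>"
  note fD = sobolev_spaceD[OF f] and gD = sobolev_spaceD[OF g]
  show "sobolev_form \<alpha> f g = sobolev_form \<alpha> g f"
    unfolding sobolev_form_def by (rule L2.form_sym[OF fD(2) gD(2)])
  have "sobolev_form \<alpha> (\<lambda>x. of_real c * f x) g = L2_form lborel (\<lambda>\<xi>. of_real c * weighted_fourier \<alpha> f \<xi>) (weighted_fourier \<alpha> g)"
    unfolding sobolev_form_def
    by (rule L2_form_cong_AE[OF _ _ _ weighted_fourier_cmult[OF fD(1)]])
       (use L2_cmult[OF fD(1), of "of_real c"] L2_cmult[OF fD(2), of "of_real c"] gD(2) in \<open>auto dest!: L2_measurable\<close>)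
  then show "sobolev_form \<alpha> (\<lambda>x. of_real c * f x) g = c * sobolev_form \<alpha> f g"
    by (simp add: L2.form_scale[OF fD(2) gD(2)] sobolev_form_def)
  assume h: "h \<in> sobolev_space K \<alpha>"
  note hD = sobolev_spaceD[OF h]
  have "sobolev_form \<alpha> (\<lambda>x. f x + g x) h = L2_form lborel (\<lambda>\<xi>. weighted_fourier \<alpha> f \<xi> + weighted_fourier \<alpha> g \<xi>) (weighted_fourier \<alpha> h)"
    unfolding sobolev_form_def
    by (rule L2_form_cong_AE[OF _ _ _ weighted_fourier_add[OF fD(1) gD(1)]])
       (use L2_add[OF fD(1) gD(1)] L2_add[OF fD(2) gD(2)] hD(2) in \<open>auto dest!: L2_measurable\<close>)
  then show "sobolev_form \<alpha> (\<lambda>x. f x + g x) h = sobolev_form \<alpha> f h + sobolev_form \<alpha> g h"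
    by (simp add: L2.form_add[OF fD(2) gD(2) hD(2)] sobolev_form_def)
next
  fix f :: "real ^ 'n \<Rightarrow> complex" assume f: "f \<in> sobolev_space K \<alpha>"
  show "0 \<le> sobolev_form \<alpha> f f"
    unfolding sobolev_form_def by (rule L2.form_nonneg[OF sobolev_spaceD(2)[OF f]])
qed (use K in \<open>auto intro: sobolev_space_zero sobolev_space_add sobolev_space_cmult\<close>)

lemma sobolev_norm_form: "sobolev_norm \<alpha> f = sqrt (sobolev_form \<alpha> f f)"
  unfolding sobolev_norm_eq sobolev_form_def L2.nm_def ..

text \<open>The functions and their weighted transforms are Cauchy in L^2 separately, with limits f
  and G. Dividing G by the weight gives an L^2 limit of the transforms, and Plancherel identifies it
  with \<open>fourier f\<close>. Taking f as a limit of functions with values in K keeps real spaces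
  real.\<close>

lemma sobolev_complete:
  fixes X :: "nat \<Rightarrow> real ^ 'n \<Rightarrow> complex"
  assumes K: "K = \<real> \<or> K = UNIV" and a: "\<alpha> \<ge> 0" and X: "\<And>n. X n \<in> sobolev_space K \<alpha>"
    and Cauchy: "\<And>e. e > 0 \<Longrightarrow> \<exists>N. \<forall>m\<ge>N. \<forall>n\<ge>N. sobolev_norm \<alpha> (\<lambda>x. X m x - X n x) < e"
  obtains f where "f \<in> sobolev_space K \<alpha>" "(\<lambda>n. sobolev_norm \<alpha> (\<lambda>x. X n x - f x)) \<longlonglongrightarrow> 0"
proof -
  interpret H: real_form_space "sobolev_space K \<alpha> :: (real ^ 'n \<Rightarrow> complex) set" "sobolev_form \<alpha>"
    by (rule sobolev_real_form_space[OF K])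
  note XD = sobolev_spaceD[OF X]
  have cK: "closed K" "0 \<in> K" using K closed_complex_Reals by auto
  have C2: "\<exists>N. \<forall>m\<ge>N. \<forall>n\<ge>N. L2.nm lborel (\<lambda>x. X m x - X n x) < e" if "e > 0" for e
  proof -
    have "L2.nm lborel (\<lambda>x. X m x - X n x) \<le> sobolev_norm \<alpha> (\<lambda>x. X m x - X n x)" for m n
      by (rule L2_nm_le_sobolev_norm[OF H.diff[OF X X] a])
    then show ?thesis using Cauchy[OF that] by (meson le_less_trans)
  qed
  obtain f where f: "f \<in> L2 lborel" "range f \<subseteq> K" "(\<lambda>n. L2.nm lborel (\<lambda>x. X n x - f x)) \<longlonglongrightarrow> 0"
    by (rule L2_Cauchy_convergent[OF XD(1) C2 cK XD(3)]) (assumption, rule that)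
  have Cw: "\<exists>N. \<forall>m\<ge>N. \<forall>n\<ge>N. L2.nm lborel (\<lambda>\<xi>. weighted_fourier \<alpha> (X m) \<xi> - weighted_fourier \<alpha> (X n) \<xi>) < e" if "e > 0" for e
    using Cauchy[OF that] by (simp add: sobolev_norm_diff[OF X X])
  obtain G where G: "G \<in> L2 lborel" "(\<lambda>n. L2.nm lborel (\<lambda>\<xi>. weighted_fourier \<alpha> (X n) \<xi> - G \<xi>)) \<longlonglongrightarrow> 0"
    by (rule L2_Cauchy_convergent[OF XD(2) Cw closed_UNIV UNIV_I subset_UNIV]) (assumption, rule that)
  define g where "g \<xi> = (1 + (norm \<xi>)\<^sup>2) powr (- \<alpha> / 2) *\<^sub>R G \<xi>" for \<xi>
  have inv: "(1 + (norm \<xi>)\<^sup>2) powr (- \<alpha> / 2) * (1 + (norm \<xi>)\<^sup>2) powr (\<alpha> / 2) = 1" for \<xi> :: "real ^ 'n"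
  proof -
    have "1 + (norm \<xi>)\<^sup>2 \<noteq> 0" by (smt (verit) zero_le_power2)
    then show ?thesis by (simp flip: powr_add)
  qed
  have le1: "(1 + (norm \<xi>)\<^sup>2) powr (- \<alpha> / 2) \<le> 1" for \<xi> :: "real ^ 'n"
    using powr_mono[of "- \<alpha> / 2" 0 "1 + (norm \<xi>)\<^sup>2"] a by (auto split: if_splits)
  have [measurable]: "G \<in> borel_measurable borel" using L2_measurable[OF G(1)] by simp
  have gm: "g \<in> borel_measurable borel" unfolding g_def[abs_def] by measurable
  have g: "g \<in> L2 lborel"
  proof (rule L2_dominated[OF G(1)])
    have "norm (g \<xi>) \<le> norm (G \<xi>)" for \<xi>
      using mult_left_le_one_le[OF norm_ge_zero[of "G \<xi>"] _ le1[of \<xi>]] by (simp add: g_def)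
    then show "AE \<xi> in lborel. norm (g \<xi>) \<le> norm (G \<xi>)" by simp
  qed (use gm in simp)
  have "(\<lambda>n. L2.nm lborel (\<lambda>\<xi>. fourier (X n) \<xi> - g \<xi>)) \<longlonglongrightarrow> 0"
  proof (rule Lim_null_comparison[OF always_eventually G(2)])
    have "norm (fourier (X n) \<xi> - g \<xi>) \<le> norm (weighted_fourier \<alpha> (X n) \<xi> - G \<xi>)" for n \<xi>
    proof -
      have "fourier (X n) \<xi> - g \<xi> = (1 + (norm \<xi>)\<^sup>2) powr (- \<alpha> / 2) *\<^sub>R (weighted_fourier \<alpha> (X n) \<xi> - G \<xi>)"
        unfolding g_def weighted_fourier_def scaleR_diff_right scaleR_scaleR inv by simp
      then show ?thesis
        using mult_left_le_one_le[OF norm_ge_zero[of "weighted_fourier \<alpha> (X n) \<xi> - G \<xi>"] _ le1[of \<xi>]] by simp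
    qed
    then have "L2.nm lborel (\<lambda>\<xi>. fourier (X n) \<xi> - g \<xi>) \<le> L2.nm lborel (\<lambda>\<xi>. weighted_fourier \<alpha> (X n) \<xi> - G \<xi>)" for n
      using L2_measurable[OF L2.diff[OF fourier_L2[OF XD(1)[of n]] g]]
      by (intro L2_nm_mono[OF L2.diff[OF XD(2) G(1)]]) auto
    then show "\<forall>n. norm (L2.nm lborel (\<lambda>\<xi>. fourier (X n) \<xi> - g \<xi>)) \<le> L2.nm lborel (\<lambda>\<xi>. weighted_fourier \<alpha> (X n) \<xi> - G \<xi>)"
      by simp
  qed
  moreover have "(\<lambda>n. L2.nm lborel (\<lambda>\<xi>. fourier (X n) \<xi> - fourier f \<xi>)) \<longlonglongrightarrow> 0"
  proof -
    have "L2.nm lborel (\<lambda>\<xi>. fourier (X n) \<xi> - fourier f \<xi>) = L2.nm lborel (\<lambda>x. X n x - f x)" for n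
    proof -
      have "L2.nm lborel (\<lambda>\<xi>. fourier (X n) \<xi> - fourier f \<xi>) = L2.nm lborel (fourier (\<lambda>x. X n x - f x))"
      proof (rule L2_nm_cong_AE)
        show "AE \<xi> in lborel. norm (fourier (X n) \<xi> - fourier f \<xi>) = norm (fourier (\<lambda>x. X n x - f x) \<xi>)"
          using fourier_diff[OF XD(1) f(1), of n] by eventually_elim simp
      qed (use fourier_L2[OF XD(1)[of n]] fourier_L2[OF f(1)] fourier_L2[OF L2.diff[OF XD(1)[of n] f(1)]] in \<open>auto dest!: L2_measurable\<close>)
      then show ?thesis by (simp add: plancherel[OF L2.diff[OF XD(1) f(1)]])
    qed
    then show ?thesis using f(3) by simp
  qed
  ultimately have "AE \<xi> in lborel. g \<xi> = fourier f \<xi>"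
    by (intro L2_limit_unique[OF fourier_L2[OF XD(1)] g fourier_L2[OF f(1)]]) auto
  then have GW: "AE \<xi> in lborel. G \<xi> = weighted_fourier \<alpha> f \<xi>"
  proof eventually_elim
    case (elim \<xi>)
    then have "weighted_fourier \<alpha> f \<xi> = ((1 + (norm \<xi>)\<^sup>2) powr (- \<alpha> / 2) * (1 + (norm \<xi>)\<^sup>2) powr (\<alpha> / 2)) *\<^sub>R G \<xi>"
      unfolding weighted_fourier_def elim[symmetric] by (simp add: g_def mult.commute)
    then show ?case unfolding inv by simp
  qed
  have wm: "weighted_fourier \<alpha> f \<in> borel_measurable lborel" using f(1) by simp
  have fH: "f \<in> sobolev_space K \<alpha>"
    using L2_cong_AE[OF G(1) wm GW] f by (simp add: sobolev_space_iff)
  have "sobolev_norm \<alpha> (\<lambda>x. X n x - f x) = L2.nm lborel (\<lambda>\<xi>. weighted_fourier \<alpha> (X n) \<xi> - G \<xi>)" for n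
    unfolding sobolev_norm_diff[OF X fH]
    by (rule L2_nm_cong_AE) (use GW wm L2_measurable[OF XD(2)[of n]] L2_measurable[OF G(1)] in auto)
  then show thesis using that[OF fH] G(2) by simp
qed

text \<open>A nonzero element of the space, for real and complex scalars alike; it ensures that the
  infimum is over a nonempty set.\<close>

lemma gaussian_in_sobolev_space:
  assumes K: "K = \<real> \<or> K = UNIV" and a: "\<alpha> > 0"
  shows "(\<lambda>x :: real ^ 'n. complex_of_real (gaussian x)) \<in> sobolev_space K \<alpha>"
proof -
  let ?g = "\<lambda>x :: real ^ 'n. complex_of_real (gaussian x)"
  have gi: "integrable lborel ?g"
    using integrable_gaussian_scaled[of 1, where 'a="real^'n"] by simp
  have g2: "?g \<in> L2 lborel"
  proof -
    have "integrable lborel (\<lambda>x :: real ^ 'n. (norm (?g x))\<^sup>2)"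
    proof (rule Bochner_Integration.integrable_bound[OF gi])
      show "AE x in lborel. norm ((norm (?g x))\<^sup>2) \<le> norm (?g x)"
        using mult_left_le[OF gaussian_le_1 gaussian_nonneg] by (intro AE_I2) (simp add: power2_eq_square)
    qed measurable
    then show ?thesis by (simp add: L2_def)
  qed
  have F: "fourier_integral ?g \<xi> = ?g \<xi>" for \<xi>
    using fourier_integral_gaussian_scaled[of 1 \<xi>] by simp
  have ae: "AE \<xi> in lborel. fourier ?g \<xi> = ?g \<xi>"
    using fourier_eq_fourier_integral[OF gi g2] by (simp only: F)
  define h where "h \<xi> = complex_of_real ((2 * \<alpha>) powr (\<alpha> / 2) * exp (1/4) * exp (- (norm \<xi>)\<^sup>2 / 4))" for \<xi> :: "real ^ 'n"
  have h2: "h \<in> L2 lborel"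
  proof -
    have "(norm (h \<xi>))\<^sup>2 = ((2 * \<alpha>) powr (\<alpha> / 2) * exp (1/4))\<^sup>2 * gaussian \<xi>" for \<xi>
      unfolding h_def norm_of_real power2_abs power_mult_distrib gaussian_def
      by (simp add: exp_double[symmetric])
    then have "integrable lborel (\<lambda>\<xi>. (norm (h \<xi>))\<^sup>2)"
      by (simp add: integrable_gaussian)
    moreover have "h \<in> borel_measurable lborel" unfolding h_def[abs_def] by measurable
    ultimately show ?thesis by (simp add: L2_def)
  qed
  \<comment> \<open>From y \<le> exp y at y = (1 + s) / (2 \<alpha>), raised to the power \<alpha> /
    2, the weight costs only exp ((1 + s) / 4). The remaining factor exp (- s / 4) has
    \<open>gaussian\<close> as its square.\<close>
  have bound: "(1 + s) powr (\<alpha> / 2) * exp (- s / 2) \<le> (2 * \<alpha>) powr (\<alpha> / 2) * exp (1/4) * exp (- s / 4)" if "s \<ge> 0" for s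
  proof -
    have "(1 + s) / (2 * \<alpha>) \<le> exp ((1 + s) / (2 * \<alpha>))"
      using exp_ge_add_one_self[of "(1 + s) / (2 * \<alpha>)"] by linarith
    then have "((1 + s) / (2 * \<alpha>)) powr (\<alpha> / 2) \<le> exp ((1 + s) / (2 * \<alpha>)) powr (\<alpha> / 2)"
      using a that by (intro powr_mono2) auto
    also have "\<dots> = exp ((1 + s) / 4)"
      using a by (simp add: exp_powr_real)
    finally have "(1 + s) powr (\<alpha> / 2) \<le> (2 * \<alpha>) powr (\<alpha> / 2) * exp ((1 + s) / 4)"
      using a that by (simp add: powr_divide field_simps)
    then have "(1 + s) powr (\<alpha> / 2) * exp (- s / 2) \<le> (2 * \<alpha>) powr (\<alpha> / 2) * exp ((1 + s) / 4) * exp (- s / 2)"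
      by (rule mult_right_mono) simp
    also have "\<dots> = (2 * \<alpha>) powr (\<alpha> / 2) * (exp ((1 + s) / 4) * exp (- s / 2))" by simp
    also have "exp ((1 + s) / 4) * exp (- s / 2) = exp (1/4) * exp (- s / 4)"
      by (simp add: exp_add[symmetric] field_simps)
    finally show ?thesis by simp
  qed
  have "AE \<xi> in lborel. norm (weighted_fourier \<alpha> ?g \<xi>) \<le> norm (h \<xi>)"
    using ae
  proof eventually_elim
    case (elim \<xi>)
    have "norm (weighted_fourier \<alpha> ?g \<xi>) = (1 + (norm \<xi>)\<^sup>2) powr (\<alpha> / 2) * exp (- (norm \<xi>)\<^sup>2 / 2)"
      by (simp add: weighted_fourier_def elim) (simp add: gaussian_def)
    then show ?case
      using bound[of "(norm \<xi>)\<^sup>2"] unfolding h_def norm_of_real by simp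
  qed
  then have "weighted_fourier \<alpha> ?g \<in> L2 lborel"
    using g2 by (intro L2_dominated[OF h2]) auto
  then show ?thesis using K g2 by (auto simp: sobolev_space_iff)
qed

section \<open>Local convergence and mass splitting\<close>

text \<open>Frequencies are at most 2^k, and \<bar>exp (i a) - 1\<bar> \<le> \<bar>a\<bar>. Because
  the constant depends on f only through its L^2 norm, values at moving points can be compared with
  values at their limit along a bounded sequence.\<close>

lemma low_Lipschitz:
  obtains L where "L \<ge> 0" "\<And>(f :: real ^ 'n \<Rightarrow> complex) x y. f \<in> L2 lborel \<Longrightarrow>
    norm (low k f x - low k f y) \<le> L * norm (x - y) * L2.nm lborel f"
proof -
  define E where "E = cball (0 :: real ^ 'n) (2 ^ k)"
  have E: "E \<in> sets borel" "emeasure lborel E < \<infinity>" "E \<subseteq> cball 0 (2 ^ k)"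
    using emeasure_cball_less_top[of "2 ^ k", where ?'a="real ^ 'n"] by (auto simp: E_def)
  define c where "c = (2 * pi) powr (- real CARD('n) / 2)"
  define L where "L = c * (2 ^ k * sqrt (measure lborel E))"
  have c: "c \<ge> 0" by (simp add: c_def)
  have L: "L \<ge> 0" by (simp add: L_def c_def)
  have "norm (low k f x - low k f y) \<le> L * norm (x - y) * L2.nm lborel f"
    if f: "f \<in> L2 lborel" for f :: "real ^ 'n \<Rightarrow> complex" and x y
  proof -
    define g where "g \<xi> = indicator E \<xi> *\<^sub>R fourier f \<xi>" for \<xi>
    have g2: "g \<in> L2 lborel" and gn: "L2.nm lborel g \<le> L2.nm lborel f"
      unfolding g_def using L2_restrict[OF fourier_L2[OF f], of E] E plancherel[OF f] by auto
    have g0: "\<xi> \<notin> E \<Longrightarrow> g \<xi> = 0" for \<xi> by (simp add: g_def)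
    have g1: "integrable lborel g" "(LINT \<xi>|lborel. norm (g \<xi>)) \<le> sqrt (measure lborel E) * L2.nm lborel g"
      using L2_indicator_integral[OF g2 _ E(2) g0] E(1) by auto
    let ?e = "\<lambda>z \<xi>. exp (- (\<i> * complex_of_real (\<xi> \<bullet> (- z))))"
    have le: "norm (?e x \<xi> * g \<xi> - ?e y \<xi> * g \<xi>) \<le> 2 ^ k * norm (x - y) * norm (g \<xi>)" for \<xi>
    proof (cases "\<xi> \<in> E")
      case True
      have "?e x \<xi> = ?e y \<xi> * iexp (\<xi> \<bullet> (x - y))"
        by (simp add: inner_diff_right algebra_simps flip: exp_add)
      then have "?e x \<xi> * g \<xi> - ?e y \<xi> * g \<xi> = ?e y \<xi> * (iexp (\<xi> \<bullet> (x - y)) - 1) * g \<xi>"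
        by (simp add: algebra_simps)
      then have "norm (?e x \<xi> * g \<xi> - ?e y \<xi> * g \<xi>) = norm (iexp (\<xi> \<bullet> (x - y)) - 1) * norm (g \<xi>)"
        by (simp only: norm_mult norm_character mult_1_left)
      also have "\<dots> \<le> \<bar>\<xi> \<bullet> (x - y)\<bar> * norm (g \<xi>)"
        using iexp_approx1[of "\<xi> \<bullet> (x - y)" 0] by (intro mult_right_mono) auto
      also have "\<dots> \<le> (norm \<xi> * norm (x - y)) * norm (g \<xi>)"
        by (intro mult_right_mono Cauchy_Schwarz_ineq2) simp
      also have "\<dots> \<le> (2 ^ k * norm (x - y)) * norm (g \<xi>)"
        using True by (intro mult_right_mono) (auto simp: E_def)
      finally show ?thesis .
    qed (simp add: g0)
    have "norm ((LINT \<xi>|lborel. ?e x \<xi> * g \<xi>) - (LINT \<xi>|lborel. ?e y \<xi> * g \<xi>)) =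
        norm (LINT \<xi>|lborel. ?e x \<xi> * g \<xi> - ?e y \<xi> * g \<xi>)"
      by (simp only: Bochner_Integration.integral_diff[OF integrable_character_mult[OF g1(1)] integrable_character_mult[OF g1(1)]])
    also have "\<dots> \<le> (LINT \<xi>|lborel. 2 ^ k * norm (x - y) * norm (g \<xi>))"
    proof (rule order_trans[OF integral_norm_bound integral_mono])
      show "integrable lborel (\<lambda>\<xi>. norm (?e x \<xi> * g \<xi> - ?e y \<xi> * g \<xi>))"
        by (intro integrable_norm Bochner_Integration.integrable_diff integrable_character_mult g1(1))
    qed (use le g1(1) in auto)
    also have "\<dots> \<le> 2 ^ k * norm (x - y) * (sqrt (measure lborel E) * L2.nm lborel f)"
      using g1(2) mult_left_mono[OF gn, of "sqrt (measure lborel E)"]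
      by (subst integral_mult_right_zero) (intro mult_left_mono, auto)
    finally have *: "norm ((LINT \<xi>|lborel. ?e x \<xi> * g \<xi>) - (LINT \<xi>|lborel. ?e y \<xi> * g \<xi>)) \<le>
      2 ^ k * norm (x - y) * (sqrt (measure lborel E) * L2.nm lborel f)" .
    have "low k f x - low k f y = of_real c * ((LINT \<xi>|lborel. ?e x \<xi> * g \<xi>) - (LINT \<xi>|lborel. ?e y \<xi> * g \<xi>))"
      unfolding band_def fourier_integral_def c_def g_def E_def by (simp only: right_diff_distrib)
    then have "norm (low k f x - low k f y) = c * norm ((LINT \<xi>|lborel. ?e x \<xi> * g \<xi>) - (LINT \<xi>|lborel. ?e y \<xi> * g \<xi>))"
      using c by (simp only: norm_mult norm_of_real abs_of_nonneg)
    also have "\<dots> \<le> c * (2 ^ k * norm (x - y) * (sqrt (measure lborel E) * L2.nm lborel f))"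
      by (rule mult_left_mono[OF * c])
    finally show ?thesis unfolding L_def by (simp only: mult_ac)
  qed
  then show thesis using that L by blast
qed

text \<open>The q-th power of \<open>Lq_norm\<close>; masses, unlike norms, add up when a function
  is split.\<close>

definition Lq_mass :: "real \<Rightarrow> (real ^ 'n \<Rightarrow> complex) \<Rightarrow> real" where
  "Lq_mass q f = (LINT x|lborel. norm (f x) powr q)"

lemma Lq_mass_nonneg [simp]: "0 \<le> Lq_mass q f"
  unfolding Lq_mass_def by (intro integral_nonneg_AE) simp

lemma Lq_norm_eq_1_iff: "q > 0 \<Longrightarrow> Lq_norm q f = 1 \<longleftrightarrow> Lq_mass q f = 1"
proof
  assume q: "q > 0" and "Lq_norm q f = 1"
  then have "(Lq_mass q f powr (1 / q)) powr q = 1" by (simp add: Lq_norm_def Lq_mass_def)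
  then show "Lq_mass q f = 1" using q by (simp add: powr_powr)
qed (simp add: Lq_norm_def Lq_mass_def)

lemma Lq_mass_cmult: "Lq_mass q (\<lambda>x. c * f x) = norm c powr q * Lq_mass q f"
  unfolding Lq_mass_def by (simp add: norm_mult powr_mult)

lemma Lq_mass_translate:
  assumes [measurable]: "f \<in> borel_measurable borel"
  shows "Lq_mass q (\<lambda>x. f (x - y)) = Lq_mass q f"
proof -
  have eq: "Lq_mass q g = Re (LINT x|lborel. complex_of_real (norm (g x) powr q))" for g
    unfolding Lq_mass_def by (subst integral_complex_of_real) simp
  show ?thesis
    unfolding eq using lborel_affine_integral[of "\<lambda>x. complex_of_real (norm (f x) powr q)" 1 "-y"] by simp
qed

lemma integrable_of_nn_integral_le:
  fixes f :: "'a \<Rightarrow> real"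
  assumes "f \<in> borel_measurable M" "\<And>x. 0 \<le> f x" "(\<integral>\<^sup>+x. ennreal (f x) \<partial>M) \<le> ennreal B" "0 \<le> B"
  shows "integrable M f" "(LINT x|M. f x) \<le> B"
proof -
  show i: "integrable M f"
    using assms by (intro integrableI_bounded) (auto intro: le_less_trans[OF _ ennreal_less_top])
  have "ennreal (LINT x|M. f x) \<le> ennreal B"
    using nn_integral_eq_integral[OF i] assms by simp
  then show "(LINT x|M. f x) \<le> B" using assms(4) by (simp add: ennreal_le_iff)
qed

text \<open>\<open>H.nm\<close> stands for the given norm. Equivalence imports completeness and the
  L^q estimates from \<open>sobolev_norm\<close>, while weak limits and the expansion of squares use
  \<open>b\<close> itself, as it is this norm that is minimized.\<close>

locale minimization = subcritical \<alpha> q dim + H: real_form_space "sobolev_space K \<alpha>" b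
  for \<alpha> q :: real and dim :: "'n::finite itself" and K :: "complex set"
    and b :: "(real ^ 'n \<Rightarrow> complex) \<Rightarrow> (real ^ 'n \<Rightarrow> complex) \<Rightarrow> real" +
  fixes c C :: real
  assumes K: "K = \<real> \<or> K = UNIV" and c: "c > 0" and C: "C > 0"
    and lower: "\<And>u. u \<in> sobolev_space K \<alpha> \<Longrightarrow> c * sobolev_norm \<alpha> u \<le> H.nm u"
    and upper: "\<And>u. u \<in> sobolev_space K \<alpha> \<Longrightarrow> H.nm u \<le> C * sobolev_norm \<alpha> u"
    and invariant: "\<And>u y. u \<in> sobolev_space K \<alpha> \<Longrightarrow> (\<And>i. y $ i \<in> \<int>) \<Longrightarrow> H.nm (\<lambda>x. u (x - y)) = H.nm u"
begin

abbreviation "V \<equiv> sobolev_space K \<alpha> :: (real ^ 'n \<Rightarrow> complex) set"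

lemma sobolev_le_nm: "u \<in> V \<Longrightarrow> sobolev_norm \<alpha> u \<le> H.nm u / c"
  using lower[of u] c by (simp add: field_simps)

lemma V_measurable: "u \<in> V \<Longrightarrow> u \<in> borel_measurable borel"
  using L2_measurable[OF sobolev_spaceD(1)[of u K \<alpha>]] by simp

lemma L2_le_nm: "u \<in> V \<Longrightarrow> L2.nm lborel u \<le> H.nm u / c"
  using sobolev_le_nm[of u] L2_nm_le_sobolev_norm[of u K \<alpha>] a by auto

lemma complete: H.complete_form
  unfolding H.complete_form_def
proof safe
  fix X :: "nat \<Rightarrow> real ^ 'n \<Rightarrow> complex"
  assume X: "\<forall>n. X n \<in> V" and Cauchy: "\<forall>e>0. \<exists>N. \<forall>m\<ge>N. \<forall>n\<ge>N. H.nm (\<lambda>x. X m x - X n x) < e"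
  have X: "X n \<in> V" for n using X by blast
  have C': "\<exists>N. \<forall>m\<ge>N. \<forall>n\<ge>N. sobolev_norm \<alpha> (\<lambda>x. X m x - X n x) < e" if "e > 0" for e
  proof -
    have "c * e > 0" using c that by simp
    from Cauchy[rule_format, OF this]
    obtain N where N: "\<And>m n. m \<ge> N \<Longrightarrow> n \<ge> N \<Longrightarrow> H.nm (\<lambda>x. X m x - X n x) < c * e"
      by auto
    have "sobolev_norm \<alpha> (\<lambda>x. X m x - X n x) < e" if "m \<ge> N" "n \<ge> N" for m n
    proof -
      have "c * sobolev_norm \<alpha> (\<lambda>x. X m x - X n x) < c * e"
        using lower[OF H.diff[OF X X], of m n] N[OF that] by linarith
      then show ?thesis using c by simp
    qed
    then show ?thesis by blast
  qed
  have "\<alpha> \<ge> 0" using a by simp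
  then obtain f where f: "f \<in> V" "(\<lambda>n. sobolev_norm \<alpha> (\<lambda>x. X n x - f x)) \<longlonglongrightarrow> 0"
    by (rule sobolev_complete[OF K _ X C']) (assumption, rule that)
  have "(\<lambda>n. H.nm (\<lambda>x. X n x - f x)) \<longlonglongrightarrow> 0"
  proof (rule Lim_null_comparison[OF always_eventually])
    show "(\<lambda>n. C * sobolev_norm \<alpha> (\<lambda>x. X n x - f x)) \<longlonglongrightarrow> 0"
      using tendsto_mult_left[OF f(2), of C] by simp
    show "\<forall>n. norm (H.nm (\<lambda>x. X n x - f x)) \<le> C * sobolev_norm \<alpha> (\<lambda>x. X n x - f x)"
      using upper[OF H.diff[OF X f(1)]] H.nm_nonneg[OF H.diff[OF X f(1)]] by simp
  qed
  then show "\<exists>f\<in>V. (\<lambda>n. H.nm (\<lambda>x. X n x - f x)) \<longlonglongrightarrow> 0" using f(1) by blast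
qed

lemma Lq_bound:
  obtains C0 where "C0 > 0" "\<And>u. u \<in> V \<Longrightarrow> integrable lborel (\<lambda>x. norm (u x) powr q)"
    "\<And>u. u \<in> V \<Longrightarrow> Lq_mass q u \<le> C0 * H.nm u powr q"
proof -
  obtain C1 where C1: "C1 > 0" "\<And>(f :: real ^ 'n \<Rightarrow> complex) K. f \<in> sobolev_space K \<alpha> \<Longrightarrow>
    (\<integral>\<^sup>+x. ennreal (norm (f x) powr q) \<partial>lborel) \<le> ennreal (C1 * sobolev_norm \<alpha> f powr q)"
    by (rule sobolev_embedding) (rule that)
  define C0 where "C0 = C1 / c powr q"
  have C0: "C0 > 0" using C1(1) c by (simp add: C0_def)
  have "integrable lborel (\<lambda>x. norm (u x) powr q) \<and> Lq_mass q u \<le> C0 * H.nm u powr q" if u: "u \<in> V" for u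
  proof -
    have [measurable]: "u \<in> borel_measurable borel" by (rule V_measurable[OF u])
    have "C1 * sobolev_norm \<alpha> u powr q \<le> C1 * (H.nm u / c) powr q"
      using sobolev_le_nm[OF u] q C1(1) by (intro mult_left_mono powr_mono2) auto
    also have "\<dots> = C0 * H.nm u powr q"
      using H.nm_nonneg[OF u] c by (simp add: C0_def powr_divide)
    finally have "ennreal (C1 * sobolev_norm \<alpha> u powr q) \<le> ennreal (C0 * H.nm u powr q)"
      by (rule ennreal_leI)
    then have "(\<integral>\<^sup>+x. ennreal (norm (u x) powr q) \<partial>lborel) \<le> ennreal (C0 * H.nm u powr q)"
      using C1(2)[OF u] by (rule order_trans[rotated])
    note le = this
    have "0 \<le> C0 * H.nm u powr q" using C0 by simp
    note r = integrable_of_nn_integral_le[OF _ _ le this]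
    show ?thesis
      unfolding Lq_mass_def by (intro conjI r) auto
  qed
  then show thesis using that C0 by blast
qed

lemma Lq_integrable: "u \<in> V \<Longrightarrow> integrable lborel (\<lambda>x. norm (u x) powr q)"
  by (rule Lq_bound) blast

lemma low_in_L2: "u \<in> V \<Longrightarrow> low k u \<in> L2 lborel"
  by (rule band_L2[OF _ subset_refl sobolev_spaceD(1)]) auto

lemma tail_bound:
  obtains D where "D \<ge> 0" "\<And>u k. u \<in> V \<Longrightarrow> integrable lborel (\<lambda>x. norm (u x - low k u x) powr q)"
    "\<And>u k. u \<in> V \<Longrightarrow> Lq_mass q (\<lambda>x. u x - low k u x) \<le> D * ratio ^ k * H.nm u powr q"
proof -
  obtain D1 where D1: "D1 \<ge> 0" "\<And>(f :: real ^ 'n \<Rightarrow> complex) K k. f \<in> sobolev_space K \<alpha> \<Longrightarrow>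
    (\<integral>\<^sup>+x. ennreal (norm (f x - low k f x) powr q) \<partial>lborel) \<le> ennreal (D1 * ratio ^ k * sobolev_norm \<alpha> f powr q)"
    by (rule low_tail_bound) (rule that)
  define D where "D = D1 / c powr q"
  have D: "D \<ge> 0" using D1(1) c by (simp add: D_def)
  have "integrable lborel (\<lambda>x. norm (u x - low k u x) powr q) \<and>
      Lq_mass q (\<lambda>x. u x - low k u x) \<le> D * ratio ^ k * H.nm u powr q" if u: "u \<in> V" for u k
  proof -
    have [measurable]: "u \<in> borel_measurable borel" "low k u \<in> borel_measurable borel"
      using V_measurable[OF u] L2_measurable[OF low_in_L2[OF u]] by auto
    have "D1 * ratio ^ k * sobolev_norm \<alpha> u powr q \<le> D1 * ratio ^ k * (H.nm u / c) powr q"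
      using sobolev_le_nm[OF u] q D1(1) ratio by (intro mult_left_mono powr_mono2) auto
    also have "\<dots> = D * ratio ^ k * H.nm u powr q"
      using H.nm_nonneg[OF u] c by (simp add: D_def powr_divide)
    finally have "ennreal (D1 * ratio ^ k * sobolev_norm \<alpha> u powr q) \<le> ennreal (D * ratio ^ k * H.nm u powr q)"
      by (rule ennreal_leI)
    then have "(\<integral>\<^sup>+x. ennreal (norm (u x - low k u x) powr q) \<partial>lborel) \<le> ennreal (D * ratio ^ k * H.nm u powr q)"
      using D1(2)[OF u] by (rule order_trans[rotated])
    note le = this
    have "0 \<le> D * ratio ^ k * H.nm u powr q" using D ratio by simp
    note r = integrable_of_nn_integral_le[OF _ _ le this]
    show ?thesis
      unfolding Lq_mass_def by (intro conjI r) auto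
  qed
  then show thesis using that D by blast
qed

text \<open>This is how weak convergence becomes convergence of the low frequencies at each single
  point. Real and imaginary parts occur separately because functionals are real-valued.\<close>

lemma low_functional:
  shows "H.bounded_functional (\<lambda>u. Re (low k u x))" "H.bounded_functional (\<lambda>u. Im (low k u x))"
proof -
  define B where "B = (2 * pi) powr (- real CARD('n) / 2) * sqrt (measure lborel (cball (0 :: real ^ 'n) (2 ^ k)))"
  have bound: "norm (low k u x) \<le> B / c * H.nm u" if u: "u \<in> V" for u
  proof -
    have "norm (low k u x) \<le> B * L2.nm lborel u"
      unfolding B_def by (rule low_bound[OF sobolev_spaceD(1)[OF u]])
    also have "\<dots> \<le> B * (H.nm u / c)"
      using L2_le_nm[OF u] by (intro mult_left_mono) (auto simp: B_def)
    finally show ?thesis by simp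
  qed
  have add: "low k (\<lambda>x. u x + v x) x = low k u x + low k v x" if "u \<in> V" "v \<in> V" for u v
    using that by (intro band_add[OF _ subset_refl]) (auto dest: sobolev_spaceD)
  have scale: "low k (\<lambda>x. of_real r * u x) x = of_real r * low k u x" if "u \<in> V" for u r
    using that by (intro band_cmult[OF _ subset_refl]) (auto dest: sobolev_spaceD)
  have bR: "\<bar>Re (low k u x)\<bar> \<le> B / c * H.nm u" and bI: "\<bar>Im (low k u x)\<bar> \<le> B / c * H.nm u" if "u \<in> V" for u
    using bound[OF that] abs_Re_le_cmod[of "low k u x"] abs_Im_le_cmod[of "low k u x"] by linarith+
  show "H.bounded_functional (\<lambda>u. Re (low k u x))" "H.bounded_functional (\<lambda>u. Im (low k u x))"
    unfolding H.bounded_functional_def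
    by (intro conjI ballI allI exI[of _ "B / c"], simp add: add, simp add: scale, erule bR)
       (intro conjI ballI allI exI[of _ "B / c"], simp add: add, simp add: scale, erule bI)
qed

text \<open>Low frequencies converge pointwise and boundedly, and high frequencies are uniformly small
  in \<open>L\<^sup>q\<close>: this replaces the local compactness of the embedding (Rellich).\<close>

lemma local_convergence:
  assumes X: "\<And>n. X n \<in> V" and B: "\<And>n. H.nm (X n) \<le> B"
    and lim: "\<And>k x. (\<lambda>n. low k (X n) x) \<longlonglongrightarrow> 0"
  shows "(\<lambda>n. LINT x|lborel. indicator (cball 0 R) x * norm (X n x) powr q) \<longlonglongrightarrow> 0"
proof (rule LIMSEQ_I)
  fix e :: real assume e: "e > 0"
  obtain D where D: "D \<ge> 0" "\<And>u k. u \<in> V \<Longrightarrow> integrable lborel (\<lambda>x. norm (u x - low k u x) powr q)"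
    "\<And>u k. u \<in> V \<Longrightarrow> Lq_mass q (\<lambda>x. u x - low k u x) \<le> D * ratio ^ k * H.nm u powr q"
    by (rule tail_bound) (rule that)
  have B0: "B \<ge> 0" using H.nm_nonneg[OF X[of 0]] B[of 0] by linarith
  define c2 where "c2 = (1/2 :: real) powr (1 - q)"
  have c2: "c2 > 0" by (simp add: c2_def)
  have "(\<lambda>k. c2 * (D * ratio ^ k * B powr q)) \<longlonglongrightarrow> c2 * (D * 0 * B powr q)"
    using ratio by (intro tendsto_intros LIMSEQ_realpow_zero) auto
  then have "(\<lambda>k. c2 * (D * ratio ^ k * B powr q)) \<longlonglongrightarrow> 0" by simp
  \<comment> \<open>The tail estimate is uniform along the sequence, so k can be fixed before n;
    dominated convergence on the ball is then needed for this one k only.\<close>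
  from order_tendstoD(2)[OF this, of "e / 2"] e obtain k where k: "c2 * (D * ratio ^ k * B powr q) < e / 2"
    by (auto simp: eventually_sequentially)
  define M where "M = (2 * pi) powr (- real CARD('n) / 2) * sqrt (measure lborel (cball (0 :: real ^ 'n) (2 ^ k))) * (B / c)"
  have lowM: "norm (low k (X n) x) \<le> M" for n x
  proof -
    have "norm (low k (X n) x) \<le> (2 * pi) powr (- real CARD('n) / 2) *
        sqrt (measure lborel (cball (0 :: real ^ 'n) (2 ^ k))) * L2.nm lborel (X n)"
      by (rule low_bound[OF sobolev_spaceD(1)[OF X]])
    also have "\<dots> \<le> M"
      unfolding M_def using L2_le_nm[OF X, of n] divide_right_mono[OF B[of n], of c] c
      by (intro mult_left_mono) auto
    finally show ?thesis .
  qed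
  have [measurable]: "X n \<in> borel_measurable borel" "low k (X n) \<in> borel_measurable borel" for n
    using V_measurable[OF X] L2_measurable[OF low_in_L2[OF X]] by auto
  have [measurable]: "cball (0 :: real ^ 'n) R \<in> sets borel" by simp
  let ?l = "\<lambda>n x. indicator (cball 0 R) x * norm (low k (X n) x) powr q :: real"
  have dom: "integrable lborel (\<lambda>x :: real ^ 'n. indicator (cball 0 R) x * M powr q)"
    using integrable_indicator_cball[of R, where 'a="real ^ 'n"] by simp
  have ldom: "norm (?l n x) \<le> indicator (cball 0 R) x * M powr q" for n x
    using powr_mono2[OF _ norm_ge_zero lowM[of n x], of q] q by (auto simp: indicator_def)
  have lint: "integrable lborel (?l n)" for n
    by (rule Bochner_Integration.integrable_bound[OF dom])
       (measurable, use order_trans[OF ldom abs_ge_self] in auto)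
  have "(\<lambda>n. LINT x|lborel. ?l n x) \<longlonglongrightarrow> (LINT (x :: real ^ 'n)|lborel. (0 :: real))"
  proof (rule integral_dominated_convergence[OF _ _ dom])
    have "(\<lambda>n. ?l n x) \<longlonglongrightarrow> indicator (cball 0 R) x * norm (0 :: complex) powr q" for x
      using q by (intro tendsto_intros tendsto_powr' lim) auto
    then show "AE x in lborel. (\<lambda>n. ?l n x) \<longlonglongrightarrow> 0" using q by simp
  qed (measurable, use ldom in auto)
  then have "(\<lambda>n. c2 * (LINT x|lborel. ?l n x)) \<longlonglongrightarrow> 0"
    using tendsto_mult_left[of "\<lambda>n. LINT x|lborel. ?l n x" 0 sequentially c2] by simp
  from LIMSEQ_D[OF this, of "e / 2"] obtain N where N: "\<And>n. n \<ge> N \<Longrightarrow> \<bar>c2 * (LINT x|lborel. ?l n x)\<bar> < e / 2"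
    using e by auto
  have main: "(LINT x|lborel. indicator (cball 0 R) x * norm (X n x) powr q) \<le>
      c2 * (D * ratio ^ k * B powr q) + c2 * (LINT x|lborel. ?l n x)" for n
  proof -
    have pw: "indicator (cball 0 R) x * norm (X n x) powr q \<le>
        c2 * norm (X n x - low k (X n) x) powr q + c2 * ?l n x" for x
      using norm_add_powr_le[of q "1/2" "X n x - low k (X n) x" "low k (X n) x"] q c2
      by (auto simp: indicator_def c2_def)
    have "(LINT x|lborel. indicator (cball 0 R) x * norm (X n x) powr q) \<le>
        (LINT x|lborel. c2 * norm (X n x - low k (X n) x) powr q + c2 * ?l n x)"
    proof (rule integral_mono)
      show "integrable lborel (\<lambda>x. indicator (cball 0 R) x * norm (X n x) powr q)"
        by (rule Bochner_Integration.integrable_bound[OF Lq_integrable[OF X[of n]]]) (auto simp: indicator_def)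
      show "integrable lborel (\<lambda>x. c2 * norm (X n x - low k (X n) x) powr q + c2 * ?l n x)"
        by (intro Bochner_Integration.integrable_add integrable_mult_right D(2)[OF X] lint)
    qed (rule pw)
    also have "\<dots> = c2 * Lq_mass q (\<lambda>x. X n x - low k (X n) x) + c2 * (LINT x|lborel. ?l n x)"
      unfolding Lq_mass_def using D(2)[OF X, of n k] lint[of n]
      by (subst Bochner_Integration.integral_add) (auto intro: integrable_mult_right)
    also have "Lq_mass q (\<lambda>x. X n x - low k (X n) x) \<le> D * ratio ^ k * B powr q"
    proof -
      have "H.nm (X n) powr q \<le> B powr q" using q by (intro powr_mono2 B H.nm_nonneg X) auto
      then show ?thesis using D(3)[OF X, of n k] D(1) ratio
        by (meson mult_left_mono mult_nonneg_nonneg order_trans zero_le_power less_imp_le)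
    qed
    finally show ?thesis using c2 by simp
  qed
  have "\<bar>LINT x|lborel. indicator (cball 0 R) x * norm (X n x) powr q\<bar> < e" if "n \<ge> N" for n
  proof -
    have "0 \<le> (LINT x|lborel. indicator (cball 0 R) x * norm (X n x) powr q)"
      by (intro integral_nonneg_AE) simp
    then show ?thesis using main[of n] k N[OF that] by linarith
  qed
  then show "\<exists>N. \<forall>n\<ge>N. norm ((LINT x|lborel. indicator (cball 0 R) x * norm (X n x) powr q) - 0) < e"
    by auto
qed

text \<open>The half of the Brezis--Lieb lemma that the minimization argument uses.\<close>

lemma mass_splitting:
  assumes U: "\<And>n. U n \<in> V" and f: "f \<in> V" and B: "\<And>n. H.nm (\<lambda>x. U n x - f x) \<le> B"
    and lim: "\<And>k x. (\<lambda>n. low k (\<lambda>x. U n x - f x) x) \<longlonglongrightarrow> 0" and e: "e > 0"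
  shows "\<forall>\<^sub>F n in sequentially. Lq_mass q (U n) \<le> Lq_mass q f + Lq_mass q (\<lambda>x. U n x - f x) + e"
proof -
  obtain C0 where C0: "C0 > 0" "\<And>u. u \<in> V \<Longrightarrow> integrable lborel (\<lambda>x. norm (u x) powr q)"
    "\<And>u. u \<in> V \<Longrightarrow> Lq_mass q u \<le> C0 * H.nm u powr q"
    by (rule Lq_bound) (rule that)
  have W: "(\<lambda>x. U n x - f x) \<in> V" for n by (rule H.diff[OF U f])
  \<comment> \<open>M bounds the masses of f and of \<open>U n - f\<close> together, for all n, so
    the factor (1 - t)^(1-q) in front of them costs at most e / 3 once t is small.\<close>
  define M where "M = Lq_mass q f + C0 * B powr q"
  have Wm: "Lq_mass q (\<lambda>x. U n x - f x) \<le> C0 * B powr q" for n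
  proof -
    have "H.nm (\<lambda>x. U n x - f x) powr q \<le> B powr q"
      using q by (intro powr_mono2 B H.nm_nonneg W) auto
    then show ?thesis using C0(3)[OF W, of n] C0(1) by (meson mult_left_mono order_trans less_imp_le)
  qed
  have "((\<lambda>t. ((1 - t) powr (1 - q) - 1) * M) \<longlongrightarrow> ((1 - 0) powr (1 - q) - 1) * M) (at_right 0)"
    by (intro tendsto_intros) auto
  then have "\<forall>\<^sub>F t in at_right (0::real). ((1 - t) powr (1 - q) - 1) * M < e / 3"
    using e by (intro order_tendstoD(2)) auto
  moreover have "\<forall>\<^sub>F t in at_right (0::real). t < 1" "\<forall>\<^sub>F t in at_right (0::real). 0 < t"
    by (auto simp: eventually_at_right_less intro: eventually_at_rightI[of 0 1])
  ultimately have "\<forall>\<^sub>F t in at_right (0::real). ((1 - t) powr (1 - q) - 1) * M < e / 3 \<and> t < 1 \<and> 0 < t"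
    by eventually_elim auto
  \<comment> \<open>From here t is fixed. The complementary factor t^(1-q) may be huge, but it will
    meet only two small quantities: f outside a large ball, chosen next, and \<open>U n - f\<close>
    inside that ball, for late n.\<close>
  then obtain t where t: "((1 - t) powr (1 - q) - 1) * M < e / 3" "0 < t" "t < 1"
    using eventually_happens[of _ "at_right (0::real)"] by (auto simp: trivial_limit_at_right_real)
  define A where "A = (1 - t) powr (1 - q)"
  define T where "T = t powr (1 - q)"
  have T: "T > 0" using t by (simp add: T_def)
  have A1: "A \<ge> 1"
    using powr_mono'[of "1 - q" 0 "1 - t"] t q by (simp add: A_def)
  have [measurable]: "cball (0 :: real ^ 'n) R \<in> sets borel" for R by simp
  have [measurable]: "f \<in> borel_measurable borel" "U n \<in> borel_measurable borel" for n
    using V_measurable f U by auto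
  have "(\<lambda>m. LINT x|lborel. indicator (- cball 0 (real m)) x * norm (f x) powr q) \<longlonglongrightarrow> (LINT (x :: real ^ 'n)|lborel. (0 :: real))"
  proof (rule integral_dominated_convergence[OF _ _ C0(2)[OF f]])
    have "(\<lambda>m. indicator (- cball 0 (real m)) x * norm (f x) powr q) \<longlonglongrightarrow> 0" for x
    proof (rule tendsto_eventually)
      obtain N where "norm x \<le> real N" using real_arch_simple by blast
      then show "\<forall>\<^sub>F m in sequentially. indicator (- cball 0 (real m)) x * norm (f x) powr q = 0"
        by (auto simp: eventually_sequentially indicator_def intro!: exI[of _ N])
    qed
    then show "AE x in lborel. (\<lambda>m. indicator (- cball 0 (real m)) x * norm (f x) powr q) \<longlonglongrightarrow> 0" by simp
  qed (measurable, auto simp: indicator_def)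
  then have "(\<lambda>m. T * (LINT x|lborel. indicator (- cball 0 (real m)) x * norm (f x) powr q)) \<longlonglongrightarrow> 0"
    using tendsto_mult_left[of _ 0 sequentially T] by fastforce
  from order_tendstoD(2)[OF this, of "e / 3"] e
  obtain m where m: "T * (LINT x|lborel. indicator (- cball 0 (real m)) x * norm (f x) powr q) < e / 3"
    by (auto simp: eventually_sequentially)
  have "(\<lambda>n. T * (LINT x|lborel. indicator (cball 0 (real m)) x * norm (U n x - f x) powr q)) \<longlonglongrightarrow> T * 0"
    by (intro tendsto_intros local_convergence[OF W B lim])
  then have ev: "\<forall>\<^sub>F n in sequentially. T * (LINT x|lborel. indicator (cball 0 (real m)) x * norm (U n x - f x) powr q) < e / 3"
    using e by (intro order_tendstoD(2)) auto
  show ?thesis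
    using ev
  proof eventually_elim
    fix n
    assume n: "T * (LINT x|lborel. indicator (cball 0 (real m)) x * norm (U n x - f x) powr q) < e / 3"
    let ?i = "\<lambda>x. indicator (cball 0 (real m)) x * norm (U n x - f x) powr q :: real"
    let ?o = "\<lambda>x. indicator (- cball 0 (real m)) x * norm (f x) powr q :: real"
    \<comment> \<open>Inside the ball \<open>U n - f\<close> takes the large factor T, outside f
      does; the roles in the convexity inequality are exchanged at the boundary.\<close>
    have pw: "norm (U n x) powr q \<le> (A * norm (f x) powr q + A * norm (U n x - f x) powr q) + (T * ?i x + T * ?o x)" for x
    proof (cases "x \<in> cball 0 (real m)")
      case True
      then show ?thesis
        using norm_add_powr_le[of q t "f x" "U n x - f x"] q t A1 by (auto simp: A_def T_def intro: order_trans)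
    next
      case False
      then show ?thesis
        using norm_add_powr_le[of q t "U n x - f x" "f x"] q t A1 by (auto simp: A_def T_def intro: order_trans)
    qed
    have ii: "integrable lborel ?i"
      by (rule Bochner_Integration.integrable_bound[OF C0(2)[OF W[of n]]]) (measurable, auto simp: indicator_def)
    have io: "integrable lborel ?o"
      by (rule Bochner_Integration.integrable_bound[OF C0(2)[OF f]]) (measurable, auto simp: indicator_def)
    note ints = C0(2)[OF f] C0(2)[OF W[of n]] ii io
    have "Lq_mass q (U n) \<le> (LINT x|lborel. (A * norm (f x) powr q + A * norm (U n x - f x) powr q) + (T * ?i x + T * ?o x))"
      unfolding Lq_mass_def
      by (intro integral_mono pw C0(2) U Bochner_Integration.integrable_add integrable_mult_right ints)
    also have "\<dots> = (A * Lq_mass q f + A * Lq_mass q (\<lambda>x. U n x - f x)) +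
        (T * (LINT x|lborel. ?i x) + T * (LINT x|lborel. ?o x))"
      unfolding Lq_mass_def
      by (simp only: Bochner_Integration.integral_add Bochner_Integration.integrable_add integrable_mult_right ints integral_mult_right_zero)
    finally have 1: "Lq_mass q (U n) \<le> (A * Lq_mass q f + A * Lq_mass q (\<lambda>x. U n x - f x)) +
        (T * (LINT x|lborel. ?i x) + T * (LINT x|lborel. ?o x))" .
    have "(A - 1) * (Lq_mass q f + Lq_mass q (\<lambda>x. U n x - f x)) \<le> (A - 1) * M"
      using A1 Wm[of n] by (intro mult_left_mono) (auto simp: M_def)
    then have "A * Lq_mass q f + A * Lq_mass q (\<lambda>x. U n x - f x) \<le>
        Lq_mass q f + Lq_mass q (\<lambda>x. U n x - f x) + e / 3"
      using t(1) unfolding A_def[symmetric] by (simp add: algebra_simps)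
    then show "Lq_mass q (U n) \<le> Lq_mass q f + Lq_mass q (\<lambda>x. U n x - f x) + e"
      using 1 n m by linarith
  qed
qed

end

section \<open>Existence of a minimizer\<close>

context minimization
begin

definition admissible :: "(real ^ 'n \<Rightarrow> complex) set" where
  "admissible = {v \<in> V. Lq_mass q v = 1}"

definition infimum :: real where
  "infimum = (INF v\<in>admissible. (H.nm v)\<^sup>2)"

lemma admissible_normalize:
  assumes u: "u \<in> V" and pos: "Lq_mass q u > 0"
  shows "(\<lambda>x. of_real (Lq_mass q u powr (- 1 / q)) * u x) \<in> admissible"
proof -
  have "(Lq_mass q u powr (- 1 / q)) powr q = Lq_mass q u powr (- 1 / q * q)" by (rule powr_powr)
  also have "- 1 / q * q = - 1" using q by simp
  finally have "(Lq_mass q u powr (- 1 / q)) powr q * Lq_mass q u = 1"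
    using pos by (simp add: powr_minus)
  then show ?thesis
    using H.scale[OF u, of "Lq_mass q u powr (- 1 / q)"] by (simp add: admissible_def Lq_mass_cmult)
qed

lemma Lq_mass_eq_0_iff: "u \<in> V \<Longrightarrow> Lq_mass q u = 0 \<longleftrightarrow> L2.nm lborel u = 0"
proof -
  assume u: "u \<in> V"
  have "Lq_mass q u = 0 \<longleftrightarrow> (AE x in lborel. norm (u x) powr q = 0)"
    unfolding Lq_mass_def by (rule integral_nonneg_eq_0_iff_AE[OF Lq_integrable[OF u]]) simp
  also have "\<dots> \<longleftrightarrow> L2.nm lborel u = 0"
    by (simp add: L2_nm_eq_0[OF sobolev_spaceD(1)[OF u]])
  finally show ?thesis .
qed

lemma admissible_nonempty: "admissible \<noteq> {}"
proof -
  let ?g = "\<lambda>x :: real ^ 'n. complex_of_real (gaussian x)"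
  have g: "?g \<in> V" by (rule gaussian_in_sobolev_space[OF K a])
  have "\<not> (AE x in (lborel :: (real ^ 'n) measure). ?g x = 0)"
    by (simp add: gaussian_def ae_filter_eq_bot_iff flip: trivial_limit_def)
  then have "Lq_mass q ?g \<noteq> 0"
    unfolding Lq_mass_eq_0_iff[OF g] L2_nm_eq_0[OF sobolev_spaceD(1)[OF g]] .
  then have "Lq_mass q ?g > 0" using Lq_mass_nonneg[of q ?g] by linarith
  then show ?thesis using admissible_normalize[OF g] by blast
qed

lemma infimum_le: "v \<in> admissible \<Longrightarrow> infimum \<le> (H.nm v)\<^sup>2"
  unfolding infimum_def by (rule cINF_lower) (auto intro!: bdd_belowI[of _ 0])

lemma infimum_pos: "infimum > 0"
proof -
  obtain C0 where C0: "C0 > 0" "\<And>u. u \<in> V \<Longrightarrow> integrable lborel (\<lambda>x. norm (u x) powr q)"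
    "\<And>u. u \<in> V \<Longrightarrow> Lq_mass q u \<le> C0 * H.nm u powr q"
    by (rule Lq_bound) (rule that)
  define m where "m = (1 / C0) powr (1 / q)"
  have m: "m > 0" using C0 by (simp add: m_def)
  have "m\<^sup>2 \<le> (H.nm v)\<^sup>2" if v: "v \<in> admissible" for v
  proof -
    have vV: "v \<in> V" "Lq_mass q v = 1" using v by (auto simp: admissible_def)
    have "1 / C0 \<le> H.nm v powr q" using C0(3)[OF vV(1)] vV(2) C0(1) by (simp add: field_simps)
    then have "m \<le> (H.nm v powr q) powr (1 / q)"
      unfolding m_def using q C0(1) by (intro powr_mono2) auto
    also have "\<dots> = H.nm v" using q H.nm_nonneg[OF vV(1)] by (simp add: powr_powr)
    finally show ?thesis using m by (intro power_mono) auto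
  qed
  then have "m\<^sup>2 \<le> infimum"
    unfolding infimum_def using admissible_nonempty by (intro cINF_greatest) auto
  then show ?thesis using m by (smt (verit) zero_less_power)
qed

text \<open>The homogeneous form of the minimization problem, obtained by normalizing u. It is
  applied to the weak limit and to the remainder, neither of which is known to have mass 1.\<close>

lemma infimum_scaled_le:
  assumes u: "u \<in> V"
  shows "infimum * Lq_mass q u powr (2 / q) \<le> (H.nm u)\<^sup>2"
proof (cases "Lq_mass q u = 0")
  case False
  then have pos: "Lq_mass q u > 0" using Lq_mass_nonneg[of q u] by linarith
  let ?s = "Lq_mass q u powr (- 1 / q)"
  have "infimum \<le> (H.nm (\<lambda>x. of_real ?s * u x))\<^sup>2"
    by (rule infimum_le[OF admissible_normalize[OF u pos]])
  also have "\<dots> = ?s\<^sup>2 * (H.nm u)\<^sup>2"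
    by (simp add: H.nm_scale[OF u] power_mult_distrib)
  also have "?s\<^sup>2 = Lq_mass q u powr (- (2 / q))"
    by (simp add: power2_eq_square flip: powr_add)
  finally show ?thesis using pos by (simp add: powr_minus field_simps)
qed simp

text \<open>An admissible function has a point where its low frequencies are not small: otherwise
  \<open>L\<^sup>\<infinity>\<close>--\<open>L\<^sup>2\<close> interpolation makes their \<open>L\<^sup>q\<close> norm small, and the high frequencies are small anyway.\<close>

lemma nonvanishing_low_frequencies:
  assumes B: "B \<ge> 0"
  obtains k \<delta> where "\<delta> > 0" "\<And>u. u \<in> admissible \<Longrightarrow> H.nm u \<le> B \<Longrightarrow> \<exists>x. norm (low k u x) > \<delta>"
proof -
  obtain D where D: "D \<ge> 0" "\<And>u k. u \<in> V \<Longrightarrow> integrable lborel (\<lambda>x. norm (u x - low k u x) powr q)"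
    "\<And>u k. u \<in> V \<Longrightarrow> Lq_mass q (\<lambda>x. u x - low k u x) \<le> D * ratio ^ k * H.nm u powr q"
    by (rule tail_bound) (rule that)
  define c2 where "c2 = (1/2 :: real) powr (1 - q)"
  have c2: "c2 > 0" by (simp add: c2_def)
  have "(\<lambda>k. c2 * (D * ratio ^ k * B powr q)) \<longlonglongrightarrow> c2 * (D * 0 * B powr q)"
    using ratio by (intro tendsto_intros LIMSEQ_realpow_zero) auto
  then have "(\<lambda>k. c2 * (D * ratio ^ k * B powr q)) \<longlonglongrightarrow> 0" by simp
  from order_tendstoD(2)[OF this, of "1/4"] obtain k where k: "c2 * (D * ratio ^ k * B powr q) < 1/4"
    by (auto simp: eventually_sequentially)
  \<comment> \<open>Solved from c2 \<delta>^(q-2) ((B / c)^2 + 1) = 1/4; the summand 1 keeps the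
    denominator positive when B = 0. Low and high frequencies then contribute at most 1/4 each, less
    than the mass 1.\<close>
  define \<delta> where "\<delta> = (1 / (4 * c2 * ((B / c)\<^sup>2 + 1))) powr (1 / (q - 2))"
  have pos': "(B / c)\<^sup>2 + 1 > 0" by (intro add_nonneg_pos) auto
  then have pos: "4 * c2 * ((B / c)\<^sup>2 + 1) > 0" using c2 by (intro mult_pos_pos) auto
  have \<delta>: "\<delta> > 0"
    unfolding \<delta>_def powr_gt_zero using divide_pos_pos[OF zero_less_one pos] by (rule less_imp_neq[symmetric])
  have \<delta>q: "c2 * (\<delta> powr (q - 2) * (B / c)\<^sup>2) \<le> 1/4"
  proof -
    have "\<delta> powr (q - 2) = 1 / (4 * c2 * ((B / c)\<^sup>2 + 1))"
      using q pos pos' c2 by (simp add: \<delta>_def powr_powr del: power_divide)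
    then have "c2 * (\<delta> powr (q - 2) * (B / c)\<^sup>2) = (B / c)\<^sup>2 / (4 * ((B / c)\<^sup>2 + 1))"
      using c2 by simp
    also have "\<dots> \<le> 1/4"
      using pos' by (simp add: field_simps del: power_divide)
    finally show ?thesis .
  qed
  have "\<exists>x. norm (low k u x) > \<delta>" if u: "u \<in> admissible" and uB: "H.nm u \<le> B" for u
  proof (rule ccontr)
    assume "\<nexists>x. norm (low k u x) > \<delta>"
    then have small: "norm (low k u x) \<le> \<delta>" for x by (meson not_less)
    have uV: "u \<in> V" "Lq_mass q u = 1" using u by (auto simp: admissible_def)
    note l2 = low_in_L2[OF uV(1), of k]
    have [measurable]: "u \<in> borel_measurable borel" "low k u \<in> borel_measurable borel"
      using V_measurable[OF uV(1)] L2_measurable[OF l2] by auto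
    have "L2.nm lborel (low k u) \<le> B / c"
    proof -
      have "L2.nm lborel (low k u) \<le> L2.nm lborel u"
        by (rule nm_band_le[OF _ subset_refl sobolev_spaceD(1)[OF uV(1)]]) simp
      also have "\<dots> \<le> H.nm u / c" by (rule L2_le_nm[OF uV(1)])
      also have "\<dots> \<le> B / c" using uB c by (intro divide_right_mono) auto
      finally show ?thesis .
    qed
    then have "\<delta> powr (q - 2) * (L2.nm lborel (low k u))\<^sup>2 \<le> \<delta> powr (q - 2) * (B / c)\<^sup>2"
      by (intro mult_left_mono power_mono) auto
    then have lo: "(\<integral>\<^sup>+x. ennreal (norm (low k u x) powr q) \<partial>lborel) \<le> ennreal (\<delta> powr (q - 2) * (B / c)\<^sup>2)"
      using nn_integral_powr_interpolation[OF l2 small, of q] q by (auto intro: order_trans ennreal_leI)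
    have "H.nm u powr q \<le> B powr q" using q uB H.nm_nonneg[OF uV(1)] by (intro powr_mono2) auto
    then have "Lq_mass q (\<lambda>x. u x - low k u x) \<le> D * ratio ^ k * B powr q"
      using D(3)[OF uV(1), of k] D(1) ratio
      by (meson mult_left_mono mult_nonneg_nonneg order_trans zero_le_power less_imp_le)
    then have hi: "(\<integral>\<^sup>+x. ennreal (norm (u x - low k u x) powr q) \<partial>lborel) \<le> ennreal (D * ratio ^ k * B powr q)"
      unfolding Lq_mass_def using nn_integral_eq_integral[OF D(2)[OF uV(1), of k]] by (simp add: ennreal_leI)
    have "ennreal 1 = (\<integral>\<^sup>+x. ennreal (norm ((u x - low k u x) + low k u x) powr q) \<partial>lborel)"
      using nn_integral_eq_integral[OF Lq_integrable[OF uV(1)]] uV(2) by (simp add: Lq_mass_def)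
    also have "\<dots> \<le> ennreal ((1 - 1/2) powr (1 - q)) * (\<integral>\<^sup>+x. ennreal (norm (u x - low k u x) powr q) \<partial>lborel) +
        ennreal ((1/2) powr (1 - q)) * (\<integral>\<^sup>+x. ennreal (norm (low k u x) powr q) \<partial>lborel)"
      by (rule nn_integral_powr_add_le) (use q in simp, simp, simp, measurable)
    also have "\<dots> \<le> ennreal c2 * ennreal (D * ratio ^ k * B powr q) + ennreal c2 * ennreal (\<delta> powr (q - 2) * (B / c)\<^sup>2)"
      using lo hi by (intro add_mono mult_mono) (auto simp: c2_def)
    also have "\<dots> = ennreal (c2 * (D * ratio ^ k * B powr q) + c2 * (\<delta> powr (q - 2) * (B / c)\<^sup>2))"
      using c2 D(1) ratio by (simp add: ennreal_mult ennreal_plus)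
    also have "\<dots> < ennreal 1"
      using k \<delta>q by (intro ennreal_lessI) auto
    finally show False by simp
  qed
  then show thesis using that \<delta> by blast
qed

lemma integer_translate:
  fixes x :: "real ^ 'n"
  obtains y :: "real ^ 'n" where "\<And>i. y $ i \<in> \<int>" "x + y \<in> cbox 0 1"
proof
  show "(\<chi> i. - of_int \<lfloor>x $ i\<rfloor>) $ i \<in> \<int>" for i :: 'n by simp
  show "x + (\<chi> i. - of_int \<lfloor>x $ i\<rfloor>) \<in> cbox 0 1"
    unfolding mem_box_cart using of_int_floor_le real_of_int_floor_add_one_ge by (auto simp: algebra_simps)
qed

theorem infimum_attained: "\<exists>u\<in>admissible. (H.nm u)\<^sup>2 = infimum"
proof -
  have "bdd_below ((\<lambda>v. (H.nm v)\<^sup>2) ` admissible)" by (auto intro!: bdd_belowI[of _ 0])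
  then have "\<exists>v\<in>admissible. (H.nm v)\<^sup>2 < infimum + 1 / real (Suc n)" for n
    using cINF_less_iff[OF admissible_nonempty, of "\<lambda>v. (H.nm v)\<^sup>2" "infimum + 1 / real (Suc n)"]
    by (simp add: infimum_def)
  then obtain X where X: "\<And>n. X n \<in> admissible" "\<And>n. (H.nm (X n))\<^sup>2 < infimum + 1 / real (Suc n)"
    by metis
  have XV: "X n \<in> V" "Lq_mass q (X n) = 1" for n using X(1)[of n] by (auto simp: admissible_def)
  define B where "B = sqrt (infimum + 1)"
  have B: "B \<ge> 0" using infimum_pos by (simp add: B_def)
  have XB: "H.nm (X n) \<le> B" for n
  proof -
    have "1 / real (Suc n) \<le> 1" by simp
    then have "(H.nm (X n))\<^sup>2 \<le> infimum + 1" using X(2)[of n] by linarith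
    then show ?thesis unfolding B_def by (rule real_le_rsqrt)
  qed
  obtain k \<delta> where \<delta>: "\<delta> > 0" "\<And>u. u \<in> admissible \<Longrightarrow> H.nm u \<le> B \<Longrightarrow> \<exists>x. norm (low k u x) > \<delta>"
    by (rule nonvanishing_low_frequencies[OF B]) (rule that)
  have "\<exists>x y. norm (low k (X n) x) > \<delta> \<and> (\<forall>i. y $ i \<in> \<int>) \<and> x + y \<in> cbox 0 1" for n
  proof -
    obtain x where "norm (low k (X n) x) > \<delta>" using \<delta>(2)[OF X(1) XB] by blast
    moreover obtain y where "\<And>i. y $ i \<in> \<int>" "x + y \<in> cbox 0 1" by (rule integer_translate) (rule that)
    ultimately show ?thesis by blast
  qed
  then obtain p y where py: "\<And>n. norm (low k (X n) (p n)) > \<delta>" "\<And>n i. y n $ i \<in> \<int>" "\<And>n. p n + y n \<in> cbox 0 1"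
    by metis
  \<comment> \<open>The lattice translates keep norm and mass, and they carry the points with large
    low frequencies into the unit cube, where compactness gives a limit point w.\<close>
  define Z where "Z n = (\<lambda>x. X n (x - y n))" for n
  define z where "z n = p n + y n" for n
  have Z: "Z n \<in> V" "H.nm (Z n) = H.nm (X n)" "Lq_mass q (Z n) = 1" for n
    unfolding Z_def using sobolev_space_translate[OF XV(1)] invariant[OF XV(1) py(2)]
      Lq_mass_translate[OF V_measurable[OF XV(1)]] XV(2) by auto
  have Zz: "norm (low k (Z n) (z n)) > \<delta>" for n
    using py(1)[of n] band_translate[OF _ subset_refl sobolev_spaceD(1)[OF XV(1)[of n]], of "2 ^ k" "y n" "z n"]
    by (simp add: Z_def z_def)
  have "\<forall>n. z n \<in> cbox 0 1" using py(3) by (simp add: z_def)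
  with compact_cbox[of "0 :: real ^ 'n" 1]
  obtain w s where s: "strict_mono (s :: nat \<Rightarrow> nat)" "(z \<circ> s) \<longlonglongrightarrow> w"
    unfolding compact_def by blast
  have "H.nm (Z (s n)) \<le> B" for n using Z(2) XB by simp
  then obtain f r where f: "f \<in> V" and r: "strict_mono (r :: nat \<Rightarrow> nat)"
    and weak: "\<And>L. H.bounded_functional L \<Longrightarrow> (\<lambda>n. L (Z (s (r n)))) \<longlonglongrightarrow> L f"
    by (rule H.weakly_convergent_subsequence[OF complete Z(1)[of "s _"]]) (rule that)
  define U where "U n = Z (s (r n))" for n
  define v where "v n = z (s (r n))" for n
  have U: "U n \<in> V" "H.nm (U n) \<le> B" "Lq_mass q (U n) = 1" "norm (low k (U n) (v n)) > \<delta>" for n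
    using Z XB Zz by (auto simp: U_def v_def)
  have v: "v \<longlonglongrightarrow> w" using LIMSEQ_subseq_LIMSEQ[OF s(2) r] by (simp add: v_def[abs_def] o_def)
  have U2: "U n \<in> L2 lborel" for n by (rule sobolev_spaceD(1)[OF U(1)])
  note f2 = sobolev_spaceD(1)[OF f]
  have Unorm: "(\<lambda>n. (H.nm (U n))\<^sup>2) \<longlonglongrightarrow> infimum"
  proof -
    have "(\<lambda>n. (H.nm (X n))\<^sup>2) \<longlonglongrightarrow> infimum"
    proof (rule tendsto_sandwich[OF always_eventually always_eventually])
      show "\<forall>n. infimum \<le> (H.nm (X n))\<^sup>2" using infimum_le[OF X(1)] by blast
      show "\<forall>n. (H.nm (X n))\<^sup>2 \<le> infimum + 1 / real (Suc n)" using X(2) by (auto intro: less_imp_le)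
      show "(\<lambda>n. infimum + 1 / real (Suc n)) \<longlonglongrightarrow> infimum"
        using tendsto_add[OF tendsto_const LIMSEQ_Suc[OF lim_const_over_n[of "1::real"]], of infimum] by simp
    qed simp
    from LIMSEQ_subseq_LIMSEQ[OF this strict_mono_o[OF s(1) r]] show ?thesis
      by (simp add: U_def Z(2) o_def)
  qed
  have low_lim: "(\<lambda>n. low j (U n) x) \<longlonglongrightarrow> low j f x" for j x
    using weak[OF low_functional(1)] weak[OF low_functional(2)] unfolding tendsto_complex_iff U_def by blast
  \<comment> \<open>The points \<open>v n\<close> vary with n, while weak convergence speaks about
    fixed points. The uniform Lipschitz bound allows replacing \<open>v n\<close> by w, so the low
    frequencies of f at w have modulus at least \<delta>.\<close>
  have "L2.nm lborel f \<noteq> 0"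
  proof
    assume f0: "L2.nm lborel f = 0"
    obtain L where L: "L \<ge> 0" "\<And>(f :: real ^ 'n \<Rightarrow> complex) x y. f \<in> L2 lborel \<Longrightarrow>
      norm (low k f x - low k f y) \<le> L * norm (x - y) * L2.nm lborel f"
      by (rule low_Lipschitz) (rule that)
    have "(\<lambda>n. low k (U n) (v n) - low k (U n) w) \<longlonglongrightarrow> 0"
    proof (rule Lim_null_comparison[OF always_eventually])
      have "(\<lambda>n. L * norm (v n - w) * (B / c)) \<longlonglongrightarrow> L * norm (w - w) * (B / c)"
        by (intro tendsto_intros v)
      then show "(\<lambda>n. L * norm (v n - w) * (B / c)) \<longlonglongrightarrow> 0" by simp
      have "L2.nm lborel (U n) \<le> B / c" for n
        using L2_le_nm[OF U(1), of n] divide_right_mono[OF U(2)[of n], of c] c by linarith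
      then have "L * norm (v n - w) * L2.nm lborel (U n) \<le> L * norm (v n - w) * (B / c)" for n
        using L(1) by (intro mult_left_mono) auto
      then show "\<forall>n. norm (low k (U n) (v n) - low k (U n) w) \<le> L * norm (v n - w) * (B / c)"
        using L(2)[OF U2] by (meson order_trans)
    qed
    from tendsto_add[OF this low_lim[of k w]] have "(\<lambda>n. low k (U n) (v n)) \<longlonglongrightarrow> low k f w" by simp
    then have "\<delta> \<le> norm (low k f w)"
      by (rule tendsto_lowerbound[OF tendsto_norm always_eventually]) (use less_imp_le[OF U(4)] in auto)
    moreover have "norm (low k f w) \<le> 0" using low_bound[OF f2, of k w] f0 by simp
    ultimately show False using \<delta>(1) by linarith
  qed
  then have "Lq_mass q f \<noteq> 0" using Lq_mass_eq_0_iff[OF f] by blast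
  then have mass_pos: "Lq_mass q f > 0" using Lq_mass_nonneg[of q f] by linarith
  have W: "(\<lambda>x. U n x - f x) \<in> V" for n by (rule H.diff[OF U(1) f])
  have Wlim: "(\<lambda>n. low j (\<lambda>x. U n x - f x) x) \<longlonglongrightarrow> 0" for j x
  proof -
    have "low j (\<lambda>x. U n x - f x) x = low j (U n) x - low j f x" for n
      by (rule band_diff[OF _ subset_refl U2 f2]) simp
    then show ?thesis using low_lim[of j x] by (simp add: LIM_zero)
  qed
  have WB: "H.nm (\<lambda>x. U n x - f x) \<le> B + H.nm f" for n
    using H.nm_diff_le[OF U(1) f, of n] U(2)[of n] by linarith
  \<comment> \<open>The mixed term \<open>b (U n) f\<close> tends to \<open>b f f\<close> because
    pairing with f is a bounded functional; this turns weak convergence into the Pythagorean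
    identity in the limit.\<close>
  have Wnorm: "(\<lambda>n. (H.nm (\<lambda>x. U n x - f x))\<^sup>2) \<longlonglongrightarrow> infimum - (H.nm f)\<^sup>2"
  proof -
    have "(\<lambda>n. (H.nm (U n))\<^sup>2 - 2 * b (U n) f + (H.nm f)\<^sup>2) \<longlonglongrightarrow> infimum - 2 * b f f + (H.nm f)\<^sup>2"
      using weak[OF H.bounded_functional_form[OF f]] unfolding U_def[symmetric]
      by (intro tendsto_intros Unorm)
    then show ?thesis
      by (simp add: H.nm_sq[OF W] H.nm_sq[OF U(1)] H.nm_sq[OF f] H.form_diff_self[OF U(1) f])
  qed
  define t where "t = Lq_mass q f"
  have t0: "t > 0" using mass_pos by (simp add: t_def)
  have ft: "infimum * t powr (2 / q) \<le> (H.nm f)\<^sup>2" unfolding t_def by (rule infimum_scaled_le[OF f])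
  have f_le: "(H.nm f)\<^sup>2 \<le> infimum"
    using tendsto_lowerbound[OF Wnorm, of 0] by simp
  have p: "0 < 2 / q" "2 / q < 1" using q by auto
  \<comment> \<open>Weak lower semicontinuity of the norm, in the form of \<open>f_le\<close>,
    already excludes mass above 1; no Fatou argument in L^q is needed.\<close>
  have t1: "t \<le> 1"
  proof (rule ccontr)
    assume "\<not> t \<le> 1"
    then have "t powr (2 / q) > 1" using p by (intro gr_one_powr) auto
    then have "infimum * t powr (2 / q) > infimum" using infimum_pos by simp
    then show False using ft f_le by linarith
  qed
  have "t = 1"
  proof (rule ccontr)
    assume "t \<noteq> 1"
    then have t1: "t < 1" using t1 by simp
    \<comment> \<open>The loss \<open>e\<close> is chosen such that \<open>(1 - t - e) powr (2 / q) = 1 - t\<close>.\<close>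
    define e where "e = (1 - t) - (1 - t) powr (q / 2)"
    have "(1 - t) powr (q / 2) < (1 - t) powr 1"
      using t0 t1 q by (intro powr_less_mono') auto
    then have e: "e > 0" using t1 by (simp add: e_def)
    \<comment> \<open>Since \<open>U n\<close> has mass 1, the remainder keeps mass at least (1 -
      t)^(q/2); its squared norm is then at least \<open>infimum * (1 - t)\<close>.\<close>
    have ev: "\<forall>\<^sub>F n in sequentially. Lq_mass q (U n) \<le> t + Lq_mass q (\<lambda>x. U n x - f x) + e"
      unfolding t_def by (rule mass_splitting[OF U(1) f WB Wlim e])
    have "\<forall>\<^sub>F n in sequentially. infimum * (1 - t) \<le> (H.nm (\<lambda>x. U n x - f x))\<^sup>2"
      using ev
    proof eventually_elim
      case (elim n)
      then have "(1 - t) powr (q / 2) \<le> Lq_mass q (\<lambda>x. U n x - f x)"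
        using U(3)[of n] by (simp add: e_def)
      then have "((1 - t) powr (q / 2)) powr (2 / q) \<le> Lq_mass q (\<lambda>x. U n x - f x) powr (2 / q)"
        using q by (intro powr_mono2) auto
      moreover have "((1 - t) powr (q / 2)) powr (2 / q) = 1 - t"
        using t1 q by (simp add: powr_powr)
      ultimately have "infimum * (1 - t) \<le> infimum * Lq_mass q (\<lambda>x. U n x - f x) powr (2 / q)"
        using infimum_pos by (intro mult_left_mono) auto
      then show ?case using infimum_scaled_le[OF W, of n] by linarith
    qed
    \<comment> \<open>Added to the lower bound \<open>ft\<close> for f, this gives t^(2/q) \<le> t,
      impossible for 0 < t < 1 because 2/q < 1.\<close>
    then have "infimum * (1 - t) \<le> infimum - (H.nm f)\<^sup>2"
      by (intro tendsto_lowerbound[OF Wnorm]) auto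
    then have "infimum * t powr (2 / q) \<le> infimum * t"
      using ft by (simp add: algebra_simps)
    then have "t powr (2 / q) \<le> t" using infimum_pos by simp
    moreover have "t powr 1 < t powr (2 / q)"
      using t0 t1 p by (intro powr_less_mono') auto
    ultimately show False using t0 by simp
  qed
  then have "f \<in> admissible" using f by (simp add: admissible_def t_def)
  moreover from this have "infimum \<le> (H.nm f)\<^sup>2" by (rule infimum_le)
  ultimately show ?thesis using f_le by (intro bexI[of _ f]) auto
qed

end

text \<open>For N > 2 \<alpha> this clears the denominator of the critical exponent; for N \<le> 2
  \<alpha> it holds for every q > 2, which matches the value infinity.\<close>

lemma subcritical_exponent:
  fixes \<alpha> q N :: real
  assumes a: "\<alpha> > 0" and q: "2 < q" and crit: "N > 2 * \<alpha> \<Longrightarrow> q < 2 * N / (N - 2 * \<alpha>)"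
  shows "N * (q - 2) < 2 * \<alpha> * q"
proof (cases "N > 2 * \<alpha>")
  case True
  then show ?thesis using crit[OF True] by (simp add: field_simps)
next
  case False
  then have "N * (q - 2) \<le> 2 * \<alpha> * (q - 2)" using q by (intro mult_right_mono) auto
  also have "\<dots> < 2 * \<alpha> * q" using a by (simp add: field_simps)
  finally show ?thesis .
qed

text \<open>The real part of a Hermitian form is symmetric and bilinear over the reals and has the
  same diagonal, hence the same norm. This treats both choices of K together.\<close>

lemma hilbert_norm_real_form:
  fixes V :: "(real ^ 'n \<Rightarrow> complex) set"
  assumes K: "K = \<real> \<or> K = UNIV" and V: "(\<lambda>x. 0) \<in> V"
    "\<And>f g. f \<in> V \<Longrightarrow> g \<in> V \<Longrightarrow> (\<lambda>x. f x + g x) \<in> V" "\<And>f c. f \<in> V \<Longrightarrow> (\<lambda>x. of_real c * f x) \<in> V"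
    and nrm: "hilbert_norm_on K V nrm"
  obtains b where "real_form_space V b" "\<And>u. u \<in> V \<Longrightarrow> nrm u = sqrt (b u u)"
proof -
  obtain ip where ip: "inner_product_on K V ip" "\<And>u. u \<in> V \<Longrightarrow> nrm u = sqrt (Re (ip u u))"
    using nrm unfolding hilbert_norm_on_def by blast
  have add: "\<And>u v w. u \<in> V \<Longrightarrow> v \<in> V \<Longrightarrow> w \<in> V \<Longrightarrow> ip (\<lambda>x. u x + v x) w = ip u w + ip v w"
    and scale: "\<And>c u v. c \<in> K \<Longrightarrow> u \<in> V \<Longrightarrow> v \<in> V \<Longrightarrow> ip (\<lambda>x. c * u x) v = c * ip u v"
    and sym: "\<And>u v. u \<in> V \<Longrightarrow> v \<in> V \<Longrightarrow> ip v u = cnj (ip u v)"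
    and nonneg: "\<And>u. u \<in> V \<Longrightarrow> 0 \<le> Re (ip u u)"
    using ip(1) unfolding inner_product_on_def by blast+
  have "real_form_space V (\<lambda>u v. Re (ip u v))"
  proof
    fix f g h and r :: real assume f: "f \<in> V" and g: "g \<in> V"
    show "Re (ip f g) = Re (ip g f)" using sym[OF f g] by simp
    have "complex_of_real r \<in> K" using K by auto
    then show "Re (ip (\<lambda>x. of_real r * f x) g) = r * Re (ip f g)" by (simp add: scale f g)
    assume "h \<in> V"
    then show "Re (ip (\<lambda>x. f x + g x) h) = Re (ip f h) + Re (ip g h)" by (simp add: add f g)
  qed (use V nonneg in auto)
  then show thesis using that ip(2) by blast
qed

theorem theorem6p4:
  fixes \<alpha> q :: real
    and K :: "complex set"
    and nrm :: "(real ^ 'n \<Rightarrow> complex) \<Rightarrow> real"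
  assumes "K = \<real> \<or> K = UNIV"
    and "\<alpha> > 0"
    and "2 < q" and "ereal q < critical_exponent CARD('n) \<alpha>"
    and "nrm = sobolev_norm \<alpha> \<or>
         (hilbert_norm_on K (sobolev_space K \<alpha>) nrm \<and>
          equivalent_norms_on (sobolev_space K \<alpha>) (sobolev_norm \<alpha>) nrm \<and>
          lattice_invariant_on (sobolev_space K \<alpha>) nrm)"
  shows "\<exists>u\<in>sobolev_space K \<alpha>. Lq_norm q u = 1 \<and>
           (nrm u)\<^sup>2 = (INF v\<in>{v \<in> sobolev_space K \<alpha>. Lq_norm q v = 1}. (nrm v)\<^sup>2)"
proof -
  let ?V = "sobolev_space K \<alpha> :: (real ^ 'n \<Rightarrow> complex) set"
  \<comment> \<open>Both alternatives for \<open>nrm\<close> are brought to one shape. For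
    \<open>sobolev_norm\<close> the form is \<open>sobolev_form\<close>, both constants are 1, and
    invariance holds under all translations.\<close>
  obtain b c C where b: "real_form_space ?V b" "\<And>u. u \<in> ?V \<Longrightarrow> nrm u = sqrt (b u u)"
    and cC: "c > 0" "C > 0" "\<And>u. u \<in> ?V \<Longrightarrow> c * sobolev_norm \<alpha> u \<le> nrm u"
      "\<And>u. u \<in> ?V \<Longrightarrow> nrm u \<le> C * sobolev_norm \<alpha> u"
    and inv: "\<And>u y. u \<in> ?V \<Longrightarrow> (\<And>i. y $ i \<in> \<int>) \<Longrightarrow> nrm (\<lambda>x. u (x - y)) = nrm u"
    using assms(5)
  proof
    assume nrm: "nrm = sobolev_norm \<alpha>"
    show thesis
      by (rule that[OF sobolev_real_form_space[OF assms(1)], of 1 1])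
         (auto simp: nrm sobolev_norm_form[symmetric] sobolev_norm_translate)
  next
    assume nrm: "hilbert_norm_on K ?V nrm \<and> equivalent_norms_on ?V (sobolev_norm \<alpha>) nrm \<and> lattice_invariant_on ?V nrm"
    obtain b where b: "real_form_space ?V b" "\<And>u. u \<in> ?V \<Longrightarrow> nrm u = sqrt (b u u)"
      by (rule hilbert_norm_real_form[OF assms(1), of ?V nrm])
         (use nrm assms(1) in \<open>auto intro: sobolev_space_zero sobolev_space_add sobolev_space_cmult that\<close>)
    obtain c C where "c > 0" "C > 0" "\<forall>u\<in>?V. c * sobolev_norm \<alpha> u \<le> nrm u \<and> nrm u \<le> C * sobolev_norm \<alpha> u"
      using nrm unfolding equivalent_norms_on_def by blast
    then show thesis
      using nrm by (intro that[OF b, of c C]) (auto simp: lattice_invariant_on_def)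
  qed
  interpret H: real_form_space ?V b by (rule b(1))
  have nrm: "nrm u = H.nm u" if "u \<in> ?V" for u
    using b(2)[OF that] by (simp add: H.nm_def)
  have sub: "real CARD('n) * (q - 2) < 2 * \<alpha> * q"
    using assms(2-4) by (intro subcritical_exponent) (auto simp: critical_exponent_def)
  interpret M: minimization \<alpha> q "TYPE('n)" K b c C
  proof
    show "H.nm (\<lambda>x. u (x - y)) = H.nm u" if "u \<in> ?V" "\<And>i. y $ i \<in> \<int>" for u y
      using inv[OF that] nrm[OF that(1)] nrm[OF sobolev_space_translate[OF that(1)]] by simp
  qed (use assms sub cC nrm in auto)
  have adm: "{v \<in> ?V. Lq_norm q v = 1} = M.admissible"
    using assms(3) by (auto simp: M.admissible_def Lq_norm_eq_1_iff)
  have "(INF v\<in>M.admissible. (nrm v)\<^sup>2) = M.infimum"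
    unfolding M.infimum_def by (intro INF_cong refl) (auto simp: M.admissible_def nrm)
  moreover obtain u where u: "u \<in> M.admissible" "(H.nm u)\<^sup>2 = M.infimum"
    using M.infimum_attained by blast
  ultimately show ?thesis
    using u unfolding adm by (intro bexI[of _ u]) (use adm nrm in \<open>auto simp: M.admissible_def\<close>)
qed

end
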